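(* Given two regular languages (by finite automata), it is decidable whether they are separable by a language definable in $\mathcal{B}\Sigma_1[<,\mathrm{MOD}]$.
   Context: For $d\ge1$, $\mathcal{B}\Sigma_1[<,\mathrm{MOD}_d]$ is the class of languages defined by finite Boolean combinations of existential first-order sentences over words, where a word $a_1\cdots a_n$ is the structure with domain $\{1,\dots,n\}$, order $<$, letter predicates $P_a$, unary predicates "position $\equiv k \pmod d$" and $0$-ary predicates "word length $\equiv k\pmod d$" for $k\in[1,d]$. $\mathcal{B}\Sigma_1[<,\mathrm{MOD}]$ is the class of languages definable when these modular predicates are available for every $d\ge1$; equivalently it is $\bigcup_{d\ge1}\mathcal{B}\Sigma_1[<,\mathrm{MOD}_d]$. $K,L$ are separable by a class if some member $R$ has $K\subseteq R$, $L\cap R=\emptyset$. *)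

theory Defs
  imports Main "HOL-Library.Nat_Bijection"
begin

datatype recf = Z | S | Proj nat | Comp recf "recf list" | Prim recf recf | Mn recf

inductive ev :: "recf \<Rightarrow> nat list \<Rightarrow> nat \<Rightarrow> bool" where
  ev_Z: "ev Z xs 0"
| ev_S: "ev S (x # xs) (Suc x)"
| ev_Proj: "i < length xs \<Longrightarrow> ev (Proj i) xs (xs ! i)"
| ev_Comp: "length ys = length gs \<Longrightarrow> (\<forall>i < length gs. ev (gs ! i) xs (ys ! i))
            \<Longrightarrow> ev f ys z \<Longrightarrow> ev (Comp f gs) xs z"
| ev_Prim0: "ev f xs y \<Longrightarrow> ev (Prim f g) (0 # xs) y"
| ev_PrimS: "ev (Prim f g) (n # xs) y \<Longrightarrow> ev g (y # n # xs) z \<Longrightarrow> ev (Prim f g) (Suc n # xs) z"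
| ev_Mn: "ev f (n # xs) 0 \<Longrightarrow> (\<forall>m < n. \<exists>y. ev f (m # xs) (Suc y)) \<Longrightarrow> ev (Mn f) xs n"

definition decidable_nat :: "(nat \<Rightarrow> bool) \<Rightarrow> bool" where
  "decidable_nat P \<longleftrightarrow> (\<exists>f. \<forall>n. ev f [n] (if P n then 1 else 0))"

text \<open>An NFA: (initial states, final states, transitions (p, a, q)).\<close>
type_synonym nfa = "nat list \<times> nat list \<times> (nat \<times> nat \<times> nat) list"

fun nfa_run :: "(nat \<times> nat \<times> nat) list \<Rightarrow> nat \<Rightarrow> nat list \<Rightarrow> nat \<Rightarrow> bool" where
  "nfa_run \<delta> p [] q \<longleftrightarrow> p = q"
| "nfa_run \<delta> p (a # w) q \<longleftrightarrow> (\<exists>p'. (p, a, p') \<in> set \<delta> \<and> nfa_run \<delta> p' w q)"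

definition nfa_lang :: "nat \<Rightarrow> nfa \<Rightarrow> nat list set" where
  "nfa_lang m A = (case A of (I, F, \<delta>) \<Rightarrow>
     {w \<in> lists {0..<m}. \<exists>p \<in> set I. \<exists>q \<in> set F. nfa_run \<delta> p w q})"

definition encode_nfa :: "nfa \<Rightarrow> nat" where
  "encode_nfa A = (case A of (I, F, \<delta>) \<Rightarrow>
     prod_encode (list_encode I, prod_encode (list_encode F,
       list_encode (map (\<lambda>(p, a, q). prod_encode (p, prod_encode (a, q))) \<delta>))))"

definition encode_input :: "nat \<Rightarrow> nfa \<Rightarrow> nfa \<Rightarrow> nat" where
  "encode_input m A B = prod_encode (m, prod_encode (encode_nfa A, encode_nfa B))"

text \<open>Quantifier-free formulas; variables are natural-number indices, positions are 1..|w|.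
 PosMod k x: position x is congruent to k mod d.  LenMod k: |w| is congruent to k mod d.\<close>
datatype qf = TT | Less nat nat | Equal nat nat | Letter nat nat
  | PosMod nat nat | LenMod nat | Neg qf | Conj qf qf | Disj qf qf

fun qf_vars :: "qf \<Rightarrow> nat set" where
  "qf_vars TT = {}"
| "qf_vars (Less x y) = {x, y}"
| "qf_vars (Equal x y) = {x, y}"
| "qf_vars (Letter a x) = {x}"
| "qf_vars (PosMod k x) = {x}"
| "qf_vars (LenMod k) = {}"
| "qf_vars (Neg \<phi>) = qf_vars \<phi>"
| "qf_vars (Conj \<phi> \<psi>) = qf_vars \<phi> \<union> qf_vars \<psi>"
| "qf_vars (Disj \<phi> \<psi>) = qf_vars \<phi> \<union> qf_vars \<psi>"

fun qf_uses_mod :: "nat \<Rightarrow> qf \<Rightarrow> bool" where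
  "qf_uses_mod d (PosMod k x) \<longleftrightarrow> k \<in> {1..d}"
| "qf_uses_mod d (LenMod k) \<longleftrightarrow> k \<in> {1..d}"
| "qf_uses_mod d (Neg \<phi>) \<longleftrightarrow> qf_uses_mod d \<phi>"
| "qf_uses_mod d (Conj \<phi> \<psi>) \<longleftrightarrow> qf_uses_mod d \<phi> \<and> qf_uses_mod d \<psi>"
| "qf_uses_mod d (Disj \<phi> \<psi>) \<longleftrightarrow> qf_uses_mod d \<phi> \<and> qf_uses_mod d \<psi>"
| "qf_uses_mod d _ \<longleftrightarrow> True"

fun qf_sat :: "nat \<Rightarrow> nat list \<Rightarrow> (nat \<Rightarrow> nat) \<Rightarrow> qf \<Rightarrow> bool" where
  "qf_sat d w v TT \<longleftrightarrow> True"
| "qf_sat d w v (Less x y) \<longleftrightarrow> v x < v y"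
| "qf_sat d w v (Equal x y) \<longleftrightarrow> v x = v y"
| "qf_sat d w v (Letter a x) \<longleftrightarrow> w ! (v x - 1) = a"
| "qf_sat d w v (PosMod k x) \<longleftrightarrow> v x mod d = k mod d"
| "qf_sat d w v (LenMod k) \<longleftrightarrow> length w mod d = k mod d"
| "qf_sat d w v (Neg \<phi>) \<longleftrightarrow> \<not> qf_sat d w v \<phi>"
| "qf_sat d w v (Conj \<phi> \<psi>) \<longleftrightarrow> qf_sat d w v \<phi> \<and> qf_sat d w v \<psi>"
| "qf_sat d w v (Disj \<phi> \<psi>) \<longleftrightarrow> qf_sat d w v \<phi> \<or> qf_sat d w v \<psi>"

text \<open>An existential sentence (n, phi) stands for  exists x_0 ... x_{n-1}. phi,
 where all variables of phi are among x_0..x_{n-1}.\<close>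
type_synonym sigma1 = "nat \<times> qf"

definition sigma1_sat :: "nat \<Rightarrow> nat list \<Rightarrow> sigma1 \<Rightarrow> bool" where
  "sigma1_sat d w s = (case s of (n, \<phi>) \<Rightarrow>
     \<exists>v. (\<forall>i < n. v i \<in> {1..length w}) \<and> qf_sat d w v \<phi>)"

definition sigma1_wf :: "nat \<Rightarrow> sigma1 \<Rightarrow> bool" where
  "sigma1_wf d s = (case s of (n, \<phi>) \<Rightarrow> qf_vars \<phi> \<subseteq> {..<n} \<and> qf_uses_mod d \<phi>)"

datatype bsigma1 = BAtom sigma1 | BNot bsigma1 | BAnd bsigma1 bsigma1 | BOr bsigma1 bsigma1

fun bs_wf :: "nat \<Rightarrow> bsigma1 \<Rightarrow> bool" where
  "bs_wf d (BAtom s) \<longleftrightarrow> sigma1_wf d s"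
| "bs_wf d (BNot \<phi>) \<longleftrightarrow> bs_wf d \<phi>"
| "bs_wf d (BAnd \<phi> \<psi>) \<longleftrightarrow> bs_wf d \<phi> \<and> bs_wf d \<psi>"
| "bs_wf d (BOr \<phi> \<psi>) \<longleftrightarrow> bs_wf d \<phi> \<and> bs_wf d \<psi>"

fun bs_sat :: "nat \<Rightarrow> nat list \<Rightarrow> bsigma1 \<Rightarrow> bool" where
  "bs_sat d w (BAtom s) \<longleftrightarrow> sigma1_sat d w s"
| "bs_sat d w (BNot \<phi>) \<longleftrightarrow> \<not> bs_sat d w \<phi>"
| "bs_sat d w (BAnd \<phi> \<psi>) \<longleftrightarrow> bs_sat d w \<phi> \<and> bs_sat d w \<psi>"
| "bs_sat d w (BOr \<phi> \<psi>) \<longleftrightarrow> bs_sat d w \<phi> \<or> bs_sat d w \<psi>"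

definition BSigma1_MODd :: "nat \<Rightarrow> nat \<Rightarrow> nat list set set" where
  "BSigma1_MODd m d = {R. \<exists>\<phi>. bs_wf d \<phi> \<and> R = {w \<in> lists {0..<m}. bs_sat d w \<phi>}}"

definition BSigma1_MOD :: "nat \<Rightarrow> nat list set set" where
  "BSigma1_MOD m = (\<Union>d \<in> {1..}. BSigma1_MODd m d)"

definition separable :: "nat list set set \<Rightarrow> nat list set \<Rightarrow> nat list set \<Rightarrow> bool" where
  "separable C K L \<longleftrightarrow> (\<exists>R \<in> C. K \<subseteq> R \<and> L \<inter> R = {})"

end

theory Submission
  imports Defs "HOL-Library.Sublist" "HOL-Library.Multiset_Order"
begin

text \<open>
  Pair every letter of a word with its position modulo \<open>d\<close>. Two languages are separable with modulus \<open>d\<close>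
  iff for some \<open>k\<close> no word of one agrees with a word of the other in its length modulo \<open>d\<close> and in the
  scattered subwords of length at most \<open>k\<close> of the enriched words.

  If this fails for all \<open>k\<close>, choose a product of atoms (an optional letter, or all words over an
  alphabet \<open>C\<close>) that is minimal among those covering such pairs for every \<open>k\<close>. Membership in a product
  is determined by short subwords, and replacing \<open>C\<^sup>*\<close> by the words over \<open>C\<close> that avoid a fixed word
  yields a smaller product; so by minimality both words of some pair factorize along the same product,
  with every block over \<open>C\<close> rich enough to contain a loop of its automaton that reads exactly \<open>C\<close>.

  For \<open>d = (N!)\<^sup>2\<^sup>N\<close>, with \<open>N\<close> bounding the numbers of states, each block then has a modulus \<open>c\<close>
  dividing \<open>d\<close> such that both automata have, over the same letters modulo \<open>c\<close>, two loops whose lengths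
  differ by \<open>c\<close>. Such loops can be pumped to agree modulo every multiple of \<open>d\<close>. Hence inseparability is
  witnessed by a path in the product of the two automata, and separability by a finite set of
  invariants; both kinds of witnesses can be enumerated.
\<close>

section \<open>Recursive functions on encoded data\<close>

text \<open>The obstacle is that the modulus is not fixed: inseparability means that every modulus
  and every precision fails, yet its witness has to be one finite object. Raising the modulus or the
  precision only refines the equivalence, so it suffices to defeat all multiples of one fixed
  modulus. A single loop per block does not achieve this. With two loops whose lengths differ by
  \<open>c\<close>, the positions behind them can be shifted by any multiple of \<open>c\<close>, so
  a letter can be placed on every residue that is compatible with its residue modulo
  \<open>c\<close>. The constant: replacing a modulus that is too coarse multiplies it by a factor
  between 2 and \<open>N\<close> and removes a state from a set of at most \<open>N\<close> states.
  With two automata this happens at most \<open>2 * N\<close> times, and every factor divides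
  \<open>N!\<close>. The minimal product exists by well-foundedness of a multiset order, an argument
  that yields no bound on the precision. This is why the problem is decided by two searches running
  side by side and not by bounding \<open>k\<close>.\<close>

definition rfun :: "nat \<Rightarrow> (nat list \<Rightarrow> nat) \<Rightarrow> bool" where
  "rfun n F \<longleftrightarrow> (\<exists>r. \<forall>xs. length xs = n \<longrightarrow> ev r xs (F xs))"

lemma rfun_cong: "rfun n F \<Longrightarrow> (\<And>xs. length xs = n \<Longrightarrow> F xs = G xs) \<Longrightarrow> rfun n G"
  unfolding rfun_def by metis

lemma rfun_proj: "i < n \<Longrightarrow> rfun n (\<lambda>xs. xs ! i)"
  unfolding rfun_def using ev_Proj by blast

lemma rfun_comp:
  assumes F: "rfun (length Gs) F" and Gs: "\<And>G. G \<in> set Gs \<Longrightarrow> rfun n G"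
  shows "rfun n (\<lambda>xs. F (map (\<lambda>G. G xs) Gs))"
proof -
  obtain f where f: "length ys = length Gs \<Longrightarrow> ev f ys (F ys)" for ys
    using F unfolding rfun_def by blast
  obtain r where r: "G \<in> set Gs \<Longrightarrow> length xs = n \<Longrightarrow> ev (r G) xs (G xs)" for G xs
    using Gs unfolding rfun_def by metis
  have "ev (Comp f (map r Gs)) xs (F (map (\<lambda>G. G xs) Gs))" if "length xs = n" for xs
    by (rule ev_Comp[where ys = "map (\<lambda>G. G xs) Gs"]) (auto simp: f intro: r that)
  then show ?thesis unfolding rfun_def by blast
qed

lemma rfun_prim:
  assumes "rfun n f" "rfun (Suc (Suc n)) g"
  shows "rfun (Suc n) (\<lambda>xs. rec_nat (f (tl xs)) (\<lambda>i y. g (y # i # tl xs)) (hd xs))"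
proof -
  obtain rf rg where rf: "length xs = n \<Longrightarrow> ev rf xs (f xs)"
    and rg: "length ys = Suc (Suc n) \<Longrightarrow> ev rg ys (g ys)" for xs ys
    using assms unfolding rfun_def by blast
  have "ev (Prim rf rg) (k # xs) (rec_nat (f xs) (\<lambda>i y. g (y # i # xs)) k)" if "length xs = n" for k xs
  proof (induction k)
    case 0
    show ?case using ev_Prim0 rf that by simp
  next
    case (Suc k)
    show ?case using ev_PrimS[OF Suc] rg that by simp
  qed
  then have "ev (Prim rf rg) xs (rec_nat (f (tl xs)) (\<lambda>i y. g (y # i # tl xs)) (hd xs))"
    if "length xs = Suc n" for xs
    using that by (cases xs) auto
  then show ?thesis unfolding rfun_def by blast
qed

text \<open>\<open>Mn\<close> asks for a positive value at every smaller argument. For a total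
  \<open>f\<close> this is just minimality, so the existence of a zero is all that remains.\<close>

lemma rfun_Least:
  assumes "rfun (Suc n) f" and ex: "\<And>xs. length xs = n \<Longrightarrow> \<exists>k. f (k # xs) = 0"
  shows "rfun n (\<lambda>xs. LEAST k. f (k # xs) = 0)"
proof -
  obtain r where r: "length xs = Suc n \<Longrightarrow> ev r xs (f xs)" for xs
    using assms(1) unfolding rfun_def by blast
  have "ev (Mn r) xs (LEAST k. f (k # xs) = 0)" if xs: "length xs = n" for xs
  proof (rule ev_Mn)
    have "f ((LEAST k. f (k # xs) = 0) # xs) = 0" using ex[OF xs] by (auto intro: LeastI)
    then show "ev r ((LEAST k. f (k # xs) = 0) # xs) 0"
      using r[of "(LEAST k. f (k # xs) = 0) # xs"] xs by simp
    show "\<forall>m<(LEAST k. f (k # xs) = 0). \<exists>y. ev r (m # xs) (Suc y)"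
    proof (intro allI impI)
      fix m assume "m < (LEAST k. f (k # xs) = 0)"
      then have "f (m # xs) \<noteq> 0" using not_less_Least by blast
      then show "\<exists>y. ev r (m # xs) (Suc y)" using r[of "m # xs"] xs
        by (metis length_Cons not0_implies_Suc)
    qed
  qed
  then show ?thesis unfolding rfun_def by blast
qed

lemma rfun_Suc: "rfun n f \<Longrightarrow> rfun n (\<lambda>xs. Suc (f xs))"
proof -
  assume f: "rfun n f"
  have "ev S xs (Suc (hd xs))" if "length xs = 1" for xs
    using ev_S that by (cases xs) auto
  then have "rfun (length [f]) (\<lambda>xs. Suc (hd xs))" unfolding rfun_def by auto
  from rfun_comp[OF this, of n] f show ?thesis by simp
qed

lemma rfun_const: "rfun n (\<lambda>xs. c)"
proof (induction c)
  case 0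
  show ?case unfolding rfun_def using ev_Z by blast
qed (rule rfun_Suc)

lemma rfun_rec:
  assumes "rfun n f" "rfun n k" "rfun (Suc (Suc n)) g"
  shows "rfun n (\<lambda>xs. rec_nat (f xs) (\<lambda>i y. g (y # i # xs)) (k xs))"
proof -
  let ?Gs = "k # map (\<lambda>i xs. xs ! i) [0..<n]"
  have "rfun n (\<lambda>xs. (\<lambda>xs. rec_nat (f (tl xs)) (\<lambda>i y. g (y # i # tl xs)) (hd xs)) (map (\<lambda>G. G xs) ?Gs))"
    by (rule rfun_comp) (use assms rfun_prim[OF assms(1,3)] in \<open>auto intro: rfun_proj\<close>)
  then show ?thesis
    by (rule rfun_cong) (auto simp: o_def map_nth)
qed

lemma rfun_comp1: "rfun 1 F \<Longrightarrow> rfun n f \<Longrightarrow> rfun n (\<lambda>xs. F [f xs])"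
  using rfun_comp[of "[f]" F n] by simp

lemma rfun_add: "rfun n f \<Longrightarrow> rfun n g \<Longrightarrow> rfun n (\<lambda>xs. f xs + g xs)"
proof -
  assume "rfun n f" "rfun n g"
  then have "rfun n (\<lambda>xs. rec_nat (f xs) (\<lambda>i y. Suc ((y # i # xs) ! 0)) (g xs))"
    by (intro rfun_rec rfun_Suc rfun_proj) auto
  moreover have "rec_nat a (\<lambda>i y. Suc ((y # i # xs) ! 0)) b = a + b" for a b and xs :: "nat list"
    by (induction b) auto
  ultimately show ?thesis by simp
qed

lemma rfun_diff: "rfun n f \<Longrightarrow> rfun n g \<Longrightarrow> rfun n (\<lambda>xs. f xs - g xs)"
proof -
  have P: "rfun n (\<lambda>xs. f xs - 1)" if "rfun n f" for n f
  proof -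
    have "rfun n (\<lambda>xs. rec_nat 0 (\<lambda>i y. (y # i # xs) ! 1) (f xs))"
      by (intro rfun_rec rfun_const rfun_proj that) auto
    moreover have "rec_nat 0 (\<lambda>i y. (y # i # xs) ! 1) a = a - 1" for a and xs :: "nat list"
      by (cases a) auto
    ultimately show ?thesis by simp
  qed
  assume "rfun n f" "rfun n g"
  then have "rfun n (\<lambda>xs. rec_nat (f xs) (\<lambda>i y. ((y # i # xs) ! 0) - 1) (g xs))"
    by (intro rfun_rec P rfun_proj) auto
  moreover have "rec_nat a (\<lambda>i y. ((y # i # xs) ! 0) - 1) b = a - b" for a b and xs :: "nat list"
    by (induction b) auto
  ultimately show ?thesis by simp
qed

lemma rfun_triangle: "rfun n f \<Longrightarrow> rfun n (\<lambda>xs. triangle (f xs))"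
proof -
  assume "rfun n f"
  then have "rfun n (\<lambda>xs. rec_nat 0 (\<lambda>i y. ((y # i # xs) ! 0) + Suc ((y # i # xs) ! 1)) (f xs))"
    by (intro rfun_rec rfun_add rfun_Suc rfun_proj rfun_const) auto
  moreover have "rec_nat 0 (\<lambda>i y. ((y # i # xs) ! 0) + Suc ((y # i # xs) ! 1)) a = triangle a" for a and xs :: "nat list"
    by (induction a) auto
  ultimately show ?thesis by simp
qed

lemma rfun_prod_encode:
  "rfun n f \<Longrightarrow> rfun n g \<Longrightarrow> rfun n (\<lambda>xs. prod_encode (f xs, g xs))"
  unfolding prod_encode_def by (simp, intro rfun_add rfun_triangle)

lemma mono_triangle: "a \<le> b \<Longrightarrow> triangle a \<le> triangle b"
  by (induction rule: dec_induct) auto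

text \<open>In the Cantor pairing \<open>k = triangle (a + b) + a\<close>, the diagonal
  \<open>a + b\<close> is the least \<open>s\<close> with \<open>k < triangle (Suc s)\<close>. The
  truncated difference expresses this inequality as the vanishing of a number, the form that
  minimisation accepts.\<close>

lemma prod_decode_eq_Least:
  assumes "s = (LEAST s. Suc k - triangle (Suc s) = 0)"
  shows "fst (prod_decode k) = k - triangle s" "snd (prod_decode k) = s - (k - triangle s)"
proof -
  obtain a b where ab: "prod_decode k = (a, b)" by fastforce
  have k: "k = triangle (a + b) + a"
    using prod_decode_inverse[of k] unfolding ab prod_encode_def by simp
  have "s = a + b"
    unfolding assms
  proof (rule Least_equality)
    show "Suc k - triangle (Suc (a + b)) = 0" unfolding triangle_Suc k by arith
    fix y assume y: "Suc k - triangle (Suc y) = 0"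
    show "a + b \<le> y"
    proof (rule ccontr)
      assume "\<not> a + b \<le> y"
      then have "triangle (Suc y) \<le> triangle (a + b)" by (intro mono_triangle) simp
      then show False using y k by arith
    qed
  qed
  then have a: "k - triangle s = a" and "s - a = b" using k by arith+
  then show "fst (prod_decode k) = k - triangle s" "snd (prod_decode k) = s - (k - triangle s)"
    unfolding ab a by simp_all
qed

lemma rfun_prod_decode:
  assumes "rfun n f"
  shows "rfun n (\<lambda>xs. fst (prod_decode (f xs)))" "rfun n (\<lambda>xs. snd (prod_decode (f xs)))"
proof -
  define T where "T k = (LEAST s. Suc k - triangle (Suc s) = 0)" for k
  have ge: "k \<le> triangle k" for k by (induction k) auto
  have "rfun 1 (\<lambda>xs. LEAST s. (\<lambda>ys. Suc (ys ! 1) - triangle (Suc (ys ! 0))) (s # xs) = 0)"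
  proof (rule rfun_Least)
    show "rfun (Suc 1) (\<lambda>ys. Suc (ys ! 1) - triangle (Suc (ys ! 0)))"
      by (intro rfun_diff rfun_Suc rfun_triangle rfun_proj) auto
    fix xs :: "nat list"
    show "\<exists>k. Suc ((k # xs) ! 1) - triangle (Suc ((k # xs) ! 0)) = 0"
      by (intro exI[of _ "xs ! 0"]) (use ge[of "Suc (xs ! 0)"] in simp)
  qed
  then have "rfun 1 (\<lambda>xs. T (xs ! 0))" by (simp add: T_def)
  from rfun_comp1[OF this assms] have T: "rfun n (\<lambda>xs. T (f xs))" by simp
  then have "rfun n (\<lambda>xs. f xs - triangle (T (f xs)))"
    "rfun n (\<lambda>xs. T (f xs) - (f xs - triangle (T (f xs))))"
    by (intro rfun_diff rfun_triangle assms T)+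
  then show "rfun n (\<lambda>xs. fst (prod_decode (f xs)))" "rfun n (\<lambda>xs. snd (prod_decode (f xs)))"
    by (simp_all only: prod_decode_eq_Least[OF T_def])
qed

section \<open>Data types coded bijectively by numbers\<close>

class gcode =
  fixes gnum :: "'a \<Rightarrow> nat"
  assumes bij_gnum: "bij gnum"

instantiation nat :: gcode
begin
definition "gnum_nat = (\<lambda>n::nat. n)"
instance by standard (auto simp: gnum_nat_def bij_def)
end

text \<open>The instances for pairs and lists copy the encodings of the problem, so that an encoded
  input is simply \<open>gnum\<close> of a triple.\<close>

instantiation prod :: (gcode, gcode) gcode
begin
definition "gnum_prod = prod_encode \<circ> map_prod gnum gnum"
instance
proof
  have "bij (map_prod (gnum :: 'a \<Rightarrow> nat) (gnum :: 'b \<Rightarrow> nat))"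
    using bij_gnum[where 'a = 'a] bij_gnum[where 'a = 'b]
    by (simp add: bij_def prod.inj_map map_prod_surj)
  then show "bij (gnum :: 'a \<times> 'b \<Rightarrow> nat)"
    unfolding gnum_prod_def by (intro bij_comp bij_prod_encode)
qed
end

instantiation list :: (gcode) gcode
begin
definition "gnum_list = list_encode \<circ> map gnum"
instance
proof
  have "bij (map (gnum :: 'a \<Rightarrow> nat))"
    using bij_gnum[where 'a = 'a] lists_image[of "gnum :: 'a \<Rightarrow> nat" UNIV]
    by (simp add: bij_def list.inj_map lists_UNIV)
  then show "bij (gnum :: 'a list \<Rightarrow> nat)"
    unfolding gnum_list_def by (intro bij_comp bij_list_encode)
qed
end

text \<open>Bijectivity makes decoding total: every number is a valid code, so a search over numbers
  is a search over the type, without a test for well-formed codes.\<close>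

definition gden :: "nat \<Rightarrow> 'a::gcode" where "gden = inv gnum"

lemma gden_gnum [simp]: "gden (gnum x) = x"
  by (simp add: gden_def bij_gnum bij_is_inj)

lemma gnum_gden [simp]: "gnum (gden n) = n"
  by (simp add: gden_def bij_gnum bij_is_surj surj_f_inv_f)

lemma gnum_eq_iff [simp]: "gnum x = gnum y \<longleftrightarrow> x = y"
  by (metis gden_gnum)

lemma gnum_nat [simp]: "gnum (n::nat) = n"
  by (simp add: gnum_nat_def)

lemma gden_nat [simp]: "gden n = (n::nat)"
  by (metis gden_gnum gnum_nat)

lemma gnum_Pair [simp]: "gnum (x, y) = prod_encode (gnum x, gnum y)"
  by (simp add: gnum_prod_def)

lemma gnum_fst: "gnum (fst p) = fst (prod_decode (gnum p))"
  by (cases p) simp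

lemma gnum_snd: "gnum (snd p) = snd (prod_decode (gnum p))"
  by (cases p) simp

lemma gnum_Nil [simp]: "gnum [] = 0"
  by (simp add: gnum_list_def)

lemma gnum_Cons [simp]: "gnum (x # xs) = Suc (prod_encode (gnum x, gnum xs))"
  by (simp add: gnum_list_def)

section \<open>Computable functions and decidable predicates on coded types\<close>

definition computable :: "('a::gcode \<Rightarrow> 'b::gcode) \<Rightarrow> bool" where
  "computable f \<longleftrightarrow> rfun 1 (\<lambda>xs. gnum (f (gden (xs ! 0))))"

lemma computable_id: "computable (\<lambda>x. x)"
  by (simp add: computable_def rfun_proj)

lemma computable_const: "computable (\<lambda>x. c)"
  by (simp add: computable_def rfun_const)

lemma computable_compose: "computable f \<Longrightarrow> computable g \<Longrightarrow> computable (\<lambda>x. f (g x))"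
  unfolding computable_def
  by (drule rfun_comp1, assumption) (simp add: o_def)

lemma computable_Pair: "computable f \<Longrightarrow> computable g \<Longrightarrow> computable (\<lambda>x. (f x, g x))"
  unfolding computable_def by (simp add: rfun_prod_encode)

lemma computable_fst: "computable f \<Longrightarrow> computable (\<lambda>x. fst (f x))"
  unfolding computable_def by (simp add: gnum_fst rfun_prod_decode)

lemma computable_snd: "computable f \<Longrightarrow> computable (\<lambda>x. snd (f x))"
  unfolding computable_def by (simp add: gnum_snd rfun_prod_decode)

text \<open>The arguments of the step function are packed into nested pairs because
  \<open>computable\<close> speaks about unary functions. The recursion runs on codes, and
  \<open>gnum\<close> commutes with each of its steps.\<close>

lemma computable_rec_nat:
  assumes f: "computable f" and k: "computable k"
    and g: "computable (\<lambda>p. g (fst (fst p)) (snd (fst p)) (snd p))"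
  shows "computable (\<lambda>x. rec_nat (f x) (g x) (k x))"
proof -
  let ?g = "\<lambda>p. g (fst (fst p)) (snd (fst p)) (snd p)"
  have pair: "gden (prod_encode (prod_encode (a, i), y)) = ((gden a :: 'a, i), gden y :: 'b)"
    for a i y
    using gden_gnum[of "((gden a :: 'a, i), gden y :: 'b)"] by simp
  have G: "rfun 1 (\<lambda>xs. gnum (?g (gden (xs ! 0))))"
    using g by (simp add: computable_def)
  have "rfun (Suc (Suc 1)) (\<lambda>ys. (\<lambda>xs. gnum (?g (gden (xs ! 0))))
        [prod_encode (prod_encode (ys ! 2, ys ! 1), ys ! 0)])"
    by (intro rfun_comp1[OF G] rfun_prod_encode rfun_proj) auto
  then have "rfun (Suc (Suc 1)) (\<lambda>ys. gnum (g (gden (ys ! 2)) (ys ! 1) (gden (ys ! 0))))"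
    by (simp add: pair)
  from rfun_rec[OF f[unfolded computable_def] k[unfolded computable_def] this]
  have "rfun 1 (\<lambda>xs. rec_nat (gnum (f (gden (xs ! 0))))
    (\<lambda>i y. gnum (g (gden (xs ! 0)) i (gden y))) (k (gden (xs ! 0))))"
    by simp
  moreover have "rec_nat (gnum (f x)) (\<lambda>i y. gnum (g x i (gden y))) n = gnum (rec_nat (f x) (g x) n)" for x n
    by (induction n) auto
  ultimately show ?thesis
    by (simp add: computable_def)
qed

lemma computable_Suc: "computable f \<Longrightarrow> computable (\<lambda>x. Suc (f x))"
  by (simp add: computable_def rfun_Suc)

lemma computable_add: "computable f \<Longrightarrow> computable g \<Longrightarrow> computable (\<lambda>x. f x + g x :: nat)"
  by (simp add: computable_def rfun_add)

lemma computable_diff: "computable f \<Longrightarrow> computable g \<Longrightarrow> computable (\<lambda>x. f x - g x :: nat)"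
  by (simp add: computable_def rfun_diff)

lemma computable_Cons: "computable f \<Longrightarrow> computable g \<Longrightarrow> computable (\<lambda>x. f x # g x)"
  by (simp add: computable_def rfun_prod_encode rfun_Suc)

lemma computable_case_nat:
  assumes "computable f" "computable k" "computable (\<lambda>p. g (fst p) (snd p))"
  shows "computable (\<lambda>x. case k x of 0 \<Rightarrow> f x | Suc i \<Rightarrow> g x i)"
proof -
  have "computable (\<lambda>x. rec_nat (f x) (\<lambda>i _. g x i) (k x))"
    using computable_compose[OF assms(3) computable_fst[OF computable_id]]
    by (intro computable_rec_nat assms) simp
  moreover have "rec_nat (f x) (\<lambda>i _. g x i) (k x) = (case k x of 0 \<Rightarrow> f x | Suc i \<Rightarrow> g x i)" for x
    by (cases "k x") auto
  ultimately show ?thesis by simp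
qed

definition dec_pred :: "('a::gcode \<Rightarrow> bool) \<Rightarrow> bool" where
  "dec_pred P \<longleftrightarrow> computable (\<lambda>x. of_bool (P x) :: nat)"

lemma dec_pred_iff: "computable f \<Longrightarrow> (\<And>x. P x \<longleftrightarrow> f x = (0::nat)) \<Longrightarrow> dec_pred P"
proof -
  assume f: "computable f" and P: "\<And>x. P x \<longleftrightarrow> f x = (0::nat)"
  have "computable (\<lambda>x. 1 - f x)" by (intro computable_diff computable_const f)
  moreover have "1 - f x = of_bool (P x)" for x using P[of x] by auto
  ultimately show ?thesis by (simp add: dec_pred_def)
qed

lemma dec_pred_compose: "dec_pred P \<Longrightarrow> computable f \<Longrightarrow> dec_pred (\<lambda>x. P (f x))"
  unfolding dec_pred_def by (rule computable_compose)

lemma dec_pred_compose2: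
  assumes "dec_pred (\<lambda>p. P (fst p) (snd p))" "computable f" "computable g"
  shows "dec_pred (\<lambda>x. P (f x) (g x))"
  using dec_pred_compose[OF assms(1) computable_Pair[OF assms(2,3)]] by simp

lemma dec_pred_not: "dec_pred P \<Longrightarrow> dec_pred (\<lambda>x. \<not> P x)"
  unfolding dec_pred_def[of P] by (erule dec_pred_iff) auto

lemma dec_pred_conj: "dec_pred P \<Longrightarrow> dec_pred Q \<Longrightarrow> dec_pred (\<lambda>x. P x \<and> Q x)"
  by (rule dec_pred_iff[of "\<lambda>x. (1 - of_bool (P x)) + (1 - of_bool (Q x))"])
    (auto simp: dec_pred_def intro!: computable_add computable_diff computable_const)

lemma dec_pred_disj: "dec_pred P \<Longrightarrow> dec_pred Q \<Longrightarrow> dec_pred (\<lambda>x. P x \<or> Q x)"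
  using dec_pred_not[OF dec_pred_conj[OF dec_pred_not dec_pred_not]] by auto

lemma dec_pred_imp: "dec_pred P \<Longrightarrow> dec_pred Q \<Longrightarrow> dec_pred (\<lambda>x. P x \<longrightarrow> Q x)"
  using dec_pred_disj[OF dec_pred_not] by auto

lemma dec_pred_le: "computable f \<Longrightarrow> computable g \<Longrightarrow> dec_pred (\<lambda>x. f x \<le> (g x :: nat))"
  by (rule dec_pred_iff[of "\<lambda>x. f x - g x"]) (auto intro: computable_diff)

lemma dec_pred_less: "computable f \<Longrightarrow> computable g \<Longrightarrow> dec_pred (\<lambda>x. f x < (g x :: nat))"
  using dec_pred_le[OF computable_Suc] by (simp add: Suc_le_eq)

lemma dec_pred_eq: "computable f \<Longrightarrow> computable g \<Longrightarrow> dec_pred (\<lambda>x. f x = g x)"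
proof -
  have num: "computable (\<lambda>x. gnum (f x))" if "computable f" for f :: "'a \<Rightarrow> 'b"
    using that by (simp add: computable_def)
  assume "computable f" "computable g"
  then have "dec_pred (\<lambda>x. gnum (f x) \<le> gnum (g x) \<and> gnum (g x) \<le> gnum (f x))"
    by (intro dec_pred_conj dec_pred_le num)
  then show ?thesis by (simp flip: order.eq_iff)
qed

lemma computable_If:
  assumes "dec_pred P" "computable f" "computable g"
  shows "computable (\<lambda>x. if P x then f x else g x)"
proof -
  have "computable (\<lambda>x. case of_bool (P x) of 0 \<Rightarrow> g x | Suc i \<Rightarrow> f x)"
    using assms unfolding dec_pred_def
    by (intro computable_case_nat computable_compose[OF assms(2)] computable_fst computable_id)
  moreover have "(case of_bool (P x) of 0 \<Rightarrow> g x | Suc i \<Rightarrow> f x) = (if P x then f x else g x)" for x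
    by simp
  ultimately show ?thesis by simp
qed

lemma computable_Least:
  assumes "dec_pred (\<lambda>p. P (fst p) (snd p))" "\<And>x. \<exists>n. P x n"
  shows "computable (\<lambda>x. LEAST n::nat. P x n)"
proof -
  have pair: "gden (prod_encode (a, n)) = (gden a :: 'a, n)" for a n
    using gden_gnum[of "(gden a :: 'a, n)"] by simp
  have "computable (\<lambda>p. 1 - (of_bool (P (fst p) (snd p)) :: nat))"
    using assms(1) unfolding dec_pred_def by (intro computable_diff computable_const)
  then have C: "rfun 1 (\<lambda>xs. let p = gden (xs ! 0) in 1 - (of_bool (P (fst p) (snd p)) :: nat))"
    by (simp add: computable_def Let_def)
  have "rfun (Suc 1) (\<lambda>ys. (\<lambda>xs. let p = gden (xs ! 0) in 1 - (of_bool (P (fst p) (snd p)) :: nat))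
    [prod_encode (ys ! 1, ys ! 0)])"
    by (intro rfun_comp1[OF C] rfun_prod_encode rfun_proj) auto
  then have "rfun (Suc 1) (\<lambda>ys. 1 - (of_bool (P (gden (ys ! 1)) (ys ! 0)) :: nat))"
    by (simp add: pair Let_def)
  then have "rfun 1 (\<lambda>xs. LEAST n. (\<lambda>ys. 1 - (of_bool (P (gden (ys ! 1)) (ys ! 0)) :: nat)) (n # xs) = 0)"
    by (rule rfun_Least) (use assms(2) in force)
  moreover have "1 - (of_bool b :: nat) = 0 \<longleftrightarrow> b" for b by simp
  ultimately show ?thesis by (simp only: computable_def gnum_nat nth_Cons_0 One_nat_def nth_Cons_Suc)
qed

lemma dec_pred_all_less:
  fixes f :: "'a::gcode \<Rightarrow> nat"
  assumes f: "computable f" and P: "dec_pred (\<lambda>p. P (fst p) (snd p))"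
  shows "dec_pred (\<lambda>x. \<forall>i<f x. P x i)"
proof (rule dec_pred_iff)
  have Q: "dec_pred (\<lambda>q. P (fst (fst q)) (snd (fst q)))"
    using dec_pred_compose[OF P computable_fst[OF computable_id]] .
  show "computable (\<lambda>x. rec_nat 0 (\<lambda>i acc. if P x i then acc else 1) (f x) :: nat)"
    by (intro computable_rec_nat computable_const f computable_If Q computable_snd computable_id)
  fix x
  have "(\<forall>i<n. P x i) \<longleftrightarrow> rec_nat 0 (\<lambda>i acc. if P x i then acc else 1) n = (0::nat)" for n
    by (induction n) (auto simp: less_Suc_eq)
  then show "(\<forall>i<f x. P x i) \<longleftrightarrow> rec_nat 0 (\<lambda>i acc. if P x i then acc else 1) (f x) = (0::nat)" .
qed

lemma dec_pred_ex_less: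
  fixes f :: "'a::gcode \<Rightarrow> nat"
  assumes f: "computable f" and P: "dec_pred (\<lambda>p. P (fst p) (snd p))"
  shows "dec_pred (\<lambda>x. \<exists>i<f x. P x i)"
  using dec_pred_not[OF dec_pred_all_less[OF f dec_pred_not[OF P]]] by simp

lemma computable_mod:
  assumes "computable f" "computable g"
  shows "computable (\<lambda>x. f x mod g x :: nat)"
proof -
  have "computable (\<lambda>x. rec_nat 0 (\<lambda>i acc. if Suc acc = g x then 0 else Suc acc) (f x) :: nat)"
    by (intro computable_rec_nat computable_If computable_const dec_pred_eq computable_Suc
        computable_snd computable_fst computable_id assms computable_compose[OF assms(2)])
  moreover have "rec_nat 0 (\<lambda>i acc. if Suc acc = g then 0 else Suc acc) n = n mod g" for n g :: nat
    by (induction n) (auto simp: mod_Suc)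
  ultimately show ?thesis by simp
qed

text \<open>Out-of-range positions yield the code 0, which keeps list access total.\<close>

definition gnth :: "'a::gcode list \<Rightarrow> nat \<Rightarrow> 'a" where
  "gnth xs i = (if i < length xs then xs ! i else gden 0)"

definition ghd :: "'a::gcode list \<Rightarrow> 'a" where
  "ghd xs = (case xs of [] \<Rightarrow> gden 0 | x # _ \<Rightarrow> x)"

lemma prod_decode_0: "prod_decode 0 = (0, 0)"
  using prod_encode_inverse[of "(0, 0)"] by (simp add: prod_encode_def)

text \<open>The code of a nonempty list is the successor of a pair. On the empty list the
  predecessor stays 0, which decodes to a pair of zeros and so to the default value.\<close>

lemma computable_ghd: "computable ghd"
proof -
  have "rfun 1 (\<lambda>xs. fst (prod_decode (xs ! 0 - 1)))"
    by (intro rfun_prod_decode rfun_diff rfun_const rfun_proj) auto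
  moreover have "gnum (ghd (xs :: 'a list)) = fst (prod_decode (gnum xs - 1))" for xs
    by (cases xs) (simp_all add: ghd_def prod_decode_0)
  ultimately show ?thesis by (simp add: computable_def)
qed

lemma computable_tl:
  assumes "computable f"
  shows "computable (\<lambda>x. tl (f x) :: 'a::gcode list)"
proof (rule computable_compose[OF _ assms])
  have "rfun 1 (\<lambda>xs. snd (prod_decode (xs ! 0 - 1)))"
    by (intro rfun_prod_decode rfun_diff rfun_const rfun_proj) auto
  moreover have "gnum (tl (xs :: 'a list)) = snd (prod_decode (gnum xs - 1))" for xs
    by (cases xs) (simp_all add: prod_decode_0)
  ultimately show "computable (tl :: 'a list \<Rightarrow> _)" by (simp add: computable_def)
qed

lemma computable_drop:
  assumes "computable n" "computable f"
  shows "computable (\<lambda>x. drop (n x) (f x))"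
proof -
  have "computable (\<lambda>x. rec_nat (f x) (\<lambda>_. tl) (n x))"
    by (intro computable_rec_nat computable_tl computable_snd computable_id assms)
  moreover have "rec_nat ys (\<lambda>_. tl) k = drop k ys" for k and ys :: "'b list"
    by (induction k) (auto simp: drop_Suc tl_drop)
  ultimately show ?thesis by simp
qed

lemma computable_length:
  assumes "computable f"
  shows "computable (\<lambda>x. length (f x))"
proof -
  have "computable (\<lambda>x. LEAST n. drop n (f x) = [])"
    by (intro computable_Least dec_pred_eq computable_drop computable_const computable_snd computable_id
        computable_compose[OF assms] computable_fst) (auto intro: exI[of _ "length (f x)" for x])
  moreover have "(LEAST n. drop n ys = []) = length ys" for ys :: "'b list"
    by (rule Least_equality) auto
  ultimately show ?thesis by simp
qed

lemma computable_gnth: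
  assumes "computable f" "computable n"
  shows "computable (\<lambda>x. gnth (f x) (n x))"
proof -
  have "computable (\<lambda>x. ghd (drop (n x) (f x)))"
    by (intro computable_compose[OF computable_ghd] computable_drop assms)
  moreover have "ghd (drop k ys) = gnth ys k" for k and ys :: "'b list"
    by (auto simp: ghd_def gnth_def Cons_nth_drop_Suc[symmetric])
  ultimately show ?thesis by simp
qed

lemma ball_set_iff_gnth: "(\<forall>y\<in>set ys. P y) \<longleftrightarrow> (\<forall>i<length ys. P (gnth ys i))"
  by (auto simp: gnth_def all_set_conv_all_nth)

lemma dec_pred_ball:
  assumes f: "computable f" and P: "dec_pred (\<lambda>p. P (fst p) (snd p))"
  shows "dec_pred (\<lambda>x. \<forall>y\<in>set (f x). P x y)"
  unfolding ball_set_iff_gnth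
proof (intro dec_pred_all_less computable_length f)
  show "dec_pred (\<lambda>p. P (fst p) (gnth (f (fst p)) (snd p)))"
    by (intro dec_pred_compose2[OF P] computable_gnth computable_fst computable_snd
        computable_id computable_compose[OF f])
qed

lemma dec_pred_bex:
  assumes f: "computable f" and P: "dec_pred (\<lambda>p. P (fst p) (snd p))"
  shows "dec_pred (\<lambda>x. \<exists>y\<in>set (f x). P x y)"
  using dec_pred_not[OF dec_pred_ball[OF f dec_pred_not[OF P]]] by simp

lemma dec_pred_mem:
  assumes f: "computable f" and g: "computable g"
  shows "dec_pred (\<lambda>x. f x \<in> set (g x))"
proof -
  have "dec_pred (\<lambda>x. \<exists>y\<in>set (g x). f x = y)"
    by (intro dec_pred_bex g dec_pred_eq computable_snd computable_id computable_compose[OF f] computable_fst)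
  then show ?thesis by simp
qed

section \<open>Recursively enumerable predicates\<close>

definition re_pred :: "('a::gcode \<Rightarrow> bool) \<Rightarrow> bool" where
  "re_pred P \<longleftrightarrow> (\<exists>Q. dec_pred (\<lambda>p. Q (fst p) (snd p)) \<and> (\<forall>x. P x \<longleftrightarrow> (\<exists>n::nat. Q x n)))"

lemma re_predI:
  assumes "dec_pred (\<lambda>p. Q (fst p) (snd p))"
  shows "re_pred (\<lambda>x. \<exists>n::nat. Q x n)"
  unfolding re_pred_def using assms by blast

lemma re_pred_dec_pred:
  assumes "dec_pred P" shows "re_pred P"
proof -
  have "dec_pred (\<lambda>p. P (fst p))"
    by (rule dec_pred_compose[OF assms computable_fst[OF computable_id]])
  from re_predI[of "\<lambda>x _. P x", OF this] show ?thesis by simp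
qed

lemma computable_gden: "computable f \<Longrightarrow> computable (\<lambda>x. gden (f x) :: 'a::gcode)"
  by (simp add: computable_def)

lemma re_pred_compose:
  assumes "re_pred P" "computable f" shows "re_pred (\<lambda>x. P (f x))"
proof -
  obtain Q where Q: "dec_pred (\<lambda>p. Q (fst p) (snd p))" "\<And>x. P x \<longleftrightarrow> (\<exists>n::nat. Q x n)"
    using assms(1) unfolding re_pred_def by blast
  have "dec_pred (\<lambda>p. Q (f (fst p)) (snd p))"
    by (intro dec_pred_compose2[OF Q(1)] computable_fst computable_snd computable_id computable_compose[OF assms(2)])
  from re_predI[OF this] show ?thesis by (simp add: Q(2))
qed

lemma re_pred_compose2:
  assumes "re_pred (\<lambda>p. P (fst p) (snd p))" "computable f" "computable g"
  shows "re_pred (\<lambda>x. P (f x) (g x))"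
  using re_pred_compose[OF assms(1) computable_Pair[OF assms(2,3)]] by simp

lemma re_pred_ex:
  assumes "re_pred (\<lambda>p. P (fst p) (snd p))"
  shows "re_pred (\<lambda>x. \<exists>y::'b::gcode. P x y)"
proof -
  obtain Q where Q: "dec_pred (\<lambda>p. Q (fst p) (snd p))"
    "\<And>p. P (fst p) (snd p) \<longleftrightarrow> (\<exists>n::nat. Q p n)"
    using assms unfolding re_pred_def by blast
  have Q2: "P x y \<longleftrightarrow> (\<exists>n. Q (x, y) n)" for x y using Q(2)[of "(x, y)"] by simp
  have "dec_pred (\<lambda>p. Q (fst p, fst (gden (snd p) :: 'b \<times> nat)) (snd (gden (snd p) :: 'b \<times> nat)))"
    by (intro dec_pred_compose2[OF Q(1)] computable_Pair computable_fst computable_snd computable_id computable_gden)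
  then have "re_pred (\<lambda>x. \<exists>n. Q (x, fst (gden n :: 'b \<times> nat)) (snd (gden n :: 'b \<times> nat)))" by (rule re_predI)
  moreover have "(\<exists>n. Q (x, fst (gden n :: 'b \<times> nat)) (snd (gden n :: 'b \<times> nat))) \<longleftrightarrow> (\<exists>y. P x y)" for x
  proof
    assume "\<exists>y. P x y"
    then obtain y n where "Q (x, y) n" using Q2 by blast
    then show "\<exists>n. Q (x, fst (gden n :: 'b \<times> nat)) (snd (gden n :: 'b \<times> nat))"
      by (intro exI[of _ "gnum (y, n)"]) (simp del: gnum_Pair)
  qed (use Q2 in blast)
  ultimately show ?thesis by simp
qed

lemma re_pred_conj:
  assumes "re_pred P" "re_pred R" shows "re_pred (\<lambda>x. P x \<and> R x)"
proof -
  obtain Q where Q: "dec_pred (\<lambda>p. Q (fst p) (snd p))" "\<And>x. P x \<longleftrightarrow> (\<exists>n::nat. Q x n)"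
    using assms(1) unfolding re_pred_def by blast
  obtain T where T: "dec_pred (\<lambda>p. T (fst p) (snd p))" "\<And>x. R x \<longleftrightarrow> (\<exists>n::nat. T x n)"
    using assms(2) unfolding re_pred_def by blast
  have "re_pred (\<lambda>x. \<exists>y::nat \<times> nat. Q x (fst y) \<and> T x (snd y))"
    by (intro re_pred_ex re_pred_dec_pred dec_pred_conj dec_pred_compose2[OF Q(1)] dec_pred_compose2[OF T(1)]
        computable_fst computable_snd computable_id)
  then show ?thesis by (simp add: Q T)
qed

text \<open>Finitely many indices have finitely many search witnesses, so one bound \<open>b\<close>
  serves them all, and what follows the search for \<open>b\<close> is decidable.\<close>

lemma re_pred_all_less:
  fixes f :: "'a::gcode \<Rightarrow> nat"
  assumes f: "computable f" and P: "re_pred (\<lambda>p. P (fst p) (snd p))"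
  shows "re_pred (\<lambda>x. \<forall>i<f x. P x i)"
proof -
  obtain Q where Q: "dec_pred (\<lambda>p. Q (fst p) (snd p))"
    "\<And>p. P (fst p) (snd p) \<longleftrightarrow> (\<exists>n::nat. Q p n)"
    using P unfolding re_pred_def by blast
  have Q2: "P x y \<longleftrightarrow> (\<exists>n. Q (x, y) n)" for x y using Q(2)[of "(x, y)"] by simp
  have "dec_pred (\<lambda>q. Q (fst (fst (fst q)), snd (fst q)) (snd q))"
    by (intro dec_pred_compose2[OF Q(1)] computable_Pair computable_fst computable_snd computable_id)
  then have "re_pred (\<lambda>x. \<exists>b. \<forall>i<f x. \<exists>n<b. Q (x, i) n)"
    by (intro re_predI dec_pred_all_less dec_pred_ex_less computable_compose[OF f] computable_fst computable_snd computable_id)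
  moreover have "(\<exists>b. \<forall>i<m. \<exists>n<b. Q (x, i) n) \<longleftrightarrow> (\<forall>i<m. P x i)" for x m
  proof
    assume "\<forall>i<m. P x i"
    then obtain h where h: "i < m \<Longrightarrow> Q (x, i) (h i)" for i unfolding Q2 by metis
    have "i < m \<Longrightarrow> h i < Suc (Max (h ` {..<m}))" for i by (simp add: less_Suc_eq_le)
    with h show "\<exists>b. \<forall>i<m. \<exists>n<b. Q (x, i) n" by blast
  qed (auto simp: Q2)
  ultimately show ?thesis by simp
qed

text \<open>Post's theorem: witnesses for \<open>P\<close> and for its negation are searched in
  parallel. The search always ends, and its first hit can only be a witness for the side that
  holds.\<close>

lemma dec_pred_of_re_pred:
  assumes P: "re_pred P" and N: "re_pred (\<lambda>x. \<not> P x)"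
  shows "dec_pred P"
proof -
  obtain Q where Q: "dec_pred (\<lambda>p. Q (fst p) (snd p))" "\<And>x. P x \<longleftrightarrow> (\<exists>n::nat. Q x n)"
    using P unfolding re_pred_def by blast
  obtain T where T: "dec_pred (\<lambda>p. T (fst p) (snd p))" "\<And>x. \<not> P x \<longleftrightarrow> (\<exists>n::nat. T x n)"
    using N unfolding re_pred_def by blast
  define g where "g x = (LEAST n. Q x n \<or> T x n)" for x
  have ex: "\<exists>n. Q x n \<or> T x n" for x using Q(2) T(2) by blast
  have g: "computable g"
    unfolding g_def using ex by (intro computable_Least dec_pred_disj Q T) auto
  have "Q x (g x) \<longleftrightarrow> P x" for x
    using LeastI_ex[OF ex[of x]] Q(2) T(2) unfolding g_def by blast
  moreover have "dec_pred (\<lambda>x. Q x (g x))"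
    by (intro dec_pred_compose2[OF Q(1)] computable_id g)
  ultimately show ?thesis by simp
qed

lemma decidable_nat_if_dec_pred:
  assumes "dec_pred P"
  shows "decidable_nat (\<lambda>n. \<exists>x. n = gnum x \<and> P x)"
proof -
  obtain r where r: "length xs = 1 \<Longrightarrow> ev r xs (of_bool (P (gden (xs ! 0))))" for xs
    using assms unfolding dec_pred_def computable_def rfun_def by auto
  have "(\<exists>x. n = gnum x \<and> P x) \<longleftrightarrow> P (gden n)" for n
    by (metis gden_gnum gnum_gden)
  then have "ev r [n] (if \<exists>x. n = gnum x \<and> P x then 1 else 0)" for n
    using r[of "[n]"] by (cases "P (gden n)") simp_all
  then show ?thesis unfolding decidable_nat_def by blast
qed

section \<open>Modular subword equivalence\<close>

text \<open>The offset \<open>s\<close> lets a factor carry its positions within the whole word.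
  Positions count from 0 here but from 1 in formulas, which causes the shifts by \<open>Suc\<close>
  in the translation to sentences.\<close>

fun en :: "nat \<Rightarrow> nat \<Rightarrow> 'a list \<Rightarrow> ('a \<times> nat) list" where
  "en d s [] = []"
| "en d s (a # w) = (a, s mod d) # en d (Suc s) w"

lemma length_en [simp]: "length (en d s w) = length w"
  by (induction w arbitrary: s) auto

lemma en_append: "en d s (u @ v) = en d s u @ en d (s + length u) v"
  by (induction u arbitrary: s) auto

lemma en_nth: "i < length w \<Longrightarrow> en d s w ! i = (w ! i, (s + i) mod d)"
  by (induction w arbitrary: s i) (auto simp: nth_Cons split: nat.splits)

lemma set_en: "set (en d s w) = (\<lambda>i. (w ! i, (s + i) mod d)) ` {..<length w}"
  by (auto simp: set_conv_nth[unfolded setcompr_eq_image] en_nth intro!: image_cong)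

lemma en_cong: "s mod d = s' mod d \<Longrightarrow> en d s w = en d s' w"
proof (induction w arbitrary: s s')
  case (Cons a w)
  then have "Suc s mod d = Suc s' mod d" by (simp add: mod_Suc)
  from Cons.IH[OF this] Cons.prems show ?case by simp
qed simp

lemma map_en_dvd: "c dvd d \<Longrightarrow> map (\<lambda>(a, i). (a, i mod c)) (en d s w) = en c s w"
  by (induction w arbitrary: s) (auto simp: mod_mod_cancel)

text \<open>Simon's congruence from the theory of piecewise testable languages.\<close>

definition sub_eq :: "nat \<Rightarrow> 'a list \<Rightarrow> 'a list \<Rightarrow> bool" where
  "sub_eq k x y \<longleftrightarrow> (\<forall>u. length u \<le> k \<longrightarrow> subseq u x = subseq u y)"

lemma sub_eq_refl [simp]: "sub_eq k x x"
  by (simp add: sub_eq_def)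

lemma sub_eq_sym: "sub_eq k x y \<Longrightarrow> sub_eq k y x"
  by (simp add: sub_eq_def)

lemma sub_eq_mono: "sub_eq k x y \<Longrightarrow> l \<le> k \<Longrightarrow> sub_eq l x y"
  by (simp add: sub_eq_def)

text \<open>A subword of a concatenation splits into subwords of the two parts, neither longer than
  the whole, so the precision \<open>k\<close> is kept.\<close>

lemma sub_eq_append: "sub_eq k x y \<Longrightarrow> sub_eq k x' y' \<Longrightarrow> sub_eq k (x @ x') (y @ y')"
proof -
  have "subseq u (b @ b')" if "sub_eq k a b" "sub_eq k a' b'" "length u \<le> k" "subseq u (a @ a')"
    for a b a' b' :: "'a list" and u
  proof -
    obtain v v' where v: "u = v @ v'" "subseq v a" "subseq v' a'" using \<open>subseq u (a @ a')\<close> by (rule subseq_appendE)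
    then have "subseq v b" "subseq v' b'" using that(1-3) by (auto simp: sub_eq_def)
    then show ?thesis unfolding v(1) by (rule list_emb_append_mono)
  qed
  note * = this
  assume "sub_eq k x y" "sub_eq k x' y'"
  then show "sub_eq k (x @ x') (y @ y')"
    unfolding sub_eq_def[of k "x @ x'"]
    by (intro allI impI iffI) (rule *[of x y x' y'] *[of y x y' x']; simp add: sub_eq_sym)+
qed

lemma subseq_set: "subseq u x \<Longrightarrow> set u \<subseteq> set x"
  by (induction rule: list_emb.induct) auto

lemma subseq_map_iff: "subseq u (map f x) \<longleftrightarrow> (\<exists>v. u = map f v \<and> subseq v x)"
proof
  show "subseq u (map f x) \<Longrightarrow> \<exists>v. u = map f v \<and> subseq v x"
  proof (induction u "map f x" arbitrary: x rule: list_emb.induct)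
    case (list_emb_Nil ys)
    then show ?case by simp
  next
    case (list_emb_Cons xs ys y)
    then show ?case by (metis list_emb.list_emb_Cons map_eq_Cons_D)
  next
    case (list_emb_Cons2 a b xs ys)
    then obtain c z where x: "x = c # z" "f c = b" "map f z = ys" by (metis map_eq_Cons_D)
    then obtain v where "xs = map f v" "subseq v z" using list_emb_Cons2 by blast
    then show ?case using x list_emb_Cons2(1) by (intro exI[of _ "c # v"]) auto
  qed
qed (auto intro: subseq_map)

lemma sub_eq_map: "sub_eq k x y \<Longrightarrow> sub_eq k (map f x) (map f y)"
  unfolding sub_eq_def subseq_map_iff by (metis length_map)

definition mod_eqv :: "nat \<Rightarrow> nat \<Rightarrow> 'a list \<Rightarrow> 'a list \<Rightarrow> bool" where
  "mod_eqv d k w w' \<longleftrightarrow> length w mod d = length w' mod d \<and> sub_eq k (en d 0 w) (en d 0 w')"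

text \<open>Residues modulo \<open>c\<close> are images of residues modulo \<open>d\<close>. This is
  what permits passing to common multiples of moduli.\<close>

lemma mod_eqv_dvd: "mod_eqv d k w w' \<Longrightarrow> c dvd d \<Longrightarrow> l \<le> k \<Longrightarrow> mod_eqv c l w w'"
  using sub_eq_mono[OF sub_eq_map[of k "en d 0 w" "en d 0 w'" "\<lambda>(a, i). (a, i mod c)"], of l]
    mod_mod_cancel[of c d "length w"] mod_mod_cancel[of c d "length w'"]
  by (simp add: mod_eqv_def map_en_dvd)

lemma subseq_iff_index:
  "subseq u x \<longleftrightarrow> (\<exists>f. (\<forall>i j. i < j \<longrightarrow> j < length u \<longrightarrow> f i < f j) \<and>
     (\<forall>i<length u. f i < length x \<and> x ! f i = u ! i))"
  (is "_ \<longleftrightarrow> (\<exists>f. ?E f u x)")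
proof
  show "subseq u x \<Longrightarrow> \<exists>f. ?E f u x"
  proof (induction rule: list_emb.induct)
    case (list_emb_Cons xs ys y)
    then obtain f where "?E f xs ys" by blast
    then have "?E (\<lambda>i. Suc (f i)) xs (y # ys)" by simp
    then show ?case by (rule exI[where x = "\<lambda>i. Suc (f i)"])
  next
    case (list_emb_Cons2 a b xs ys)
    then obtain f where "?E f xs ys" by blast
    then have "?E (\<lambda>i. case i of 0 \<Rightarrow> 0 | Suc i \<Rightarrow> Suc (f i)) (a # xs) (b # ys)"
      using list_emb_Cons2(1) by (auto split: nat.splits)
    then show ?case by (rule exI[where x = "\<lambda>i. case i of 0 \<Rightarrow> 0 | Suc i \<Rightarrow> Suc (f i)"])
  qed auto
next
  show "\<exists>f. ?E f u x \<Longrightarrow> subseq u x"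
  proof (induction u arbitrary: x)
    case (Cons a u)
    then obtain f where f: "?E f (a # u) x" by blast
    have f0: "f 0 < length x" "x ! f 0 = a" using f by auto
    have pos: "f 0 < f (Suc i)" if "i < length u" for i using f that by simp
    have "?E (\<lambda>i. f (Suc i) - Suc (f 0)) u (drop (Suc (f 0)) x)"
    proof (intro conjI allI impI)
      fix i j assume "i < j" "j < length u"
      then show "f (Suc i) - Suc (f 0) < f (Suc j) - Suc (f 0)"
        using f pos[of i] by (intro diff_less_mono) (auto simp: Suc_le_eq)
    next
      fix i assume i: "i < length u"
      then have "f (Suc i) < length x" "x ! f (Suc i) = u ! i" using f by auto
      then show "f (Suc i) - Suc (f 0) < length (drop (Suc (f 0)) x)"
        "drop (Suc (f 0)) x ! (f (Suc i) - Suc (f 0)) = u ! i"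
        using pos[OF i] by auto
    qed
    then have "\<exists>g. ?E g u (drop (Suc (f 0)) x)"
      by (rule exI[where x = "\<lambda>i. f (Suc i) - Suc (f 0)"])
    then have "subseq u (drop (Suc (f 0)) x)" by (rule Cons.IH)
    then have "subseq (a # u) (take (f 0) x @ a # drop (Suc (f 0)) x)"
      by (intro subseq_drop_many) simp
    then show ?case using id_take_nth_drop[OF f0(1)] f0(2) by simp
  qed simp
qed

section \<open>Definability by existential sentences\<close>

lemma qf_sat_transfer:
  assumes "qf_vars \<phi> \<subseteq> V" "qf_uses_mod d \<phi>" "length w mod d = length w' mod d"
    and "\<And>x y. x \<in> V \<Longrightarrow> y \<in> V \<Longrightarrow> (v x < v y) = (v' x < v' y) \<and> (v x = v y) = (v' x = v' y)"
    and "\<And>x. x \<in> V \<Longrightarrow> w ! (v x - 1) = w' ! (v' x - 1) \<and> v x mod d = v' x mod d"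
  shows "qf_sat d w v \<phi> = qf_sat d w' v' \<phi>"
  using assms by (induction \<phi>) auto

text \<open>The positions chosen for the \<open>n\<close> variables spell a subword of the enriched
  word with at most \<open>n\<close> letters. A copy of this subword in \<open>w'\<close> gives a
  valuation with the same order, letters and residues.\<close>

lemma sigma1_sat_mono:
  assumes wf: "sigma1_wf d (n, \<phi>)" and len: "length w mod d = length w' mod d"
    and sub: "sub_eq k (en d 0 w) (en d 0 w')" and "n \<le> k"
    and sat: "sigma1_sat d w (n, \<phi>)"
  shows "sigma1_sat d w' (n, \<phi>)"
proof -
  obtain v where v: "\<And>i. i < n \<Longrightarrow> v i \<in> {1..length w}" and vs: "qf_sat d w v \<phi>"
    using sat by (auto simp: sigma1_sat_def)
  define ps where "ps = sorted_list_of_set (v ` {..<n})"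
  have set_ps: "set ps = v ` {..<n}" and sorted: "sorted_wrt (<) ps"
    by (auto simp: ps_def)
  have lps: "length ps \<le> n" unfolding ps_def
    using card_image_le[of "{..<n}" v] by simp
  have bnd: "p \<in> {1..length w}" if "p \<in> set ps" for p using v that set_ps by auto
  define u where "u = map (\<lambda>p. en d 0 w ! (p - 1)) ps"
  have "subseq u (en d 0 w)"
    unfolding subseq_iff_index
  proof (intro exI[of _ "\<lambda>i. ps ! i - 1"] conjI allI impI)
    fix i j assume "i < j" "j < length u"
    then have "ps ! i < ps ! j" "1 \<le> ps ! i"
      using sorted bnd[of "ps ! i"] by (auto simp: u_def sorted_wrt_iff_nth_less)
    then show "ps ! i - 1 < ps ! j - 1" by simp
  next
    fix i assume i: "i < length u"
    then have "ps ! i \<in> {1..length w}" by (intro bnd) (simp add: u_def)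
    then show "ps ! i - 1 < length (en d 0 w)" "en d 0 w ! (ps ! i - 1) = u ! i"
      using i by (auto simp: u_def)
  qed
  moreover have "length u \<le> k" using lps \<open>n \<le> k\<close> by (simp add: u_def)
  ultimately have "subseq u (en d 0 w')" using sub by (simp add: sub_eq_def)
  then obtain f where f: "\<And>i j. i < j \<Longrightarrow> j < length u \<Longrightarrow> f i < f j"
    "\<And>i. i < length u \<Longrightarrow> f i < length w' \<and> en d 0 w' ! f i = u ! i"
    unfolding subseq_iff_index by auto
  have "\<exists>j. j < length ps \<and> ps ! j = v i" if "i < n" for i
    using that set_ps by (metis imageI in_set_conv_nth lessThan_iff)
  then obtain ix where ix: "\<And>i. i < n \<Longrightarrow> ix i < length ps \<and> ps ! ix i = v i" by metis
  have lu: "length u = length ps" by (simp add: u_def)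
  \<comment> \<open>\<open>Suc\<close> leads from positions counted from 0 back to the positions of
    formulas.\<close>
  define v' where "v' i = Suc (f (ix i))" for i
  have ordered: "(v x < v y) = (v' x < v' y) \<and> (v x = v y) = (v' x = v' y)" if "x < n" "y < n" for x y
  proof -
    have mono: "ps ! i < ps ! j \<and> f i < f j" if "i < j" "j < length ps" for i j
      using sorted f(1) that lu by (auto simp: sorted_wrt_iff_nth_less)
    consider "ix x < ix y" | "ix x = ix y" | "ix y < ix x" by linarith
    then show ?thesis
      using mono[of "ix x" "ix y"] mono[of "ix y" "ix x"] ix[OF that(1)] ix[OF that(2)]
      by cases (auto simp: v'_def)
  qed
  have letters: "w ! (v x - 1) = w' ! (v' x - 1) \<and> v x mod d = v' x mod d" if "x < n" for x
  proof -
    have vx: "1 \<le> v x" "v x - 1 < length w" using v[OF that] by auto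
    have "f (ix x) < length w'" "en d 0 w' ! f (ix x) = en d 0 w ! (v x - 1)"
      using f(2)[of "ix x"] ix[OF that] lu by (auto simp: u_def)
    then have "w' ! f (ix x) = w ! (v x - 1)" "f (ix x) mod d = (v x - 1) mod d"
      using vx by (auto simp: en_nth)
    moreover from this(2) have "Suc (f (ix x)) mod d = Suc (v x - 1) mod d" by (metis mod_Suc_eq)
    ultimately show ?thesis using vx by (simp add: v'_def)
  qed
  have "qf_sat d w v \<phi> = qf_sat d w' v' \<phi>"
    by (rule qf_sat_transfer[where V = "{..<n}"]) (use wf len ordered letters in \<open>auto simp: sigma1_wf_def\<close>)
  moreover have "v' i \<in> {1..length w'}" if "i < n" for i
    using f(2)[of "ix i"] ix[OF that] lu by (simp add: v'_def)
  ultimately show ?thesis using vs by (auto simp: sigma1_sat_def)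
qed

text \<open>The number of quantified variables bounds the length of the subwords that a sentence can
  see.\<close>

fun bs_rank :: "bsigma1 \<Rightarrow> nat" where
  "bs_rank (BAtom s) = fst s"
| "bs_rank (BNot \<phi>) = bs_rank \<phi>"
| "bs_rank (BAnd \<phi> \<psi>) = max (bs_rank \<phi>) (bs_rank \<psi>)"
| "bs_rank (BOr \<phi> \<psi>) = max (bs_rank \<phi>) (bs_rank \<psi>)"

lemma bs_sat_mod_eqv:
  assumes "mod_eqv d k w w'" "bs_wf d \<phi>" "bs_rank \<phi> \<le> k"
  shows "bs_sat d w \<phi> = bs_sat d w' \<phi>"
  using assms(2,3)
proof (induction \<phi>)
  case (BAtom s)
  obtain n \<psi> where s: "s = (n, \<psi>)" by fastforce
  have eqv: "length w mod d = length w' mod d" "sub_eq k (en d 0 w) (en d 0 w')"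
    using assms(1) by (simp_all add: mod_eqv_def)
  have wf: "sigma1_wf d (n, \<psi>)" "n \<le> k" using BAtom by (simp_all add: s)
  have "sigma1_sat d w (n, \<psi>) = sigma1_sat d w' (n, \<psi>)"
    using sigma1_sat_mono[OF wf(1) eqv wf(2)]
      sigma1_sat_mono[OF wf(1) eqv(1)[symmetric] sub_eq_sym[OF eqv(2)] wf(2)] by (rule iffI)
  then show ?case by (simp add: s)
qed auto

definition chain_qf :: "nat \<Rightarrow> (nat \<times> nat) list \<Rightarrow> nat list \<Rightarrow> qf" where
  "chain_qf n u is = foldr (\<lambda>i \<phi>. Conj (Conj (Letter (fst (u ! i)) i) (PosMod (Suc (snd (u ! i))) i))
     (Conj (if Suc i < n then Less i (Suc i) else TT) \<phi>)) is TT"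

lemma qf_sat_chain:
  "qf_sat d w v (chain_qf n u is) \<longleftrightarrow> (\<forall>i\<in>set is. w ! (v i - 1) = fst (u ! i) \<and>
     v i mod d = Suc (snd (u ! i)) mod d \<and> (Suc i < n \<longrightarrow> v i < v (Suc i)))"
  by (induction "is") (auto simp: chain_qf_def)

lemma qf_vars_chain: "set is \<subseteq> {..<n} \<Longrightarrow> qf_vars (chain_qf n u is) \<subseteq> {..<n}"
  by (induction "is") (auto simp: chain_qf_def)

lemma qf_uses_mod_chain: "(\<And>i. i \<in> set is \<Longrightarrow> snd (u ! i) < d) \<Longrightarrow> qf_uses_mod d (chain_qf n u is)"
  by (induction "is") (auto simp: chain_qf_def Suc_le_eq)

lemma Suc_mod_eq_iff: "Suc a mod d = Suc b mod d \<longleftrightarrow> a mod d = b mod d"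
  by (simp add: mod_Suc split: if_splits)

definition occurs :: "(nat \<times> nat) list \<Rightarrow> sigma1" where
  "occurs u = (length u, chain_qf (length u) u [0..<length u])"

text \<open>For positive \<open>d\<close>, a residue of \<open>d\<close> or more never occurs in
  \<open>en d 0 w\<close>, while \<open>PosMod\<close> would identify it with a smaller one; hence
  the bound on the letters of \<open>u\<close>.\<close>

lemma sigma1_sat_occurs:
  assumes "\<And>x. x \<in> set u \<Longrightarrow> snd x < d"
  shows "sigma1_sat d w (occurs u) \<longleftrightarrow> subseq u (en d 0 w)"
proof -
  let ?E = "\<lambda>f. (\<forall>i j. i < j \<longrightarrow> j < length u \<longrightarrow> f i < f j) \<and>
     (\<forall>i<length u. f i < length (en d 0 w) \<and> en d 0 w ! f i = u ! i)"
  have small: "snd (u ! i) mod d = snd (u ! i)" if "i < length u" for i using assms that by simp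
  have "(\<exists>v. (\<forall>i<length u. v i \<in> {1..length w}) \<and> qf_sat d w v (chain_qf (length u) u [0..<length u]))
    \<longleftrightarrow> (\<exists>f. ?E f)"
  proof
    assume "\<exists>v. (\<forall>i<length u. v i \<in> {1..length w}) \<and> qf_sat d w v (chain_qf (length u) u [0..<length u])"
    then obtain v where v: "\<And>i. i < length u \<Longrightarrow> v i \<in> {1..length w}"
      and "qf_sat d w v (chain_qf (length u) u [0..<length u])" by blast
    then have q: "\<And>i. i < length u \<Longrightarrow> w ! (v i - 1) = fst (u ! i) \<and>
          v i mod d = Suc (snd (u ! i)) mod d \<and> (Suc i < length u \<longrightarrow> v i < v (Suc i))"
      by (simp add: qf_sat_chain)
    have mono: "v i < v j" if "i < j" "j < length u" for i j
      using that
    proof (induction j)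
      case (Suc j)
      then show ?case using q[of j] by (cases "i = j") (auto simp: less_Suc_eq)
    qed simp
    have "?E (\<lambda>i. v i - 1)"
    proof (intro conjI allI impI)
      fix i j assume "i < j" "j < length u"
      then have "v i < v j" "1 \<le> v i" using mono v[of i] by auto
      then show "v i - 1 < v j - 1" by simp
    next
      fix i assume i: "i < length u"
      have vi: "1 \<le> v i" "v i \<le> length w" using v[OF i] by auto
      then show "v i - 1 < length (en d 0 w)" by simp
      have "Suc (v i - 1) mod d = Suc (snd (u ! i)) mod d" using q[OF i] vi by simp
      then have "(v i - 1) mod d = snd (u ! i)" unfolding Suc_mod_eq_iff using small[OF i] by simp
      then show "en d 0 w ! (v i - 1) = u ! i" using q[OF i] vi by (auto simp: en_nth prod_eq_iff)
    qed
    then show "\<exists>f. ?E f" by (rule exI[where x = "\<lambda>i. v i - 1"])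
  next
    assume "\<exists>f. ?E f"
    then obtain f where f: "?E f" by blast
    have "w ! (f i) = fst (u ! i) \<and> Suc (f i) mod d = Suc (snd (u ! i)) mod d" if "i < length u" for i
    proof -
      have "f i < length w" "en d 0 w ! f i = u ! i" using f that by auto
      then have "u ! i = (w ! f i, f i mod d)" by (simp add: en_nth)
      then show ?thesis by (simp add: mod_Suc_eq)
    qed
    then show "\<exists>v. (\<forall>i<length u. v i \<in> {1..length w}) \<and> qf_sat d w v (chain_qf (length u) u [0..<length u])"
      using f by (intro exI[of _ "\<lambda>i. Suc (f i)"]) (auto simp: qf_sat_chain)
  qed
  then show ?thesis by (simp only: sigma1_sat_def occurs_def subseq_iff_index case_prod_conv)
qed

definition BTrue :: bsigma1 where "BTrue = BAtom (0, TT)"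

lemma BTrue [simp]: "bs_wf d BTrue" "bs_sat d w BTrue"
  by (auto simp: BTrue_def sigma1_wf_def sigma1_sat_def)

lemma definable_finite_Or:
  assumes "finite \<Phi>" "\<And>\<phi>. \<phi> \<in> \<Phi> \<Longrightarrow> bs_wf d \<phi>"
  shows "\<exists>\<psi>. bs_wf d \<psi> \<and> (\<forall>w. bs_sat d w \<psi> \<longleftrightarrow> (\<exists>\<phi>\<in>\<Phi>. bs_sat d w \<phi>))"
  using assms
proof (induction rule: finite_induct)
  case empty
  show ?case by (intro exI[of _ "BNot BTrue"]) simp
next
  case (insert \<phi> \<Phi>)
  then obtain \<psi> where "bs_wf d \<psi> \<and> (\<forall>w. bs_sat d w \<psi> \<longleftrightarrow> (\<exists>\<phi>\<in>\<Phi>. bs_sat d w \<phi>))" by auto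
  then show ?case using insert.prems by (intro exI[of _ "BOr \<phi> \<psi>"]) auto
qed

lemma definable_finite_And:
  assumes "finite \<Phi>" "\<And>\<phi>. \<phi> \<in> \<Phi> \<Longrightarrow> bs_wf d \<phi>"
  shows "\<exists>\<psi>. bs_wf d \<psi> \<and> (\<forall>w. bs_sat d w \<psi> \<longleftrightarrow> (\<forall>\<phi>\<in>\<Phi>. bs_sat d w \<phi>))"
  using assms
proof (induction rule: finite_induct)
  case empty
  show ?case by (intro exI[of _ BTrue]) simp
next
  case (insert \<phi> \<Phi>)
  then obtain \<psi> where "bs_wf d \<psi> \<and> (\<forall>w. bs_sat d w \<psi> \<longleftrightarrow> (\<forall>\<phi>\<in>\<Phi>. bs_sat d w \<phi>))" by auto
  then show ?case using insert.prems by (intro exI[of _ "BAnd \<phi> \<psi>"]) auto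
qed

definition factors :: "nat \<Rightarrow> nat \<Rightarrow> nat \<Rightarrow> (nat \<times> nat) list set" where
  "factors m d k = {u \<in> lists ({0..<m} \<times> {0..<d}). length u \<le> k}"

lemma finite_factors: "finite (factors m d k)"
proof -
  have "factors m d k = {u. set u \<subseteq> {0..<m} \<times> {0..<d} \<and> length u \<le> k}"
    by (auto simp: factors_def)
  then show ?thesis by (simp add: finite_lists_length_le)
qed

lemma subseq_en_factors:
  assumes "w \<in> lists {0..<m}" "d \<ge> 1" "subseq u (en d s w)" "length u \<le> k"
  shows "u \<in> factors m d k"
proof -
  have "set (en d s w) \<subseteq> {0..<m} \<times> {0..<d}"
    using assms(1,2) by (auto simp: set_en in_lists_conv_set)
  moreover have "set u \<subseteq> set (en d s w)" using assms(3) by (rule subseq_set)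
  ultimately show ?thesis using assms(4) by (auto simp: factors_def)
qed

lemma mod_eqv_class_definable:
  assumes d: "d \<ge> 1"
  shows "\<exists>\<psi>. bs_wf d \<psi> \<and> (\<forall>w. bs_sat d w \<psi> \<longleftrightarrow>
    length w mod d = r mod d \<and> (\<forall>u\<in>factors m d k. subseq u (en d 0 w) \<longleftrightarrow> u \<in> X))"
proof -
  \<comment> \<open>\<open>LenMod\<close> takes constants from 1 to \<open>d\<close>, so the residue
    0 is written as \<open>d\<close>.\<close>
  define k' where "k' = (if r mod d = 0 then d else r mod d)"
  define len where "len = BAtom (0, LenMod k')"
  have r: "r mod d < d" using d by simp
  have lam: "bs_wf d len" "bs_sat d w len \<longleftrightarrow> length w mod d = r mod d" for w
    using d r less_imp_le[OF r] by (auto simp: len_def k'_def sigma1_wf_def sigma1_sat_def)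
  define g where "g u = (if u \<in> X then BAtom (occurs u) else BNot (BAtom (occurs u)))" for u
  have f1: "snd x < d" if "x \<in> set u" "u \<in> factors m d k" for x u
    using that by (auto simp: factors_def)
  have "sigma1_wf d (occurs u)" if "u \<in> factors m d k" for u
    unfolding occurs_def sigma1_wf_def
    using f1[OF _ that] qf_vars_chain[of "[0..<length u]" "length u" u]
      qf_uses_mod_chain[of "[0..<length u]" u d] by (simp add: atLeast0LessThan)
  then have wf: "bs_wf d \<phi>" if "\<phi> \<in> insert len (g ` factors m d k)" for \<phi>
    using that lam by (auto simp: g_def)
  have "finite (insert len (g ` factors m d k))" by (simp add: finite_factors)
  from definable_finite_And[OF this wf]
  obtain \<psi> where \<psi>: "bs_wf d \<psi>" "\<And>w. bs_sat d w \<psi> \<longleftrightarrow> (\<forall>\<phi>\<in>insert len (g ` factors m d k). bs_sat d w \<phi>)"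
    by blast
  have "bs_sat d w (g u) \<longleftrightarrow> (subseq u (en d 0 w) \<longleftrightarrow> u \<in> X)" if "u \<in> factors m d k" for u w
    using sigma1_sat_occurs f1[OF _ that] by (auto simp: g_def)
  then show ?thesis using \<psi> lam by (intro exI[of _ \<psi>]) auto
qed

text \<open>A sentence of rank \<open>k\<close> cannot tell equivalent words apart. Conversely, over
  a finite alphabet there are finitely many classes, each definable, and the union of those that
  meet \<open>K\<close> is a separator.\<close>

lemma separable_iff:
  assumes K: "K \<subseteq> lists {0..<m}" and L: "L \<subseteq> lists {0..<m}"
  shows "separable (BSigma1_MOD m) K L \<longleftrightarrow>
    (\<exists>d k. d \<ge> 1 \<and> (\<forall>w\<in>K. \<forall>w'\<in>L. \<not> mod_eqv d k w w'))"
proof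
  assume "separable (BSigma1_MOD m) K L"
  then obtain d \<phi> where d: "d \<ge> 1" "bs_wf d \<phi>" "K \<subseteq> {w \<in> lists {0..<m}. bs_sat d w \<phi>}"
    "L \<inter> {w \<in> lists {0..<m}. bs_sat d w \<phi>} = {}"
    by (auto simp: separable_def BSigma1_MOD_def BSigma1_MODd_def)
  have "\<not> mod_eqv d (bs_rank \<phi>) w w'" if "w \<in> K" "w' \<in> L" for w w'
    using bs_sat_mod_eqv[OF _ d(2) order_refl, of w w'] d(3,4) that L by blast
  then show "\<exists>d k. d \<ge> 1 \<and> (\<forall>w\<in>K. \<forall>w'\<in>L. \<not> mod_eqv d k w w')" using d(1) by blast
next
  assume "\<exists>d k. d \<ge> 1 \<and> (\<forall>w\<in>K. \<forall>w'\<in>L. \<not> mod_eqv d k w w')"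
  then obtain d k where d: "d \<ge> 1" and neq: "\<And>w w'. w \<in> K \<Longrightarrow> w' \<in> L \<Longrightarrow> \<not> mod_eqv d k w w'" by blast
  define prof where "prof w = (length w mod d, {u \<in> factors m d k. subseq u (en d 0 w)})" for w :: "nat list"
  have eqv: "mod_eqv d k w w'" if "w \<in> lists {0..<m}" "w' \<in> lists {0..<m}" "prof w = prof w'" for w w'
  proof -
    have "subseq u (en d 0 w) = subseq u (en d 0 w')" if u: "length u \<le> k" for u
    proof (cases "u \<in> factors m d k")
      case True
      then show ?thesis using \<open>prof w = prof w'\<close> by (auto simp: prof_def)
    next
      \<comment> \<open>Such a short word is a subword of neither side, so the finite profile
        determines the class.\<close>
      case False
      then show ?thesis using subseq_en_factors[OF _ d _ u] \<open>w \<in> _\<close> \<open>w' \<in> _\<close> by blast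
    qed
    then show ?thesis using that(3) by (simp add: mod_eqv_def sub_eq_def prof_def)
  qed
  have "\<exists>\<chi>. bs_wf d \<chi> \<and> (\<forall>w. bs_sat d w \<chi> \<longleftrightarrow> prof w = p)" if pK: "p \<in> prof ` K" for p
  proof -
    obtain w0 where p: "p = prof w0" using pK by blast
    obtain \<psi> where \<psi>: "bs_wf d \<psi>" "\<And>w. bs_sat d w \<psi> \<longleftrightarrow>
      length w mod d = length w0 mod d \<and> (\<forall>u\<in>factors m d k. subseq u (en d 0 w) \<longleftrightarrow> u \<in> snd p)"
      using mod_eqv_class_definable[OF d, of "length w0" m k "snd p"] by blast
    have "bs_sat d w \<psi> \<longleftrightarrow> prof w = p" for w
      unfolding \<psi>(2) unfolding p prof_def by auto
    then show ?thesis using \<psi>(1) by blast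
  qed
  then obtain \<chi> where \<chi>: "\<And>p. p \<in> prof ` K \<Longrightarrow> bs_wf d (\<chi> p) \<and> (\<forall>w. bs_sat d w (\<chi> p) \<longleftrightarrow> prof w = p)"
    by metis
  have "prof ` K \<subseteq> {0..<d} \<times> Pow (factors m d k)" using d by (auto simp: prof_def)
  then have "finite (prof ` K)" by (rule finite_subset) (simp add: finite_factors)
  then have fin: "finite (\<chi> ` prof ` K)" by simp
  obtain \<psi> where \<psi>: "bs_wf d \<psi>" "\<And>w. bs_sat d w \<psi> \<longleftrightarrow> (\<exists>\<phi>\<in>\<chi> ` prof ` K. bs_sat d w \<phi>)"
    using definable_finite_Or[OF fin, of d] \<chi> by blast
  have sat: "bs_sat d w \<psi> \<longleftrightarrow> prof w \<in> prof ` K" for w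
    unfolding \<psi>(2) using \<chi> by blast
  let ?R = "{w \<in> lists {0..<m}. bs_sat d w \<psi>}"
  have "?R \<in> BSigma1_MOD m"
    unfolding BSigma1_MOD_def BSigma1_MODd_def using d \<psi>(1) by auto
  moreover have "K \<subseteq> ?R" using K by (auto simp: sat)
  moreover have "L \<inter> ?R = {}"
  proof -
    have False if w: "w \<in> L" "prof w \<in> prof ` K" for w
    proof -
      obtain w0 where "w0 \<in> K" "prof w0 = prof w" using w(2) by auto
      then show False using neq[of w0 w] eqv[of w0 w] w(1) K L by auto
    qed
    then show ?thesis by (auto simp: sat)
  qed
  ultimately show "separable (BSigma1_MOD m) K L" unfolding separable_def by blast
qed

section \<open>Products of atoms\<close>

text \<open>Over a finite alphabet, the products of such atoms denote the ideals of the subword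
  order.\<close>

datatype 'a atom = Opt 'a | Star "'a set"

fun atom_lang :: "'a atom \<Rightarrow> 'a list set" where
  "atom_lang (Opt a) = {[], [a]}"
| "atom_lang (Star C) = lists C"

fun prod_lang :: "'a atom list \<Rightarrow> 'a list set" where
  "prod_lang [] = {[]}"
| "prod_lang (t # T) = {u @ v | u v. u \<in> atom_lang t \<and> v \<in> prod_lang T}"

lemma Nil_in_atom_lang [simp]: "[] \<in> atom_lang t"
  by (cases t) auto

lemma Nil_in_prod_lang [simp]: "[] \<in> prod_lang T"
  by (induction T) auto

lemma prod_lang_appendI: "u \<in> atom_lang t \<Longrightarrow> v \<in> prod_lang T \<Longrightarrow> u @ v \<in> prod_lang (t # T)"
  by auto

lemma prod_lang_ConsI: "w \<in> prod_lang T \<Longrightarrow> w \<in> prod_lang (t # T)"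
  using prod_lang_appendI[of "[]" t w T] by simp

lemma atom_lang_subseq: "u \<in> atom_lang t \<Longrightarrow> subseq v u \<Longrightarrow> v \<in> atom_lang t"
  by (cases t; cases v) (auto simp: in_lists_conv_set subset_iff dest: subseq_set split: if_splits)

lemma prod_lang_subseq: "u \<in> prod_lang T \<Longrightarrow> subseq v u \<Longrightarrow> v \<in> prod_lang T"
proof (induction T arbitrary: u v)
  case (Cons t T)
  then obtain x y where "u = x @ y" "x \<in> atom_lang t" "y \<in> prod_lang T" by auto
  with Cons.prems(2) obtain x' y' where "v = x' @ y'" "subseq x' x" "subseq y' y"
    by (auto elim: subseq_appendE)
  with Cons.IH[OF \<open>y \<in> _\<close>] atom_lang_subseq[OF \<open>x \<in> _\<close>] show ?case by auto
qed simp

lemma prod_lang_append: "prod_lang (T @ U) = {u @ v | u v. u \<in> prod_lang T \<and> v \<in> prod_lang U}"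
proof (induction T)
  case (Cons t T)
  show ?case
  proof (intro set_eqI iffI)
    fix w assume "w \<in> prod_lang ((t # T) @ U)"
    then obtain a b c where "w = a @ b @ c" "a \<in> atom_lang t" "b \<in> prod_lang T" "c \<in> prod_lang U"
      by (auto simp: Cons.IH)
    then have "w = (a @ b) @ c" "a @ b \<in> prod_lang (t # T)" "c \<in> prod_lang U" by auto
    then show "w \<in> {u @ v | u v. u \<in> prod_lang (t # T) \<and> v \<in> prod_lang U}" by blast
  next
    fix w assume "w \<in> {u @ v | u v. u \<in> prod_lang (t # T) \<and> v \<in> prod_lang U}"
    then obtain a b c where "w = a @ b @ c" "a \<in> atom_lang t" "b \<in> prod_lang T" "c \<in> prod_lang U"
      by auto
    then have "b @ c \<in> prod_lang (T @ U)" unfolding Cons.IH by blast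
    then show "w \<in> prod_lang ((t # T) @ U)" using \<open>w = _\<close> \<open>a \<in> _\<close> by auto
  qed
qed simp

text \<open>Greedy reading: the first atom absorbs the longest prefix it can, and the next letter,
  which it cannot start with, is forced onto the remaining product. Each atom thus costs at most one
  letter of the obstruction, and one more letter is rejected by the empty product; this gives
  \<open>Suc (length T)\<close>.\<close>

lemma prod_lang_obstruction:
  "w \<notin> prod_lang T \<Longrightarrow> \<exists>y. subseq y w \<and> length y \<le> Suc (length T) \<and> y \<notin> prod_lang T"
proof (induction T arbitrary: w)
  case Nil
  then obtain a w' where "w = a # w'" by (cases w) auto
  then show ?case by (intro exI[of _ "[a]"]) auto
next
  case (Cons t T)
  text \<open>No nonempty word of \<open>t\<close> starts with \<open>x\<close>, so a word with first letter \<open>x\<close> has to be covered by \<open>T\<close>.\<close>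
  have step: ?case if w: "w = u @ x # v" and v: "x # v \<notin> prod_lang T" and x: "\<And>z. z \<in> atom_lang t \<Longrightarrow> z = [] \<or> hd z \<noteq> x"
    for u x v
  proof -
    obtain y where y: "subseq y (x # v)" "length y \<le> Suc (length T)" "y \<notin> prod_lang T"
      using Cons.IH[OF v] by blast
    define y' where "y' = (if y \<noteq> [] \<and> hd y = x then y else x # y)"
    have "subseq y' (x # v)"
    proof (cases "y \<noteq> [] \<and> hd y = x")
      case False
      then have "subseq y v" using y(1) by (cases y) (auto split: if_splits)
      then show ?thesis using False by (auto simp: y'_def)
    qed (use y(1) in \<open>simp add: y'_def\<close>)
    then have "subseq y' w" unfolding w by (rule subseq_drop_many)
    moreover have "y' \<notin> prod_lang (t # T)"
    proof
      assume "y' \<in> prod_lang (t # T)"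
      then obtain z z' where z: "y' = z @ z'" "z \<in> atom_lang t" "z' \<in> prod_lang T" by auto
      have "hd y' = x" by (auto simp: y'_def)
      then have "z = []" using x[OF z(2)] z(1) by (cases z) auto
      then have "y' \<in> prod_lang T" using z by simp
      moreover have "subseq y y'" by (auto simp: y'_def)
      ultimately show False using prod_lang_subseq y(3) by blast
    qed
    moreover have "length y' \<le> Suc (length (t # T))" using y(2) by (simp add: y'_def)
    ultimately show ?case by blast
  qed
  show ?case
  proof (cases t)
    case (Star C)
    define u where "u = takeWhile (\<lambda>a. a \<in> C) w"
    define v where "v = dropWhile (\<lambda>a. a \<in> C) w"
    have w: "w = u @ v" by (simp add: u_def v_def)
    have "u \<in> lists C" by (auto simp: u_def dest: set_takeWhileD)
    then have "v \<notin> prod_lang T" using Cons.prems w Star by auto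
    moreover from this have "v \<noteq> []" by auto
    moreover from this have "hd v \<notin> C" unfolding v_def using hd_dropWhile[of "\<lambda>a. a \<in> C" w] by simp
    moreover have "z = [] \<or> hd z \<noteq> hd v" if "z \<in> atom_lang t" for z
      using that \<open>hd v \<notin> C\<close> Star by (cases z) auto
    ultimately show ?thesis
      using w by (intro step[of u "hd v" "tl v"]) auto
  next
    case (Opt a)
    have "w \<notin> prod_lang T" using Cons.prems prod_lang_ConsI[of w T t] by blast
    then obtain x v where w: "w = x # v" by (cases w) auto
    show ?thesis
    proof (cases "x = a")
      case False
      then show ?thesis using w \<open>w \<notin> prod_lang T\<close> Opt by (intro step[of "[]" x v]) auto
    next
      case True
      then have "v \<notin> prod_lang T" using Cons.prems w Opt prod_lang_appendI[of "[a]" t v T] by auto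
      then obtain y where y: "subseq y v" "length y \<le> Suc (length T)" "y \<notin> prod_lang T"
        using Cons.IH by blast
      have "a # y \<notin> prod_lang T" using y(3) prod_lang_subseq[of "a # y" T y] by auto
      then have "a # y \<notin> prod_lang (t # T)" using y(3) Opt by auto
      then show ?thesis using y w True by (intro exI[of _ "a # y"]) simp
    qed
  qed
qed

lemma prod_lang_sub_eq:
  assumes "sub_eq k w w'" "Suc (length T) \<le> k" "w \<in> prod_lang T"
  shows "w' \<in> prod_lang T"
proof (rule ccontr)
  assume "w' \<notin> prod_lang T"
  then obtain y where "subseq y w'" "length y \<le> k" "y \<notin> prod_lang T"
    using prod_lang_obstruction assms(2) by (meson order_trans)
  then show False using assms prod_lang_subseq unfolding sub_eq_def by blast
qed

section \<open>Weakening a product\<close>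

fun avoid :: "'a set \<Rightarrow> 'a list \<Rightarrow> 'a atom list" where
  "avoid C [] = []"
| "avoid C (z # zs) = Star (C - {z}) # Opt z # avoid C zs"

text \<open>The word is cut at the first occurrences of the letters of \<open>z\<close> in turn. The
  product is a cover and not the exact complement, since it contains \<open>z\<close> itself; what
  counts is that, for \<open>z\<close> over \<open>C\<close>, every star in it has a smaller
  alphabet than \<open>C\<close>.\<close>

lemma avoid:
  "w \<in> lists C \<Longrightarrow> \<not> subseq z w \<Longrightarrow> w \<in> prod_lang (avoid C z)"
proof (induction z arbitrary: w)
  case (Cons z zs)
  show ?case
  proof (cases "z \<in> set w")
    case True
    then obtain u v where w: "w = u @ z # v" "z \<notin> set u" by (metis split_list_first)
    have "\<not> subseq zs v" using Cons.prems(2) w(1) by (auto intro: subseq_drop_many)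
    then have "v \<in> prod_lang (avoid C zs)" using Cons w(1) by auto
    moreover have "u \<in> lists (C - {z})" using Cons.prems(1) w by auto
    ultimately have "u @ [z] @ v \<in> prod_lang (avoid C (z # zs))"
      unfolding avoid.simps by (intro prod_lang_appendI) auto
    then show ?thesis using w(1) by simp
  next
    case False
    then have "w \<in> lists (C - {z})" using Cons.prems(1) by auto
    then have "w @ [] @ [] \<in> prod_lang (avoid C (z # zs))"
      unfolding avoid.simps by (intro prod_lang_appendI) auto
    then show ?thesis by simp
  qed
qed simp

text \<open>Weights are compared as multisets: an atom may be traded for any number of lighter ones,
  so the avoided word may be arbitrarily long.\<close>

fun weight :: "'a atom \<Rightarrow> nat" where
  "weight (Opt a) = 0"
| "weight (Star C) = Suc (card C)"

fun fin_atom :: "'a atom \<Rightarrow> bool" where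
  "fin_atom (Opt a) = True"
| "fin_atom (Star C) = finite C"

lemma weight_avoid:
  assumes "finite C"
  shows "set z \<subseteq> C \<Longrightarrow> t \<in> set (avoid C z) \<Longrightarrow> weight t < Suc (card C) \<and> fin_atom t"
proof (induction z)
  case (Cons z zs)
  have "card (C - {z}) < card C" using Cons.prems(1) assms by (intro psubset_card_mono) auto
  then show ?case using Cons assms by auto
qed simp

text \<open>The smaller product that results from weakening the atom \<open>t\<close>; \<open>z C\<close> is a word over \<open>C\<close>
  that shall be a subword of every block over \<open>C\<close>.\<close>

fun weaken :: "('a set \<Rightarrow> 'a list) \<Rightarrow> 'a atom \<Rightarrow> 'a atom list" where
  "weaken z (Opt a) = []"
| "weaken z (Star C) = avoid C (z C)"

text \<open>The shape of a block of \<open>t\<close> that escapes the weakening of \<open>t\<close>: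
  an optional letter is present, and a starred block contains \<open>z C\<close>.\<close>

fun full_block :: "('a set \<Rightarrow> 'a list) \<Rightarrow> 'a list \<Rightarrow> 'a atom \<Rightarrow> bool" where
  "full_block z u (Opt a) \<longleftrightarrow> u = [a]"
| "full_block z u (Star C) \<longleftrightarrow> finite C \<and> set u \<subseteq> C \<and> subseq (z C) u"

lemma full_block_if_not_weaken:
  "u \<in> atom_lang t \<Longrightarrow> fin_atom t \<Longrightarrow> u \<notin> prod_lang (weaken z t) \<Longrightarrow> full_block z u t"
  using avoid by (cases t) (auto simp: in_lists_conv_set)

lemma mset_weaken_less:
  assumes "fin_atom t" "\<And>C. set (z C) \<subseteq> C"
  shows "mset (map weight (T @ weaken z t @ U)) < mset (map weight (T @ t # U))"
proof -
  have "image_mset weight (mset (weaken z t)) < {#weight t#}"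
  proof (cases t)
    case (Star C)
    then have "\<forall>x\<in>set (avoid C (z C)). weight x < Suc (card C)"
      using weight_avoid[OF _ assms(2)] assms(1) by auto
    then show ?thesis
      unfolding Star by (intro ex_gt_imp_less_multiset) auto
  qed simp
  then show ?thesis by (simp add: ac_simps)
qed

text \<open>If some block of a factorization along \<open>T\<close> also lay in its weakened atom,
  then \<open>w\<close> would lie in the weakened product. Hence every block is full.\<close>

lemma full_blocks_if_not_weaken:
  assumes "w \<in> prod_lang T" "\<forall>t\<in>set T. fin_atom t"
    and "\<And>T1 t T2. T = T1 @ t # T2 \<Longrightarrow> w \<notin> prod_lang (T1 @ weaken z t @ T2)"
  shows "\<exists>us. concat us = w \<and> list_all2 (full_block z) us T"
  using assms
proof (induction T arbitrary: w)
  case (Cons t T)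
  then obtain u v where w: "w = u @ v" "u \<in> atom_lang t" "v \<in> prod_lang T" by auto
  have "u \<notin> prod_lang (weaken z t)"
    using Cons.prems(3)[of "[]" t T] w unfolding append_Nil prod_lang_append by auto
  then have u: "full_block z u t" using full_block_if_not_weaken w(2) Cons.prems(2) by auto
  have "v \<notin> prod_lang (T1 @ weaken z t' @ T2)" if "T = T1 @ t' # T2" for T1 t' T2
    using Cons.prems(3)[of "t # T1" t' T2] that w by auto
  then obtain us where "concat us = v" "list_all2 (full_block z) us T"
    using Cons.IH[OF w(3)] Cons.prems(2) by auto
  then show ?case using u w(1) by (intro exI[of _ "u # us"]) auto
qed auto

text \<open>A product of minimal weight among those that meet the pairs in \<open>W\<close> at every precision \<open>k\<close>
  cannot be weakened, and by the obstruction lemma this transfers from one component to the other.\<close>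

theorem common_factorization:
  fixes W :: "('a list \<times> 'a list) set"
  assumes W: "\<And>k. \<exists>(w, w')\<in>W. sub_eq k w w'"
    and \<Gamma>: "finite \<Gamma>" "\<And>w w'. (w, w') \<in> W \<Longrightarrow> w \<in> lists \<Gamma>"
    and z: "\<And>C. set (z C) \<subseteq> C"
  shows "\<exists>T us us'. (concat us, concat us') \<in> W \<and>
    list_all2 (full_block z) us T \<and> list_all2 (full_block z) us' T"
proof -
  define P where "P T \<longleftrightarrow> (\<forall>t\<in>set T. fin_atom t) \<and>
    (\<forall>k. \<exists>(w, w')\<in>W. w \<in> prod_lang T \<and> sub_eq k w w')" for T
  let ?m = "\<lambda>T :: 'a atom list. mset (map weight T)"
  \<comment> \<open>The descent starts from all words over \<open>\<Gamma>\<close>. The multiset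
    order on weights is well-founded, so a minimal product exists.\<close>
  have "P [Star \<Gamma>]" unfolding P_def using W \<Gamma> by (fastforce intro: exI[of _ "[]"])
  then have "\<exists>M. \<exists>T. ?m T = M \<and> P T" by blast
  then obtain M where "\<exists>T. ?m T = M \<and> P T" "\<forall>N<M. \<not> (\<exists>T. ?m T = N \<and> P T)"
    unfolding exists_least_iff[of "\<lambda>M. \<exists>T. ?m T = M \<and> P T"] by blast
  then obtain T where T: "P T" and min: "\<And>U. ?m U < ?m T \<Longrightarrow> \<not> P U"
    by blast
  have finT: "\<forall>t\<in>set T. fin_atom t" using T by (simp add: P_def)
  define Us where "Us = (\<lambda>i. take i T @ weaken z (T ! i) @ drop (Suc i) T) ` {..<length T}"
  have Us: "T1 @ weaken z t @ T2 \<in> Us" if "T = T1 @ t # T2" for T1 t T2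
    unfolding Us_def using that by (auto intro!: image_eqI[of _ _ "length T1"])
  \<comment> \<open>By minimality each weakening \<open>U\<close> of a single atom fails at some
    precision.\<close>
  have "\<exists>k. \<forall>(w, w')\<in>W. w \<in> prod_lang U \<longrightarrow> \<not> sub_eq k w w'" if U: "U \<in> Us" for U
  proof -
    obtain i where i: "i < length T" "U = take i T @ weaken z (T ! i) @ drop (Suc i) T"
      using U by (auto simp: Us_def)
    have Ti: "T = take i T @ T ! i # drop (Suc i) T" using i(1) by (rule id_take_nth_drop)
    have fi: "fin_atom (T ! i)" using finT i(1) by simp
    have "?m U < ?m T"
      using mset_weaken_less[of "T ! i" z "take i T" "drop (Suc i) T"] fi z i(2) Ti by metis
    then have "\<not> P U" by (rule min)
    moreover have "\<forall>t\<in>set (weaken z (T ! i)). fin_atom t"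
      using fi weight_avoid[OF _ z] by (cases "T ! i") auto
    then have "\<forall>t\<in>set U. fin_atom t"
      using finT i(2) by (auto dest: in_set_takeD in_set_dropD)
    ultimately show ?thesis unfolding P_def by fastforce
  qed
  then obtain k where k: "\<And>U w w'. U \<in> Us \<Longrightarrow> (w, w') \<in> W \<Longrightarrow> w \<in> prod_lang U \<Longrightarrow> \<not> sub_eq (k U) w w'"
    by (metis (mono_tags, lifting) case_prodD)
  \<comment> \<open>Precise enough to keep \<open>w\<close> out of every weakening, and long enough
    for the obstructions to carry membership in \<open>T\<close> and non-membership in the
    weakenings over to \<open>w'\<close>.\<close>
  define l where "l = Suc (length T) + (\<Sum>U\<in>Us. k U + Suc (length U))"
  have l: "k U \<le> l" "Suc (length U) \<le> l" if "U \<in> Us" for U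
    using member_le_sum[of U Us "\<lambda>U. k U + Suc (length U)"] that by (auto simp: l_def Us_def)
  obtain w w' where w: "(w, w') \<in> W" "w \<in> prod_lang T" "sub_eq l w w'"
    using T unfolding P_def by blast
  have nw: "w \<notin> prod_lang U" if "U \<in> Us" for U
    using k[OF that w(1)] sub_eq_mono[OF w(3)] l[OF that] by blast
  then have nw': "w' \<notin> prod_lang U" if "U \<in> Us" for U
    using prod_lang_sub_eq[OF sub_eq_sym[OF w(3)]] l[OF that] that by blast
  have w': "w' \<in> prod_lang T"
    using prod_lang_sub_eq[OF w(3) _ w(2)] by (simp add: l_def)
  obtain us where "concat us = w" "list_all2 (full_block z) us T"
    using full_blocks_if_not_weaken[OF w(2) finT] nw Us by blast
  moreover obtain us' where "concat us' = w'" "list_all2 (full_block z) us' T"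
    using full_blocks_if_not_weaken[OF w' finT] nw' Us by blast
  ultimately show ?thesis using w(1) by blast
qed

section \<open>Gaps\<close>

lemma nfa_run_append: "nfa_run \<delta> p (u @ v) q \<longleftrightarrow> (\<exists>x. nfa_run \<delta> p u x \<and> nfa_run \<delta> x v q)"
  by (induction u arbitrary: p) auto

definition wpow :: "nat \<Rightarrow> 'a list \<Rightarrow> 'a list" where
  "wpow n v = concat (replicate n v)"

lemma wpow_simps [simp]: "wpow 0 v = []" "wpow (Suc n) v = v @ wpow n v"
  by (simp_all add: wpow_def)

lemma wpow_add: "wpow (m + n) v = wpow m v @ wpow n v"
  by (induction m) auto

lemma length_wpow [simp]: "length (wpow n v) = n * length v"
  by (induction n) auto

lemma nfa_run_wpow: "nfa_run \<delta> x v x \<Longrightarrow> nfa_run \<delta> x (wpow n v) x"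
  by (induction n) (auto simp: nfa_run_append)

lemma en_shift: "c dvd l \<Longrightarrow> en c (s + l) w = en c s w"
  by (rule en_cong) (auto elim: dvdE)

lemma set_en_wpow: "c dvd length v \<Longrightarrow> set (en c s v) \<subseteq> D \<Longrightarrow> set (en c s (wpow n v)) \<subseteq> D"
  by (induction n) (auto simp: en_append en_shift)

lemma set_en_dvd: "c dvd d \<Longrightarrow> set (en c s w) = (\<lambda>(a, i). (a, i mod c)) ` set (en d s w)"
  by (metis list.set_map map_en_dvd)

lemma set_en_mod_less: "(a, i) \<in> set (en d s w) \<Longrightarrow> d > 0 \<Longrightarrow> i < d"
  by (auto simp: set_en)

lemma shift_mod:
  fixes X Y c d :: nat
  assumes "c dvd d" "d > 0" "X mod c = Y mod c"
  shows "\<exists>t<d. (X + t * c) mod d = Y mod d"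
proof -
  \<comment> \<open>\<open>d - 1\<close> acts as -1 modulo \<open>d\<close>, so
    \<open>X * (d - 1)\<close> stands for \<open>-X\<close> in the natural numbers.\<close>
  have "c dvd Y + X * (d - 1)"
  proof -
    have "(Y + X * (d - 1)) mod c = (X + X * (d - 1)) mod c"
      using assms(3) by (intro mod_add_cong) simp_all
    moreover have "X + X * (d - 1) = X * d" using assms(2) by (cases d) auto
    ultimately show ?thesis
      using dvd_mult[OF assms(1), of X] by (simp only: dvd_eq_mod_eq_0)
  qed
  then obtain t where t: "Y + X * (d - 1) = c * t" by (auto elim: dvdE)
  have "(X + (t mod d) * c) mod d = (X + c * t) mod d"
    by (intro mod_add_cong) (simp_all add: mod_mult_right_eq mult.commute[of _ c])
  also have "X + c * t = Y + X * d" unfolding t[symmetric] using assms(2) by (cases d) auto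
  finally have "(X + (t mod d) * c) mod d = Y mod d" by simp
  then show ?thesis using assms(2) by (intro exI[of _ "t mod d"]) simp
qed

text \<open>A run through a block from \<open>p\<close> to \<open>q\<close> with the loops at
  \<open>x\<close> taken out, so \<open>l\<close> counts only the entry \<open>u\<close> and the
  exit \<open>u'\<close>. \<open>D\<close> is an alphabet of letters with residues modulo
  \<open>c\<close>: \<open>v\<close> reads all of it, and the other parts stay inside it. As both
  loop lengths are multiples of \<open>c\<close>, the loops and the exit share the offset
  \<open>s + length u\<close>.\<close>

definition gap_side :: "(nat \<times> nat \<times> nat) list \<Rightarrow> nat \<Rightarrow> (nat \<times> nat) set \<Rightarrow> nat \<Rightarrow> nat \<Rightarrow> nat \<Rightarrow> nat \<Rightarrow> bool" where
  "gap_side \<delta> c D s p l q \<longleftrightarrow> (\<exists>x u v v' u'.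
     nfa_run \<delta> p u x \<and> nfa_run \<delta> x v x \<and> nfa_run \<delta> x v' x \<and> nfa_run \<delta> x u' q \<and>
     l = length u + length u' \<and> c dvd length v \<and> length v' = length v + c \<and>
     set (en c s u) \<subseteq> D \<and> set (en c (s + length u) v) = D \<and>
     set (en c (s + length u) v') \<subseteq> D \<and> set (en c (s + length u) u') \<subseteq> D)"

text \<open>Rounds of a loop whose length is congruent to \<open>c\<close> modulo \<open>d\<close>
  bring the letters of \<open>D\<close> to every compatible residue modulo \<open>d\<close>. After
  \<open>k * d\<close> rounds all words of length at most \<open>k\<close> over these letters occur,
  so the short subwords depend on \<open>c\<close>, \<open>d\<close> and \<open>D\<close> alone and
  not on the automaton.\<close>

lemma gap_side_words:
  assumes gap: "gap_side \<delta> c D s p l q" and c: "c dvd d" "d > 0" and s1: "s1 mod c = s mod c"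
    and n: "n \<ge> k * d"
  shows "\<exists>g. nfa_run \<delta> p g q \<and> length g mod d = (l + n * c) mod d \<and>
    (\<forall>y. length y \<le> k \<longrightarrow> subseq y (en d s1 g) = (set y \<subseteq> {(a, i). i < d \<and> (a, i mod c) \<in> D}))"
proof -
  obtain x u v v' u' where run: "nfa_run \<delta> p u x" "nfa_run \<delta> x v x" "nfa_run \<delta> x v' x" "nfa_run \<delta> x u' q"
    and l: "l = length u + length u'" and len: "c dvd length v" "length v' = length v + c"
    and D: "set (en c s u) \<subseteq> D" "set (en c (s + length u) v) = D"
     "set (en c (s + length u) v') \<subseteq> D" "set (en c (s + length u) u') \<subseteq> D"
    using gap unfolding gap_side_def by blast
  have c0: "c > 0" using c by (metis dvd_pos_nat)
  \<comment> \<open>The length is \<open>2 * d * length v + c\<close>, congruent to \<open>c\<close>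
    modulo \<open>d\<close>; the copy of \<open>v\<close> behind \<open>v'\<close> supplies all of
    \<open>D\<close> in every round.\<close>
  define V where "V = v' @ v @ wpow (2 * (d - 1)) v"
  define g where "g = u @ wpow n V @ u'"
  let ?F = "{(a, i). i < d \<and> (a, i mod c) \<in> D}"
  have lenV: "length V = 2 * d * length v + c"
    using c(2) by (cases d) (auto simp: V_def len algebra_simps)
  have cV: "c dvd length V" using len(1) by (simp add: lenV)
  have cv': "c dvd length v'" using len by simp
  have VD: "set (en c (s + length u) V) \<subseteq> D"
    using D set_en_wpow[OF len(1), of "s + length u" D] cv' len(1)
    by (simp add: V_def en_append en_shift)
  have gD: "set (en c s g) \<subseteq> D"
    using D(1,4) set_en_wpow[OF cV VD, of n] cV by (simp add: g_def en_append en_shift)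
  have block: "?F \<subseteq> set (en d s2 (wpow d V))" if s2eq: "s2 mod c = (s + length u) mod c" for s2
  proof
    fix b assume "b \<in> ?F"
    then obtain a i where b: "b = (a, i)" "i < d" "(a, i mod c) \<in> D" by auto
    then obtain j where j: "j < length v" "v ! j = a" "(s + length u + j) mod c = i mod c"
      using D(2) by (auto simp: set_en)
    obtain m where "length v' = c * m" using cv' by (auto elim: dvdE)
    then have "s2 + length v' + j = (s2 + j) + c * m" by simp
    then have "(s2 + length v' + j) mod c = (s2 + j) mod c" by (simp only: mod_mult_self2)
    also have "\<dots> = (s + length u + j) mod c" using s2eq by (intro mod_add_cong) simp_all
    finally have "(s2 + length v' + j) mod c = i mod c" using j(3) by simp
    \<comment> \<open>Round \<open>t\<close> starts \<open>t * c\<close> later modulo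
      \<open>d\<close>; a suitable \<open>t\<close> puts the letter on residue
      \<open>i\<close>.\<close>
    then obtain t where t: "t < d" "(s2 + length v' + j + t * c) mod d = i mod d"
      using shift_mod[OF c] by blast
    have "(s2 + t * length V + length v' + j) mod d = i"
    proof -
      have "s2 + t * length V + length v' + j = (s2 + length v' + j + t * c) + d * (2 * t * length v)"
        unfolding lenV by (simp add: algebra_simps)
      then have "(s2 + t * length V + length v' + j) mod d = (s2 + length v' + j + t * c) mod d"
        by (simp only: mod_mult_self2)
      then show ?thesis using t(2) b(2) by simp
    qed
    then have "b \<in> set (en d (s2 + t * length V + length v') v)"
      unfolding set_en b(1) using j by (auto intro!: image_eqI[of _ _ j])
    then have "b \<in> set (en d (s2 + t * length V) V)" by (simp add: V_def en_append)
    then have "b \<in> set (en d s2 (wpow t V @ V @ wpow (d - Suc t) V))" by (simp add: en_append)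
    moreover have "wpow d V = wpow t V @ V @ wpow (d - Suc t) V"
      using wpow_add[of t "Suc (d - Suc t)" V] t(1) by simp
    ultimately show "b \<in> set (en d s2 (wpow d V))" by simp
  qed
  have all: "subseq y (en d s2 (wpow n V))"
    if "set y \<subseteq> ?F" "n \<ge> length y * d" "s2 mod c = (s + length u) mod c" for y n s2
    using that
  proof (induction y arbitrary: n s2)
    case (Cons b y)
    have "[b] @ y = b # y" by simp
    have "subseq [b] (en d s2 (wpow d V))"
      unfolding subseq_singleton_left
      by (rule subsetD[OF block[OF Cons.prems(3)]]) (use Cons.prems(1) in simp)
    moreover have "subseq y (en d (s2 + d * length V) (wpow (n - d) V))"
    proof (rule Cons.IH)
      show "(s2 + d * length V) mod c = (s + length u) mod c"
        using Cons.prems(3) cV by (auto elim!: dvdE simp: mult.left_commute[of d])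
    qed (use Cons.prems in auto)
    ultimately have "subseq ([b] @ y) (en d s2 (wpow d V) @ en d (s2 + d * length V) (wpow (n - d) V))"
      by (rule list_emb_append_mono)
    moreover have "wpow n V = wpow d V @ wpow (n - d) V"
      using wpow_add[of d "n - d" V] Cons.prems(2) by simp
    ultimately show ?case by (simp add: en_append)
  qed simp
  have "nfa_run \<delta> x V x" using run nfa_run_wpow[OF run(2)] by (auto simp: V_def nfa_run_append)
  from nfa_run_wpow[OF this, of n] have "nfa_run \<delta> p g q"
    unfolding g_def nfa_run_append using run by blast
  moreover have "length g mod d = (l + n * c) mod d"
  proof -
    have "length g = (l + n * c) + d * (2 * n * length v)"
      by (simp add: g_def l lenV algebra_simps)
    then show ?thesis by (simp only: mod_mult_self2)
  qed
  moreover have "subseq y (en d s1 g) = (set y \<subseteq> ?F)" if "length y \<le> k" for y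
  proof
    assume "subseq y (en d s1 g)"
    then have "set y \<subseteq> set (en d s1 g)" by (rule subseq_set)
    moreover have "set (en c s1 g) \<subseteq> D" using gD en_cong[OF s1] by metis
    then have "set (en d s1 g) \<subseteq> ?F"
      using set_en_dvd[OF c(1), of s1 g] set_en_mod_less[of _ _ d s1 g] c(2) by fastforce
    ultimately show "set y \<subseteq> ?F" by blast
  next
    assume "set y \<subseteq> ?F"
    moreover have "n \<ge> length y * d" using n that by (meson le_trans mult_le_mono1)
    moreover have "(s1 + length u) mod c = (s + length u) mod c" using s1 by (intro mod_add_cong) simp_all
    ultimately have "subseq y (en d (s1 + length u) (wpow n V))" by (rule all)
    then show "subseq y (en d s1 g)"
      by (auto simp: g_def en_append intro: subseq_drop_many subseq_rev_drop_many)
  qed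
  ultimately show ?thesis by blast
qed

text \<open>\<open>s\<close> and \<open>s'\<close> count letters with the pumped loops left out.
  They may drift apart in a gap, where the two sides share only \<open>c\<close> and
  \<open>D\<close>. Reading a common letter requires agreement modulo \<open>d\<close>, because the
  letter has to carry the same residue on both sides.\<close>

inductive reach :: "(nat \<times> nat \<times> nat) list \<Rightarrow> (nat \<times> nat \<times> nat) list \<Rightarrow> nat set \<Rightarrow> nat set \<Rightarrow> nat
    \<Rightarrow> nat \<Rightarrow> nat \<Rightarrow> nat \<Rightarrow> nat \<Rightarrow> bool"
  for \<delta> \<delta>' I I' d where
  start: "p \<in> I \<Longrightarrow> r \<in> I' \<Longrightarrow> reach \<delta> \<delta>' I I' d p 0 r 0"
| letter: "reach \<delta> \<delta>' I I' d p s r s' \<Longrightarrow> s mod d = s' mod d \<Longrightarrow> (p, a, q) \<in> set \<delta> \<Longrightarrow> (r, a, q') \<in> set \<delta>'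
    \<Longrightarrow> reach \<delta> \<delta>' I I' d q (Suc s) q' (Suc s')"
| gap: "reach \<delta> \<delta>' I I' d p s r s' \<Longrightarrow> c dvd d \<Longrightarrow> gap_side \<delta> c D s p l q \<Longrightarrow> gap_side \<delta>' c D s' r l' q'
    \<Longrightarrow> reach \<delta> \<delta>' I I' d q (s + l) q' (s' + l')"

text \<open>Pumping the gaps realises the path for an arbitrary multiple \<open>e\<close> of
  \<open>d\<close> and an arbitrary \<open>k\<close>. The last conjunct is conditional because
  lengths can be aligned modulo \<open>e\<close> only when the counters already agree modulo
  \<open>d\<close>.\<close>

lemma reach_sound:
  assumes "reach \<delta> \<delta>' I I' d p s r s'" and d: "d dvd e" "e > 0"
  shows "\<exists>w w'. \<exists>p0\<in>I. \<exists>r0\<in>I'. nfa_run \<delta> p0 w p \<and> nfa_run \<delta>' r0 w' r \<and>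
    length w mod d = s mod d \<and> length w' mod d = s' mod d \<and> sub_eq k (en e 0 w) (en e 0 w') \<and>
    (s mod d = s' mod d \<longrightarrow> length w mod e = length w' mod e)"
  using assms(1)
proof (induction rule: reach.induct)
  case (start p r)
  then show ?case by (intro exI[of _ "[]"]) auto
next
  case (letter p s r s' a q q')
  then obtain w w' p0 r0 where w: "p0 \<in> I" "r0 \<in> I'" "nfa_run \<delta> p0 w p" "nfa_run \<delta>' r0 w' r"
    "length w mod d = s mod d" "length w' mod d = s' mod d" "sub_eq k (en e 0 w) (en e 0 w')"
    "length w mod e = length w' mod e" by blast
  have "sub_eq k (en e 0 (w @ [a])) (en e 0 (w' @ [a]))"
    using w(7,8) by (simp add: en_append sub_eq_append)
  moreover have "nfa_run \<delta> p0 (w @ [a]) q" "nfa_run \<delta>' r0 (w' @ [a]) q'"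
    using w letter by (auto simp: nfa_run_append)
  moreover have "length (w @ [a]) mod d = Suc s mod d" "length (w' @ [a]) mod d = Suc s' mod d"
    "length (w @ [a]) mod e = length (w' @ [a]) mod e"
    using w(5,6,8) by (simp_all add: Suc_mod_eq_iff)
  ultimately show ?case using w(1,2) by blast
next
  case (gap p s r s' c D l q l' q')
  then obtain w w' p0 r0 where w: "p0 \<in> I" "r0 \<in> I'" "nfa_run \<delta> p0 w p" "nfa_run \<delta>' r0 w' r"
    "length w mod d = s mod d" "length w' mod d = s' mod d" "sub_eq k (en e 0 w) (en e 0 w')"
    by blast
  have ce: "c dvd e" using gap d by (meson dvd_trans)
  have mc: "length w mod c = s mod c" "length w' mod c = s' mod c"
    using w(5,6) gap(2) by (metis mod_mod_cancel)+
  have "length w mod d = s mod d" using w(5) .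
  then have modd: "(length w + l) mod d = (s + l) mod d" "(length w' + l') mod d = (s' + l') mod d"
    using w(5,6) by (intro mod_add_cong; simp)+
  \<comment> \<open>Only one side is lengthened: \<open>t * d\<close> more letters make the two
    lengths agree modulo \<open>e\<close>.\<close>
  have "\<exists>t. (s + l) mod d = (s' + l') mod d \<longrightarrow> (length w + l + t * d) mod e = (length w' + l') mod e"
    using shift_mod[OF d, of "length w + l" "length w' + l'"] modd by metis
  then obtain t where t: "(s + l) mod d = (s' + l') mod d \<Longrightarrow> (length w + l + t * d) mod e = (length w' + l') mod e"
    by blast
  obtain f where f: "d = c * f" using gap(2) by (auto elim: dvdE)
  \<comment> \<open>Modulo \<open>e\<close> each round adds \<open>c\<close> letters. The first
    \<open>k * e\<close> rounds produce the short subwords and add a multiple of \<open>e\<close>;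
    the other \<open>t * f\<close> rounds add \<open>t * d\<close>, because
    \<open>d = c * f\<close>.\<close>
  define n where "n = k * e + t * f"
  have nc: "n * c = e * (k * c) + t * d" by (simp add: n_def f algebra_simps)
  obtain g where g: "nfa_run \<delta> p g q" "length g mod e = (l + n * c) mod e"
    "\<And>y. length y \<le> k \<Longrightarrow> subseq y (en e (length w) g) = (set y \<subseteq> {(a, i). i < e \<and> (a, i mod c) \<in> D})"
    using gap_side_words[OF gap(3) ce d(2) mc(1), of k n] by (auto simp: n_def)
  obtain g' where g': "nfa_run \<delta>' r g' q'" "length g' mod e = (l' + k * e * c) mod e"
    "\<And>y. length y \<le> k \<Longrightarrow> subseq y (en e (length w') g') = (set y \<subseteq> {(a, i). i < e \<and> (a, i mod c) \<in> D})"
    using gap_side_words[OF gap(4) ce d(2) mc(2), of k "k * e"] by auto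
  have "sub_eq k (en e (length w) g) (en e (length w') g')"
    using g(3) g'(3) by (simp add: sub_eq_def)
  then have "sub_eq k (en e 0 (w @ g)) (en e 0 (w' @ g'))"
    using w(7) by (simp add: en_append sub_eq_append)
  moreover have "nfa_run \<delta> p0 (w @ g) q" "nfa_run \<delta>' r0 (w' @ g') q'"
    using w g g' by (auto simp: nfa_run_append)
  moreover have le: "length (w @ g) mod e = (length w + l + t * d) mod e"
  proof -
    have "length (w @ g) mod e = (length w + (l + n * c)) mod e"
      unfolding length_append using g(2) by (intro mod_add_cong) simp_all
    also have "length w + (l + n * c) = (length w + l + t * d) + e * (k * c)"
      by (simp add: nc)
    finally show ?thesis by (simp only: mod_mult_self2)
  qed
  moreover have le': "length (w' @ g') mod e = (length w' + l') mod e"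
  proof -
    have "length (w' @ g') mod e = (length w' + (l' + k * e * c)) mod e"
      unfolding length_append using g'(2) by (intro mod_add_cong) simp_all
    also have "length w' + (l' + k * e * c) = (length w' + l') + e * (k * c)"
      by (simp add: algebra_simps)
    finally show ?thesis by (simp only: mod_mult_self2)
  qed
  moreover have "length (w @ g) mod d = (s + l) mod d"
    using arg_cong[OF le, of "\<lambda>x. x mod d"] modd(1) by (simp add: mod_mod_cancel[OF d(1)])
  moreover have "length (w' @ g') mod d = (s' + l') mod d"
    using arg_cong[OF le', of "\<lambda>x. x mod d"] modd(2) by (simp add: mod_mod_cancel[OF d(1)])
  moreover have "(s + l) mod d = (s' + l') mod d \<longrightarrow> length (w @ g) mod e = length (w' @ g') mod e"
    using t le le' by simp
  ultimately show ?case using w(1,2) by blast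
qed

section \<open>Inseparability as reachability\<close>

definition states :: "(nat \<times> nat \<times> nat) list \<Rightarrow> nat set" where
  "states \<delta> = fst ` set \<delta> \<union> (snd \<circ> snd) ` set \<delta>"

lemma finite_states [simp]: "finite (states \<delta>)"
  by (simp add: states_def)

lemma nfa_run_states: "nfa_run \<delta> p w q \<Longrightarrow> p \<in> states \<delta> \<Longrightarrow> q \<in> states \<delta>"
proof (induction w arbitrary: p)
  case (Cons a w)
  then obtain p' where "(p, a, p') \<in> set \<delta>" "nfa_run \<delta> p' w q" by auto
  moreover from this(1) have "p' \<in> states \<delta>" by (force simp: states_def)
  ultimately show ?case using Cons.IH by blast
qed simp

lemma nfa_run_start_state: "nfa_run \<delta> p w q \<Longrightarrow> w \<noteq> [] \<Longrightarrow> p \<in> states \<delta>"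
  by (cases w) (force simp: states_def)+

text \<open>Within the strongly connected component of \<open>x\<close> under moves that read only
  enriched letters of \<open>v\<close>, these states lie at distance 0 modulo \<open>c\<close> from
  \<open>x\<close>. Their number is the potential that bounds how often the modulus is
  refined.\<close>

definition slot :: "(nat \<times> nat \<times> nat) list \<Rightarrow> nat \<Rightarrow> nat list \<Rightarrow> nat \<Rightarrow> nat \<Rightarrow> nat set" where
  "slot \<delta> x v s c = {p. \<exists>u u'. nfa_run \<delta> x u p \<and> nfa_run \<delta> p u' x \<and>
     set (en c s u) \<subseteq> set (en c s v) \<and> set (en c s u') \<subseteq> set (en c s v) \<and> c dvd length u \<and> c dvd length u'}"

lemma slot_subset_states: "x \<in> states \<delta> \<Longrightarrow> slot \<delta> x v s c \<subseteq> states \<delta>"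
  by (auto simp: slot_def intro: nfa_run_states)

lemma slot_antimono:
  assumes "c dvd d" shows "slot \<delta> x v s d \<subseteq> slot \<delta> x v s c"
proof
  have sub: "set (en c s u) \<subseteq> set (en c s v)" if "set (en d s u) \<subseteq> set (en d s v)" for u
    unfolding set_en_dvd[OF assms] using that by (rule image_mono)
  fix p assume "p \<in> slot \<delta> x v s d"
  then obtain u u' where u: "nfa_run \<delta> x u p" "nfa_run \<delta> p u' x" "set (en d s u) \<subseteq> set (en d s v)"
    "set (en d s u') \<subseteq> set (en d s v)" "d dvd length u" "d dvd length u'"
    unfolding slot_def by blast
  then have "c dvd length u" "c dvd length u'" using assms by (auto intro: dvd_trans)
  then show "p \<in> slot \<delta> x v s c" unfolding slot_def using u sub by blast
qed

definition loops :: "(nat \<times> nat \<times> nat) list \<Rightarrow> nat \<Rightarrow> nat list \<Rightarrow> nat \<Rightarrow> nat \<Rightarrow> nat list set" where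
  "loops \<delta> x v s c = {u. nfa_run \<delta> x u x \<and> set (en c s u) \<subseteq> set (en c s v) \<and> c dvd length u}"

lemma loops_append: "u \<in> loops \<delta> x v s c \<Longrightarrow> u' \<in> loops \<delta> x v s c \<Longrightarrow> u @ u' \<in> loops \<delta> x v s c"
  by (auto simp: loops_def nfa_run_append en_append en_shift)

lemma loops_wpow: "u \<in> loops \<delta> x v s c \<Longrightarrow> wpow n u \<in> loops \<delta> x v s c"
proof (induction n)
  case 0
  then show ?case by (simp add: loops_def)
qed (simp add: loops_append)

text \<open>If \<open>c\<close> is not yet the period of the loops at \<open>x\<close> over the letters of \<open>v\<close>, then passing to the
  period removes a state from the slot of states that share the residue of \<open>x\<close>.\<close>

lemma loop_refine:
  assumes run: "nfa_run \<delta> x v x" and v: "v \<noteq> []" and c: "c dvd length v"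
  shows "(\<exists>u u'. u \<in> loops \<delta> x v s c \<and> u' \<in> loops \<delta> x v s c \<and> length u' = length u + c) \<or>
    (\<exists>t. 2 \<le> t \<and> t \<le> card (states \<delta>) \<and> t * c dvd length v \<and>
      card (slot \<delta> x v s (t * c)) < card (slot \<delta> x v s c))"
proof -
  let ?L = "loops \<delta> x v s c"
  \<comment> \<open>\<open>Q\<close> describes the positive differences of loop lengths; the least
    of them, \<open>g\<close>, is the period.\<close>
  define Q where "Q n \<longleftrightarrow> n > 0 \<and> (\<exists>u u'. u \<in> ?L \<and> u' \<in> ?L \<and> length u' = length u + n)" for n
  have c0: "c > 0" using c v by (cases c) auto
  have vL: "v \<in> ?L" using run c by (simp add: loops_def)
  have "[] \<in> ?L" by (simp add: loops_def)
  then have "Q (length v)" unfolding Q_def using vL v by (intro conjI exI[of _ "[]"] exI[of _ v]) auto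
  then obtain g where Qg: "Q g" and min: "\<And>n. n < g \<Longrightarrow> \<not> Q n"
    by (metis exists_least_iff)
  then obtain u u' where g: "g > 0" "u \<in> ?L" "u' \<in> ?L" "length u' = length u + g"
    unfolding Q_def by blast
  \<comment> \<open>Otherwise \<open>w\<close> followed by \<open>q\<close> copies of
    \<open>u\<close>, compared with \<open>q\<close> copies of \<open>u'\<close>, would give the
    smaller difference \<open>length w mod g\<close>.\<close>
  have div: "g dvd length w" if w: "w \<in> ?L" for w
  proof (rule ccontr)
    assume nd: "\<not> g dvd length w"
    define q where "q = length w div g"
    have "w @ wpow q u \<in> ?L" "wpow q u' \<in> ?L" using w g by (auto intro: loops_append loops_wpow)
    moreover have "length (w @ wpow q u) = length (wpow q u') + length w mod g"
    proof -
      have "length w = q * g + length w mod g" by (simp add: q_def)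
      then show ?thesis using g(4) by (simp add: algebra_simps)
    qed
    moreover have "length w mod g > 0" using nd by (simp add: dvd_eq_mod_eq_0)
    ultimately have "Q (length w mod g)" unfolding Q_def by blast
    then show False using min[of "length w mod g"] g(1) by simp
  qed
  have "c dvd length u" "c dvd length u + g" using g by (auto simp: loops_def)
  then have "c dvd g" by (simp add: dvd_add_right_iff)
  then obtain t where t: "g = t * c" by (metis dvdE mult.commute)
  show ?thesis
  proof (cases "g = c")
    case True
    then show ?thesis using g by blast
  next
    case False
    have t2: "2 \<le> t" using t g(1) False by (cases t; cases "t - 1") auto
    have gv: "g dvd length v" using div vL .
    then have glev: "g \<le> length v" using v by (auto intro: dvd_imp_le)
    have "\<exists>p. nfa_run \<delta> x (take n v) p \<and> nfa_run \<delta> p (drop n v) x" for n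
      using run nfa_run_append[of \<delta> x "take n v" "drop n v" x] by simp
    then obtain \<pi> where \<pi>: "\<And>n. nfa_run \<delta> x (take n v) (\<pi> n)" "\<And>n. nfa_run \<delta> (\<pi> n) (drop n v) x"
      by metis
    have lt: "i * c < length v" if "i < t" for i
      using that glev t c0 by (meson less_le_trans mult_less_mono1)
    have sub: "set (en c s (take (i * c) v)) \<subseteq> set (en c s v)"
      "set (en c s (drop (i * c) v)) \<subseteq> set (en c s v)" if "i < t" for i
    proof -
      have "en c s v = en c s (take (i * c) v) @ en c (s + i * c) (drop (i * c) v)"
        using en_append[of c s "take (i * c) v" "drop (i * c) v"] lt[OF that] by simp
      also have "en c (s + i * c) (drop (i * c) v) = en c s (drop (i * c) v)"
        by (simp add: en_shift)
      finally show "set (en c s (take (i * c) v)) \<subseteq> set (en c s v)"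
        "set (en c s (drop (i * c) v)) \<subseteq> set (en c s v)" by auto
    qed
    have dl: "c dvd length (take (i * c) v)" "c dvd length (drop (i * c) v)" if "i < t" for i
      using lt[OF that] c by (auto intro: dvd_diff_nat)
    have inslot: "\<pi> (i * c) \<in> slot \<delta> x v s c" if "i < t" for i
      unfolding slot_def using \<pi> sub[OF that] dl[OF that] by blast
    \<comment> \<open>Cutting out the part between two equal states would leave a loop whose length
      is not a multiple of \<open>g\<close>. So the slot contains \<open>t\<close> distinct states,
      which bounds \<open>t\<close>.\<close>
    have distinct: "\<pi> (i * c) \<noteq> \<pi> (j * c)" if "i < j" "j < t" for i j
    proof
      assume eq: "\<pi> (i * c) = \<pi> (j * c)"
      have it: "i < t" using that by simp
      have "take (i * c) v @ drop (j * c) v \<in> ?L"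
        using \<pi>(1)[of "i * c"] \<pi>(2)[of "j * c"] eq sub[OF it] sub[OF that(2)] dl[OF it] dl[OF that(2)]
        by (auto simp: loops_def nfa_run_append en_append en_shift)
      then have "g dvd length (take (i * c) v @ drop (j * c) v)" by (rule div)
      moreover have "length v - length (take (i * c) v @ drop (j * c) v) = (j - i) * c"
        using lt[OF that(2)] lt[OF it] that(1) by (simp add: diff_mult_distrib)
      ultimately have "g dvd (j - i) * c" using gv by (metis dvd_diff_nat)
      then have "g \<le> (j - i) * c" using that c0 by (intro dvd_imp_le) auto
      moreover have "(j - i) * c < t * c" using that c0 by (intro mult_less_mono1) auto
      ultimately show False using t by simp
    qed
    have xs: "x \<in> states \<delta>" using nfa_run_start_state run v by blast
    have fin: "finite (slot \<delta> x v s c)" by (rule finite_subset[OF slot_subset_states[OF xs] finite_states])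
    have "inj_on (\<lambda>i. \<pi> (i * c)) {..<t}"
      by (rule linorder_inj_onI) (use distinct in auto)
    then have "card {..<t} \<le> card (slot \<delta> x v s c)"
      by (rule card_inj_on_le) (use inslot fin in auto)
    moreover have "card (slot \<delta> x v s c) \<le> card (states \<delta>)"
      using slot_subset_states[OF xs] by (intro card_mono) auto
    ultimately have "t \<le> card (states \<delta>)" by simp
    \<comment> \<open>The state after \<open>c\<close> letters drops out of the slot: a path to it
      of length divisible by \<open>g\<close> would close up to a loop of length congruent to
      \<open>-c\<close> modulo \<open>g\<close>.\<close>
    moreover have "\<pi> (1 * c) \<notin> slot \<delta> x v s g"
    proof
      assume "\<pi> (1 * c) \<in> slot \<delta> x v s g"
      then obtain y where y: "nfa_run \<delta> x y (\<pi> (1 * c))" "set (en g s y) \<subseteq> set (en g s v)" "g dvd length y"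
        unfolding slot_def by blast
      have cy: "set (en c s y) \<subseteq> set (en c s v)"
        unfolding set_en_dvd[OF \<open>c dvd g\<close>] using y(2) by (rule image_mono)
      have "1 < t" using t2 by simp
      have "c dvd length y" using y(3) \<open>c dvd g\<close> dvd_trans by blast
      then have "y @ drop (1 * c) v \<in> ?L"
        using y(1) \<pi>(2)[of "1 * c"] sub[OF \<open>1 < t\<close>] dl[OF \<open>1 < t\<close>] cy
        by (auto simp: loops_def nfa_run_append en_append en_shift)
      then have "g dvd length (y @ drop (1 * c) v)" by (rule div)
      then have "g dvd length v - c" using y(3) by (simp add: dvd_add_right_iff)
      then have "g dvd length v - (length v - c)" using gv by (rule dvd_diff_nat[rotated])
      then have "g dvd c" using lt[OF \<open>1 < t\<close>] by simp
      then have "g \<le> c" using c0 by (rule dvd_imp_le)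
      then show False using t t2 c0 by simp
    qed
    then have "slot \<delta> x v s g \<subset> slot \<delta> x v s c"
      using slot_antimono[OF \<open>c dvd g\<close>, of \<delta> x v s] inslot[of 1] t2 by auto
    then have "card (slot \<delta> x v s g) < card (slot \<delta> x v s c)" using fin by (rule psubset_card_mono[rotated])
    ultimately show ?thesis using t t2 gv by blast
  qed
qed

definition two_loops :: "(nat \<times> nat \<times> nat) list \<Rightarrow> nat \<Rightarrow> (nat \<times> nat) set \<Rightarrow> nat \<Rightarrow> nat \<Rightarrow> bool" where
  "two_loops \<delta> c D s x \<longleftrightarrow> (\<exists>v v'. nfa_run \<delta> x v x \<and> nfa_run \<delta> x v' x \<and> c dvd length v \<and>
     length v' = length v + c \<and> set (en c s v) = D \<and> set (en c s v') \<subseteq> D)"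

text \<open>Putting \<open>v\<close> in front of both loops keeps their difference \<open>c\<close>
  and makes the shorter one read the whole alphabet.\<close>

lemma two_loops_if_loops:
  assumes "v \<in> loops \<delta> x v s c" "u \<in> loops \<delta> x v s c" "u' \<in> loops \<delta> x v s c" "length u' = length u + c"
  shows "two_loops \<delta> c (set (en c s v)) s x"
  unfolding two_loops_def
  using assms by (intro exI[of _ "v @ u"] exI[of _ "v @ u'"])
    (auto simp: loops_def nfa_run_append en_append en_shift)

text \<open>Both automata have to settle on one modulus, so the potential \<open>f\<close> is the
  sum of the two slot sizes; refining for one side never enlarges the slot of the other. At a
  \<open>c\<close> of least potential no refinement is left, so both sides have their two
  loops.\<close>

lemma common_modulus:
  assumes run: "nfa_run \<delta> x v x" "v \<noteq> []" "d dvd length v" "card (states \<delta>) \<le> N"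
    and run': "nfa_run \<delta>' x' v' x'" "v' \<noteq> []" "d dvd length v'" "card (states \<delta>') \<le> N"
    and d: "d = fact N ^ (2 * N)" and eq: "set (en d s v) = set (en d s' v')"
  shows "\<exists>c. c dvd d \<and> two_loops \<delta> c (set (en c s v)) s x \<and> two_loops \<delta>' c (set (en c s v)) s' x'"
proof -
  let ?A = "slot \<delta> x v s" and ?B = "slot \<delta>' x' v' s'"
  define f where "f c = card (?A c) + card (?B c)" for c
  \<comment> \<open>Invariant: \<open>d\<close> still has room for \<open>f c\<close> further
    factors between 2 and \<open>N\<close>. It holds at \<open>c = 1\<close> because
    \<open>f 1\<close> is at most \<open>2 * N\<close>.\<close>
  define P where "P c \<longleftrightarrow> c * fact N ^ f c dvd d" for c
  have A: "x \<in> states \<delta>" and B: "x' \<in> states \<delta>'"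
    using run run' nfa_run_start_state by blast+
  have finA: "finite (?A c)" and finB: "finite (?B c)" for c
    using slot_subset_states[OF A] slot_subset_states[OF B] finite_subset finite_states by metis+
  have "f 1 \<le> 2 * N"
    unfolding f_def
    using card_mono[OF finite_states slot_subset_states[OF A, of v s 1]]
      card_mono[OF finite_states slot_subset_states[OF B, of v' s' 1]] run(4) run'(4) by linarith
  then have "P 1" unfolding P_def d by (simp add: le_imp_power_dvd)
  then obtain c where Pc: "P c" and min: "\<And>c'. P c' \<Longrightarrow> f c \<le> f c'"
    using ex_has_least_nat[of P 1 f] by blast
  have cd: "c dvd d" using Pc unfolding P_def by (rule dvd_mult_left)
  then have cv: "c dvd length v" "c dvd length v'" using run(3) run'(3) by (auto intro: dvd_trans)
  have no: False if t: "t \<ge> 2" "t \<le> N" "f (t * c) < f c" for t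
  proof -
    have "t dvd fact N" using t by (intro dvd_fact) auto
    then have "t * (c * fact N ^ f (t * c)) dvd fact N * (c * fact N ^ f (t * c))" by (rule mult_dvd_mono) simp
    also have "\<dots> = c * fact N ^ Suc (f (t * c))" by simp
    also have "\<dots> dvd c * fact N ^ f c" using t(3) by (intro mult_dvd_mono le_imp_power_dvd) auto
    also have "\<dots> dvd d" using Pc unfolding P_def .
    finally have "P (t * c)" unfolding P_def by (simp add: mult.assoc)
    then show False using min t(3) by fastforce
  qed
  have monoA: "card (?A (t * c)) \<le> card (?A c)" and monoB: "card (?B (t * c)) \<le> card (?B c)" for t
    by (intro card_mono finA finB slot_antimono; simp)+
  have "two_loops \<delta> c (set (en c s v)) s x"
    using loop_refine[OF run(1,2) cv(1), of s]
  proof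
    assume "\<exists>u u'. u \<in> loops \<delta> x v s c \<and> u' \<in> loops \<delta> x v s c \<and> length u' = length u + c"
    moreover have "v \<in> loops \<delta> x v s c" using run cv by (simp add: loops_def)
    ultimately show ?thesis using two_loops_if_loops by blast
  next
    assume "\<exists>t\<ge>2. t \<le> card (states \<delta>) \<and> t * c dvd length v \<and> card (?A (t * c)) < card (?A c)"
    then obtain t where "2 \<le> t" "t \<le> N" "card (?A (t * c)) < card (?A c)" using run(4) by auto
    then have False using no[of t] monoB[of t] unfolding f_def by linarith
    then show ?thesis ..
  qed
  moreover have "two_loops \<delta>' c (set (en c s' v')) s' x'"
    using loop_refine[OF run'(1,2) cv(2), of s']
  proof
    assume "\<exists>u u'. u \<in> loops \<delta>' x' v' s' c \<and> u' \<in> loops \<delta>' x' v' s' c \<and> length u' = length u + c"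
    moreover have "v' \<in> loops \<delta>' x' v' s' c" using run' cv by (simp add: loops_def)
    ultimately show ?thesis using two_loops_if_loops by blast
  next
    assume "\<exists>t\<ge>2. t \<le> card (states \<delta>') \<and> t * c dvd length v' \<and> card (?B (t * c)) < card (?B c)"
    then obtain t where "2 \<le> t" "t \<le> N" "card (?B (t * c)) < card (?B c)" using run'(4) by auto
    then have False using no[of t] monoA[of t] unfolding f_def by linarith
    then show ?thesis ..
  qed
  moreover have "set (en c s v) = set (en c s' v')"
    unfolding set_en_dvd[OF cd] eq ..
  ultimately show ?thesis using cd by auto
qed

text \<open>\<open>h\<close> consecutive copies of \<open>z\<close> give \<open>h + 1\<close> cut
  positions. A whole copy of \<open>z\<close> lies between any two of them, so the factor between
  them reads all letters of \<open>z\<close>.\<close>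

lemma blocks_cuts:
  "subseq (wpow h z) x \<Longrightarrow> \<exists>f. (\<forall>j\<le>h. f j \<le> length x) \<and>
     (\<forall>i j. i < j \<longrightarrow> j \<le> h \<longrightarrow> set z \<subseteq> set (take (f j - f i) (drop (f i) x)) \<and> f i \<le> f j)"
proof (induction h arbitrary: x)
  case 0
  show ?case by (intro exI[of _ "\<lambda>_. 0"]) auto
next
  case (Suc h)
  have "wpow (Suc h) z = wpow h z @ z" using wpow_add[of h 1 z] by simp
  then obtain x1 x2 where x: "x = x1 @ x2" "subseq (wpow h z) x1" "subseq z x2"
    using Suc.prems list_emb_appendD[of "(=)" "wpow h z" z x] by auto
  obtain f where f: "\<And>j. j \<le> h \<Longrightarrow> f j \<le> length x1"
    "\<And>i j. i < j \<Longrightarrow> j \<le> h \<Longrightarrow> set z \<subseteq> set (take (f j - f i) (drop (f i) x1)) \<and> f i \<le> f j"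
    using Suc.IH[OF x(2)] by blast
  let ?f = "f(Suc h := length x)"
  have "set z \<subseteq> set (take (?f j - ?f i) (drop (?f i) x)) \<and> ?f i \<le> ?f j" if "i < j" "j \<le> Suc h" for i j
  proof (cases "j = Suc h")
    case True
    then show ?thesis using that f(1)[of i] subseq_set[OF x(3)] by (auto simp: x(1))
  next
    case False
    then show ?thesis using that f(2)[of i j] f(1)[of i] f(1)[of j] by (simp add: x(1))
  qed
  moreover have "?f j \<le> length x" if "j \<le> Suc h" for j
    using that f(1)[of j] by (auto simp: x(1) le_Suc_eq)
  ultimately show ?case by (intro exI[of _ ?f]) blast
qed

lemma en_eq_Nil_iff: "en d s w = [] \<longleftrightarrow> w = []"
  by (cases w) auto

lemma drop_en: "n \<le> length w \<Longrightarrow> drop n (en d s w) = en d (s + n) (drop n w)"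
  using en_append[of d s "take n w" "drop n w"] by simp

lemma take_en: "take n (en d s w) = en d s (take n w)"
  by (induction w arbitrary: n s) (auto simp: take_Cons split: nat.splits)

text \<open>Pigeonhole on pairs of a state and a position modulo \<open>d\<close>: there are at most
  \<open>N * d\<close> such pairs but \<open>N * d + 1\<close> cuts. Two cuts with the same pair
  enclose a loop of length divisible by \<open>d\<close> that reads the whole alphabet.\<close>

lemma full_block_loop:
  assumes run: "nfa_run \<delta> p w q" and N: "card (states \<delta>) \<le> N" "N > 0" and d: "d > 0"
    and z: "z \<noteq> []" "subseq (wpow (N * d) z) (en d s w)" "set (en d s w) \<subseteq> set z"
  shows "\<exists>x u v u'. w = u @ v @ u' \<and> nfa_run \<delta> p u x \<and> nfa_run \<delta> x v x \<and> nfa_run \<delta> x u' q \<and>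
    v \<noteq> [] \<and> d dvd length v \<and> set (en d (s + length u) v) = set z"
proof -
  obtain f where f: "\<And>j. j \<le> N * d \<Longrightarrow> f j \<le> length w"
    "\<And>i j. i < j \<Longrightarrow> j \<le> N * d \<Longrightarrow> set z \<subseteq> set (take (f j - f i) (drop (f i) (en d s w))) \<and> f i \<le> f j"
    using blocks_cuts[OF z(2)] by auto
  have less: "f i < f j" if "i < j" "j \<le> N * d" for i j
    using f(2)[OF that] z(1) by (cases "f i = f j") auto
  have "0 < N * d" using N d by simp
  then have "f 0 < f (N * d)" using less by blast
  then have "w \<noteq> []" using f(1)[of "N * d"] by auto
  then have ps: "p \<in> states \<delta>" using run nfa_run_start_state by blast
  have "\<exists>\<sigma>. \<forall>i j. i \<le> j \<longrightarrow> j \<le> length w \<longrightarrow> \<sigma> 0 = p \<and> \<sigma> (length w) = q \<and>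
      nfa_run \<delta> (\<sigma> i) (take (j - i) (drop i w)) (\<sigma> j)"
    using run
  proof (induction w arbitrary: p)
    case (Cons a w)
    then obtain p' where p': "(p, a, p') \<in> set \<delta>" "nfa_run \<delta> p' w q" by auto
    then obtain \<sigma> where \<sigma>: "\<And>i j. i \<le> j \<Longrightarrow> j \<le> length w \<Longrightarrow> \<sigma> 0 = p' \<and> \<sigma> (length w) = q \<and>
      nfa_run \<delta> (\<sigma> i) (take (j - i) (drop i w)) (\<sigma> j)" using Cons.IH by blast
    have \<sigma>0: "\<sigma> 0 = p'" "\<sigma> (length w) = q" using \<sigma>[of 0 0] by auto
    let ?\<sigma> = "\<lambda>i. case i of 0 \<Rightarrow> p | Suc i \<Rightarrow> \<sigma> i"
    have "nfa_run \<delta> (?\<sigma> i) (take (j - i) (drop i (a # w))) (?\<sigma> j)" if "i \<le> j" "j \<le> length (a # w)" for i j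
    proof (cases j)
      case 0
      then show ?thesis using that by simp
    next
      case (Suc j')
      show ?thesis
      proof (cases i)
        case 0
        then show ?thesis using Suc that \<sigma>[of 0 j'] p'(1) by auto
      next
        case (Suc i')
        then show ?thesis using \<open>j = Suc j'\<close> that \<sigma>[of i' j'] by auto
      qed
    qed
    then show ?case using \<sigma>0 by (intro exI[of _ ?\<sigma>]) auto
  qed auto
  then obtain \<sigma> where \<sigma>: "\<And>i j. i \<le> j \<Longrightarrow> j \<le> length w \<Longrightarrow> nfa_run \<delta> (\<sigma> i) (take (j - i) (drop i w)) (\<sigma> j)"
    and \<sigma>0: "\<sigma> 0 = p" "\<sigma> (length w) = q" by (metis le0 order_refl)
  let ?F = "\<lambda>i. (\<sigma> (f i), f i mod d)"
  have "?F ` {..N * d} \<subseteq> states \<delta> \<times> {..<d}"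
    using f(1) \<sigma>[of 0] \<sigma>0(1) ps d by (auto intro: nfa_run_states)
  then have "card (?F ` {..N * d}) \<le> card (states \<delta> \<times> {..<d})" by (intro card_mono) auto
  also have "\<dots> \<le> N * d" using N by (simp add: card_cartesian_product)
  also have "\<dots> < card {..N * d}" by simp
  finally have "\<not> inj_on ?F {..N * d}" by (rule pigeonhole)
  then obtain i j where ij: "i < j" "j \<le> N * d" "\<sigma> (f i) = \<sigma> (f j)" "f i mod d = f j mod d"
    unfolding inj_on_def by (metis (no_types, lifting) Pair_inject atMost_iff linorder_neqE_nat)
  define u v u' where "u = take (f i) w" and "v = take (f j - f i) (drop (f i) w)" and "u' = drop (f j) w"
  have fij: "f i < f j" "f j \<le> length w" using less ij f(1) by auto
  have "w = u @ v @ u'"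
  proof -
    have "drop (f i) w = v @ u'"
      using append_take_drop_id[of "f j - f i" "drop (f i) w"] fij by (simp add: v_def u'_def)
    then show ?thesis using append_take_drop_id[of "f i" w] by (simp add: u_def)
  qed
  moreover have "nfa_run \<delta> p u (\<sigma> (f i))" using \<sigma>[of 0 "f i"] fij \<sigma>0 by (simp add: u_def)
  moreover have "nfa_run \<delta> (\<sigma> (f i)) v (\<sigma> (f i))" using \<sigma>[of "f i" "f j"] fij ij(3) by (simp add: v_def)
  moreover have "nfa_run \<delta> (\<sigma> (f i)) u' q" using \<sigma>[of "f j" "length w"] fij ij(3) \<sigma>0 by (simp add: u'_def)
  moreover have lv: "length v = f j - f i" "length u = f i" using fij by (auto simp: v_def u_def)
  moreover have "v \<noteq> []" using lv fij by auto
  moreover have "d dvd length v" using lv ij(4) fij mod_eq_dvd_iff_nat[of "f i" "f j" d] by simp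
  moreover have "set (en d (s + length u) v) = set z"
  proof
    have "en d s w = en d s u @ en d (s + length u) v @ en d (s + length u + length v) u'"
      using \<open>w = u @ v @ u'\<close> by (simp add: en_append)
    then show "set (en d (s + length u) v) \<subseteq> set z" using z(3) by auto
    show "set z \<subseteq> set (en d (s + length u) v)"
      using f(2)[OF ij(1,2)] fij by (simp add: drop_en take_en lv v_def)
  qed
  ultimately show ?thesis by blast
qed

text \<open>Each side has a loop of length divisible by \<open>d\<close> inside its block, and the
  common modulus turns the two into gap sides over the same \<open>c\<close> and \<open>D\<close>.
  Taking that loop out of the block changes its length by a multiple of \<open>d\<close>, which is
  invisible modulo \<open>d\<close>.\<close>

lemma gap_sides_if_full_blocks:
  assumes N: "card (states \<delta>) \<le> N" "card (states \<delta>') \<le> N" "N > 0" and d: "d = fact N ^ (2 * N)"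
    and run: "nfa_run \<delta> p w q" "subseq (wpow (N * d) z) (en d s w)" "set (en d s w) \<subseteq> set z"
    and run': "nfa_run \<delta>' r w' q'" "subseq (wpow (N * d) z) (en d s' w')" "set (en d s' w') \<subseteq> set z"
    and z: "z \<noteq> []"
  shows "\<exists>c D l l'. c dvd d \<and> gap_side \<delta> c D s p l q \<and> gap_side \<delta>' c D s' r l' q' \<and>
    l mod d = length w mod d \<and> l' mod d = length w' mod d"
proof -
  have d0: "d > 0" using d by simp
  obtain x u v y where u: "w = u @ v @ y" "nfa_run \<delta> p u x" "nfa_run \<delta> x v x" "nfa_run \<delta> x y q"
    "v \<noteq> []" "d dvd length v" "set (en d (s + length u) v) = set z"
    using full_block_loop[OF run(1) N(1,3) d0 z run(2,3)] by blast
  obtain x' u' v' y' where u': "w' = u' @ v' @ y'" "nfa_run \<delta>' r u' x'" "nfa_run \<delta>' x' v' x'"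
    "nfa_run \<delta>' x' y' q'" "v' \<noteq> []" "d dvd length v'" "set (en d (s' + length u') v') = set z"
    using full_block_loop[OF run'(1) N(2,3) d0 z run'(2,3)] by blast
  obtain c where c: "c dvd d" and two:
    "two_loops \<delta> c (set (en c (s + length u) v)) (s + length u) x"
    "two_loops \<delta>' c (set (en c (s + length u) v)) (s' + length u') x'"
    using common_modulus[OF u(3,5,6) N(1) u'(3,5,6) N(2) d] u(7) u'(7) by metis
  define D where "D = set (en c (s + length u) v)"
  have Dz: "D = (\<lambda>(a, i). (a, i mod c)) ` set z"
    unfolding D_def set_en_dvd[OF c] u(7) ..
  have inD: "set (en c t y) \<subseteq> D" if "set (en d t y) \<subseteq> set z" for t and y :: "nat list"
    unfolding Dz set_en_dvd[OF c] using that by (rule image_mono)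
  have cv: "c dvd length v" "c dvd length v'" using c u(6) u'(6) dvd_trans by blast+
  have "set (en c s u) \<subseteq> D" "set (en c (s + length u + length v) y) \<subseteq> D"
    using run(3) unfolding u(1) en_append set_append by (intro inD; simp)+
  then have "gap_side \<delta> c D s p (length u + length y) q"
    using u(2,4) two(1) cv unfolding gap_side_def two_loops_def D_def[symmetric]
    by (simp add: en_shift) blast
  moreover have "set (en c s' u') \<subseteq> D" "set (en c (s' + length u' + length v') y') \<subseteq> D"
    using run'(3) unfolding u'(1) en_append set_append by (intro inD; simp)+
  then have "gap_side \<delta>' c D s' r (length u' + length y') q'"
    using u'(2,4) two(2) cv unfolding gap_side_def two_loops_def D_def[symmetric]
    by (simp add: en_shift) blast
  moreover have "(length u + length y) mod d = length w mod d" "(length u' + length y') mod d = length w' mod d"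
  proof -
    obtain k k' where "length v = d * k" "length v' = d * k'" using u(6) u'(6) by (auto elim!: dvdE)
    then have "length w = (length u + length y) + d * k" "length w' = (length u' + length y') + d * k'"
      using u(1) u'(1) by simp_all
    then show "(length u + length y) mod d = length w mod d" "(length u' + length y') mod d = length w' mod d"
      by (simp_all only: mod_mult_self2)
  qed
  ultimately show ?thesis using c by blast
qed

text \<open>Each atom of the common factorization becomes a step: an optional letter is read on both
  sides, and a star over a nonempty alphabet becomes a gap. The counters follow the true lengths
  only modulo \<open>d\<close>, which suffices because \<open>en d\<close> depends on its offset
  modulo \<open>d\<close>.\<close>

lemma reach_complete:
  assumes N: "card (states \<delta>) \<le> N" "card (states \<delta>') \<le> N" "N > 0" and d: "d = fact N ^ (2 * N)"
    and z: "\<And>C. finite C \<Longrightarrow> \<exists>l. set l = C \<and> z C = wpow (N * d) l"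
    and prems: "list_all2 (full_block z) us T" "list_all2 (full_block z) us' T"
      "reach \<delta> \<delta>' I I' d p s r s'" "en d s w = concat us" "en d s' w' = concat us'"
      "nfa_run \<delta> p w q" "nfa_run \<delta>' r w' q'"
  shows "\<exists>t t'. reach \<delta> \<delta>' I I' d q t q' t' \<and> t mod d = (s + length w) mod d \<and> t' mod d = (s' + length w') mod d"
  using prems
proof (induction T arbitrary: us us' p s r s' w w' rule: list.induct)
  case Nil
  have "us = []" "us' = []" using Nil.prems(1,2) by simp_all
  then have "w = []" "w' = []" using Nil.prems(4,5) by (simp_all add: en_eq_Nil_iff)
  then show ?case using Nil.prems(3,6,7) by auto
next
  case (Cons a T)
  obtain x us1 where us: "us = x # us1" "full_block z x a" "list_all2 (full_block z) us1 T"
    using Cons.prems(1) by (auto simp: list_all2_Cons2)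
  obtain x' us1' where us': "us' = x' # us1'" "full_block z x' a" "list_all2 (full_block z) us1' T"
    using Cons.prems(2) by (auto simp: list_all2_Cons2)
  define w1 w2 where "w1 = take (length x) w" and "w2 = drop (length x) w"
  define w1' w2' where "w1' = take (length x') w'" and "w2' = drop (length x') w'"
  have "length w = length (concat us)" "length w' = length (concat us')"
    using Cons.prems(4,5) length_en[of d s w] length_en[of d s' w'] by simp_all
  then have le: "length x \<le> length w" "length x' \<le> length w'" using us us' by auto
  have w: "w = w1 @ w2" "en d s w1 = x" "en d (s + length w1) w2 = concat us1"
    using take_en[of "length x" d s w] drop_en[of "length x" w d s] Cons.prems(4) us(1) le
    by (auto simp: w1_def w2_def)
  have w': "w' = w1' @ w2'" "en d s' w1' = x'" "en d (s' + length w1') w2' = concat us1'"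
    using take_en[of "length x'" d s' w'] drop_en[of "length x'" w' d s'] Cons.prems(5) us'(1) le
    by (auto simp: w1'_def w2'_def)
  obtain y where y: "nfa_run \<delta> p w1 y" "nfa_run \<delta> y w2 q" using Cons.prems(6) w(1) by (auto simp: nfa_run_append)
  obtain y' where y': "nfa_run \<delta>' r w1' y'" "nfa_run \<delta>' y' w2' q'"
    using Cons.prems(7) w'(1) by (auto simp: nfa_run_append)
  have "\<exists>t t'. reach \<delta> \<delta>' I I' d y t y' t' \<and> t mod d = (s + length w1) mod d \<and> t' mod d = (s' + length w1') mod d"
  proof (cases a)
    case (Opt b)
    then have "en d s w1 = [b]" "en d s' w1' = [b]" using us(2) us'(2) w(2) w'(2) by auto
    then obtain e e' where e: "w1 = [e]" "w1' = [e']" "b = (e, s mod d)" "b = (e', s' mod d)"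
      by (cases w1; cases w1') (auto simp: en_eq_Nil_iff)
    then have "reach \<delta> \<delta>' I I' d y (Suc s) y' (Suc s')"
      using y(1) y'(1) by (intro letter[OF Cons.prems(3)]) auto
    then show ?thesis using e by (intro exI[of _ "Suc s"] exI[of _ "Suc s'"]) simp
  next
    case (Star C)
    then have C: "finite C" "set x \<subseteq> C" "subseq (z C) x" "set x' \<subseteq> C" "subseq (z C) x'"
      using us(2) us'(2) by auto
    obtain l where l: "set l = C" "z C = wpow (N * d) l" using z C(1) by blast
    show ?thesis
    proof (cases "l = []")
      case True
      then have "x = []" "x' = []" using C l by auto
      then have "w1 = []" "w1' = []" using w(2) w'(2) by (simp_all add: en_eq_Nil_iff)
      then show ?thesis using Cons.prems(3) y y' by auto
    next
      case False
      have "\<exists>c D l l'. c dvd d \<and> gap_side \<delta> c D s p l y \<and> gap_side \<delta>' c D s' r l' y' \<and>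
        l mod d = length w1 mod d \<and> l' mod d = length w1' mod d"
        by (rule gap_sides_if_full_blocks[OF N d y(1) _ _ y'(1) _ _ False])
          (use C l w(2) w'(2) in simp_all)
      then obtain c D l l' where *: "c dvd d" "gap_side \<delta> c D s p l y" "gap_side \<delta>' c D s' r l' y'"
        "l mod d = length w1 mod d" "l' mod d = length w1' mod d" by blast
      have "reach \<delta> \<delta>' I I' d y (s + l) y' (s' + l')" using gap[OF Cons.prems(3) *(1-3)] .
      moreover have "(s + l) mod d = (s + length w1) mod d" "(s' + l') mod d = (s' + length w1') mod d"
        using *(4,5) by (intro mod_add_cong; simp)+
      ultimately show ?thesis by blast
    qed
  qed
  then obtain t t' where t: "reach \<delta> \<delta>' I I' d y t y' t'"
    "t mod d = (s + length w1) mod d" "t' mod d = (s' + length w1') mod d" by blast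
  have "en d t w2 = concat us1" "en d t' w2' = concat us1'"
    using w(3) w'(3) en_cong[OF t(2), of w2] en_cong[OF t(3), of w2'] by simp_all
  from Cons.IH[OF us(3) us'(3) t(1) this y(2) y'(2)]
  obtain t1 t1' where t1: "reach \<delta> \<delta>' I I' d q t1 q' t1'" "t1 mod d = (t + length w2) mod d"
    "t1' mod d = (t' + length w2') mod d" by blast
  have "(t + length w2) mod d = (s + length w1 + length w2) mod d"
    "(t' + length w2') mod d = (s' + length w1' + length w2') mod d"
    using t(2,3) by (intro mod_add_cong; simp)+
  then show ?case using t1 w(1) w'(1) by (auto simp: add.assoc)
qed

text \<open>Builds the alphabet bound into the transitions, so that runs and pumped loops stay
  inside the alphabet by themselves.\<close>

definition restr :: "nat \<Rightarrow> (nat \<times> nat \<times> nat) list \<Rightarrow> (nat \<times> nat \<times> nat) list" where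
  "restr m \<delta> = filter (\<lambda>t. fst (snd t) < m) \<delta>"

lemma nfa_run_restr: "nfa_run (restr m \<delta>) p w q \<longleftrightarrow> nfa_run \<delta> p w q \<and> w \<in> lists {0..<m}"
  by (induction w arbitrary: p) (auto simp: restr_def)

lemma nfa_lang_restr:
  "nfa_lang m (I, F, \<delta>) = {w. \<exists>p\<in>set I. \<exists>q\<in>set F. nfa_run (restr m \<delta>) p w q}"
  by (auto simp: nfa_lang_def nfa_run_restr)

text \<open>A path for any single \<open>d\<close> defeats every modulus, so \<open>d\<close> can
  simply be searched for. Conversely, inseparable languages always have a path for the factorial
  modulus.\<close>

theorem separable_iff_no_reach:
  "separable (BSigma1_MOD m) (nfa_lang m (I, F, \<delta>)) (nfa_lang m (I', F', \<delta>')) \<longleftrightarrow>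
   \<not> (\<exists>d p s r s'. d > 0 \<and> reach (restr m \<delta>) (restr m \<delta>') (set I) (set I') d p s r s' \<and>
      p \<in> set F \<and> r \<in> set F' \<and> s mod d = s' mod d)"
  (is "?sep \<longleftrightarrow> \<not> ?R")
proof -
  let ?K = "nfa_lang m (I, F, \<delta>)" and ?L = "nfa_lang m (I', F', \<delta>')"
  let ?\<delta> = "restr m \<delta>" and ?\<delta>' = "restr m \<delta>'"
  have KL: "?K \<subseteq> lists {0..<m}" "?L \<subseteq> lists {0..<m}" by (auto simp: nfa_lang_def)
  have "\<exists>w\<in>?K. \<exists>w'\<in>?L. mod_eqv e k w w'" if "?R" "e \<ge> 1" for e k
  proof -
    obtain d p s r s' where R: "d > 0" "reach ?\<delta> ?\<delta>' (set I) (set I') d p s r s'"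
      "p \<in> set F" "r \<in> set F'" "s mod d = s' mod d" using \<open>?R\<close> by blast
    \<comment> \<open>For a given modulus \<open>e\<close>, words that are equivalent for the
      multiple \<open>d * e\<close> are built, and the equivalence is then coarsened to
      \<open>e\<close>.\<close>
    have "d dvd d * e" "d * e > 0" using R(1) that(2) by auto
    from reach_sound[OF R(2) this, of k] obtain w w' p0 r0 where "p0 \<in> set I" "r0 \<in> set I'"
      "nfa_run ?\<delta> p0 w p" "nfa_run ?\<delta>' r0 w' r" "sub_eq k (en (d * e) 0 w) (en (d * e) 0 w')"
      "length w mod (d * e) = length w' mod (d * e)" using R(5) by blast
    then have "w \<in> ?K" "w' \<in> ?L" "mod_eqv (d * e) k w w'"
      using R(3,4) unfolding nfa_lang_restr mod_eqv_def by blast+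
    then show ?thesis using mod_eqv_dvd[of "d * e" k w w' e k] by auto
  qed
  moreover have "?R" if all: "\<And>e k. e \<ge> 1 \<Longrightarrow> \<exists>w\<in>?K. \<exists>w'\<in>?L. mod_eqv e k w w'"
  proof -
    define N where "N = Suc (card (states ?\<delta>) + card (states ?\<delta>'))"
    have N: "card (states ?\<delta>) \<le> N" "card (states ?\<delta>') \<le> N" "N > 0" by (auto simp: N_def)
    define d :: nat where "d = fact N ^ (2 * N)"
    have d0: "d > 0" by (simp add: d_def)
    \<comment> \<open>\<open>N * d\<close> rounds through the alphabet are what the pigeonhole
      argument asks for. The empty word for infinite \<open>C\<close> makes \<open>z C\<close> a
      word over \<open>C\<close> in every case.\<close>
    define z where "z C = (if finite C then wpow (N * d) (SOME l. set l = C) else [])" for C :: "(nat \<times> nat) set"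
    have some: "set (SOME l. set l = C) = C" if "finite C" for C :: "(nat \<times> nat) set"
      using finite_list[OF that] by (rule someI_ex)
    have zC: "set (z C) \<subseteq> C" for C
      using some[of C] by (auto simp: z_def wpow_def)
    \<comment> \<open>Equality of lengths modulo \<open>d\<close> is stored in \<open>W\<close>,
      since the common factorization is governed by subwords alone.\<close>
    define W where "W = {(en d 0 w, en d 0 w') | w w'. w \<in> ?K \<and> w' \<in> ?L \<and> length w mod d = length w' mod d}"
    have "\<exists>(x, y)\<in>W. sub_eq k x y" for k
      using all[of d k] d0 unfolding W_def mod_eqv_def by (auto simp: Suc_le_eq)
    moreover have "x \<in> lists ({0..<m} \<times> {0..<d})" if "(x, y) \<in> W" for x y
      using that KL(1) d0 unfolding W_def by (auto simp: set_en in_lists_conv_set subset_iff)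
    ultimately obtain T us us' where T: "(concat us, concat us') \<in> W"
      "list_all2 (full_block z) us T" "list_all2 (full_block z) us' T"
      using common_factorization[of W "{0..<m} \<times> {0..<d}" z, OF _ _ _ zC] by blast
    obtain w w' where w: "concat us = en d 0 w" "concat us' = en d 0 w'" "w \<in> ?K" "w' \<in> ?L"
      "length w mod d = length w' mod d" using T(1) unfolding W_def by blast
    obtain p q where p: "p \<in> set I" "q \<in> set F" "nfa_run ?\<delta> p w q" using w(3) unfolding nfa_lang_restr by blast
    obtain r q' where r: "r \<in> set I'" "q' \<in> set F'" "nfa_run ?\<delta>' r w' q'" using w(4) unfolding nfa_lang_restr by blast
    have z': "\<exists>l. set l = C \<and> z C = wpow (N * d) l" if "finite C" for C
      using some[OF that] that by (auto simp: z_def)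
    from reach_complete[OF N d_def z' T(2,3) start[OF p(1) r(1)] w(1,2)[symmetric] p(3) r(3)]
    obtain t t' where "reach ?\<delta> ?\<delta>' (set I) (set I') d q t q' t'" "t mod d = t' mod d"
      using w(5) by auto
    then show ?R using d0 p(2) r(2) by blast
  qed
  ultimately show ?thesis unfolding separable_iff[OF KL] by blast
qed

section \<open>Decidability\<close>

lemmas computable_intros = computable_id computable_const computable_fst computable_snd computable_Pair
  computable_Suc computable_add computable_mod computable_length computable_gnth computable_Cons

lemmas dec_pred_intros = dec_pred_not dec_pred_conj dec_pred_disj dec_pred_imp dec_pred_less dec_pred_all_less dec_pred_ex_less
  dec_pred_ball dec_pred_bex dec_pred_mem dec_pred_eq

lemma re_pred_disj:
  assumes "re_pred P" "re_pred R" shows "re_pred (\<lambda>x. P x \<or> R x)"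
proof -
  obtain Q where Q: "dec_pred (\<lambda>p. Q (fst p) (snd p))" "\<And>x. P x \<longleftrightarrow> (\<exists>n::nat. Q x n)"
    using assms(1) unfolding re_pred_def by blast
  obtain T where T: "dec_pred (\<lambda>p. T (fst p) (snd p))" "\<And>x. R x \<longleftrightarrow> (\<exists>n::nat. T x n)"
    using assms(2) unfolding re_pred_def by blast
  have "re_pred (\<lambda>x. \<exists>n. Q x n \<or> T x n)"
    by (intro re_predI dec_pred_disj Q T)
  moreover have "(\<exists>n. Q x n \<or> T x n) \<longleftrightarrow> P x \<or> R x" for x using Q(2) T(2) by blast
  ultimately show ?thesis by simp
qed

lemma gnth_Cons_0 [simp]: "gnth (x # xs) 0 = x"
  by (simp add: gnth_def)

lemma gnth_Cons_Suc [simp]: "gnth (x # xs) (Suc i) = gnth xs i"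
  by (simp add: gnth_def)

lemma gnth_tl: "gnth (tl xs) i = gnth xs (Suc i)"
  by (cases xs) (simp_all add: gnth_def)

lemma gnth_eq: "i < length xs \<Longrightarrow> gnth xs i = xs ! i"
  by (simp add: gnth_def)

text \<open>A chain becomes a number and a list, both of which have codes. As \<open>gnth\<close> is
  total, every list stands for an infinite sequence, so its length does not enter.\<close>

lemma rtranclp_iff_gnth:
  "R\<^sup>*\<^sup>* a b \<longleftrightarrow> (\<exists>n xs. gnth xs 0 = a \<and> gnth xs n = b \<and> (\<forall>i<n. R (gnth xs i) (gnth xs (Suc i))))"
  unfolding rtranclp_power relpowp_fun_conv
proof (intro iffI; elim exE conjE)
  fix n f assume f: "f 0 = a" "f n = b" "\<forall>i<n. R (f i) (f (Suc i))"
  have *: "gnth (map f [0..<Suc n]) i = f i" if "i \<le> n" for i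
    using that by (simp add: gnth_def nth_append del: upt_Suc)
  show "\<exists>n xs. gnth xs 0 = a \<and> gnth xs n = b \<and> (\<forall>i<n. R (gnth xs i) (gnth xs (Suc i)))"
    by (intro exI[of _ n] exI[of _ "map f [0..<Suc n]"]) (use f * in \<open>simp del: upt_Suc\<close>)
next
  fix n xs assume "gnth xs 0 = a" "gnth xs n = b" "\<forall>i<n. R (gnth xs i) (gnth xs (Suc i))"
  then show "\<exists>n f. f 0 = a \<and> f n = b \<and> (\<forall>i<n. R (f i) (f (Suc i)))" by blast
qed

lemma re_pred_rtranclp:
  assumes R: "re_pred (\<lambda>p. R (fst p) (fst (snd p)) (snd (snd p)))" and a: "computable a" and b: "computable b"
  shows "re_pred (\<lambda>x. (R x)\<^sup>*\<^sup>* (a x) (b x))"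
proof -
  have Rc: "re_pred (\<lambda>x. R (f x) (g x) (h x))" if "computable f" "computable g" "computable h" for f g h
    using re_pred_compose[OF R computable_Pair[OF that(1) computable_Pair[OF that(2,3)]]] by simp
  show ?thesis
    unfolding rtranclp_iff_gnth
    by (intro re_pred_ex re_pred_conj re_pred_all_less Rc; (rule re_pred_dec_pred)?;
        intro dec_pred_eq computable_compose[OF a] computable_compose[OF b] computable_intros)
qed

lemma nfa_run_iff_gnth:
  "nfa_run \<delta> p w q \<longleftrightarrow> (\<exists>ss. gnth ss 0 = p \<and> gnth ss (length w) = q \<and>
     (\<forall>i<length w. (gnth ss i, gnth w i, gnth ss (Suc i)) \<in> set \<delta>))"
proof (induction w arbitrary: p)
  case Nil
  show ?case by (auto intro: exI[of _ "[p]"])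
next
  case (Cons a w)
  show ?case
  proof
    assume "nfa_run \<delta> p (a # w) q"
    then obtain p' ss where "(p, a, p') \<in> set \<delta>" "gnth ss 0 = p'" "gnth ss (length w) = q"
      "\<forall>i<length w. (gnth ss i, gnth w i, gnth ss (Suc i)) \<in> set \<delta>" using Cons.IH by auto
    then show "\<exists>ss. gnth ss 0 = p \<and> gnth ss (length (a # w)) = q \<and>
      (\<forall>i<length (a # w). (gnth ss i, gnth (a # w) i, gnth ss (Suc i)) \<in> set \<delta>)"
      by (intro exI[of _ "p # ss"]) (auto simp: less_Suc_eq_0_disj)
  next
    assume "\<exists>ss. gnth ss 0 = p \<and> gnth ss (length (a # w)) = q \<and>
      (\<forall>i<length (a # w). (gnth ss i, gnth (a # w) i, gnth ss (Suc i)) \<in> set \<delta>)"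
    then obtain ss where ss: "gnth ss 0 = p" "gnth ss (Suc (length w)) = q"
      "\<And>i. i < Suc (length w) \<Longrightarrow> (gnth ss i, gnth (a # w) i, gnth ss (Suc i)) \<in> set \<delta>" by auto
    have "nfa_run \<delta> (gnth ss 1) w q"
      unfolding Cons.IH
      by (intro exI[of _ "tl ss"]) (use ss(2) ss(3)[of "Suc _"] in \<open>auto simp: gnth_tl\<close>)
    then show "nfa_run \<delta> p (a # w) q" using ss(1) ss(3)[of 0] by auto
  qed
qed

lemma mem_restr: "t \<in> set (restr m \<delta>) \<longleftrightarrow> t \<in> set \<delta> \<and> fst (snd t) < m"
  by (auto simp: restr_def)

lemma re_pred_nfa_run:
  assumes "computable m" "computable \<delta>" "computable p" "computable w" "computable q"
  shows "re_pred (\<lambda>x. nfa_run (restr (m x) (\<delta> x)) (p x) (w x) (q x))"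
  unfolding nfa_run_iff_gnth mem_restr
  by (intro re_pred_ex re_pred_dec_pred dec_pred_intros computable_intros assms[THEN computable_compose])

lemma set_en_gnth: "set (en d s w) = (\<lambda>i. (gnth w i, (s + i) mod d)) ` {..<length w}"
  unfolding set_en by (simp add: gnth_eq)

lemma set_en_subset_iff: "set (en d s w) \<subseteq> set D \<longleftrightarrow> (\<forall>i<length w. (gnth w i, (s + i) mod d) \<in> set D)"
  by (auto simp: set_en_gnth)

lemma set_en_eq_iff: "set (en d s w) = set D \<longleftrightarrow> (\<forall>i<length w. (gnth w i, (s + i) mod d) \<in> set D) \<and>
    (\<forall>y\<in>set D. \<exists>i<length w. y = (gnth w i, (s + i) mod d))"
  by (auto simp: set_en_gnth)

lemma re_pred_gap_side:
  assumes "computable m" "computable \<delta>" "computable c" "computable D" "computable s" "computable p" "computable l" "computable q"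
  shows "re_pred (\<lambda>x. gap_side (restr (m x) (\<delta> x)) (c x) (set (D x)) (s x) (p x) (l x) (q x))"
  unfolding gap_side_def set_en_eq_iff set_en_subset_iff dvd_eq_mod_eq_0
  by (intro re_pred_ex re_pred_conj re_pred_nfa_run; (rule re_pred_dec_pred)?;
      intro dec_pred_intros computable_intros assms[THEN computable_compose])

section \<open>Enumerating paired paths\<close>

type_synonym config = "nat \<times> nat \<times> nat \<times> nat"

definition letter_step where
  "letter_step m \<delta> \<delta>' d x y \<longleftrightarrow> fst (snd x) mod d = snd (snd (snd x)) mod d \<and>
     (\<exists>t\<in>set \<delta>. \<exists>t'\<in>set \<delta>'. fst (snd t) < m \<and> fst (snd t) = fst (snd t') \<and>
       fst t = fst x \<and> fst t' = fst (snd (snd x)) \<and>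
       y = (snd (snd t), Suc (fst (snd x)), snd (snd t'), Suc (snd (snd (snd x)))))"
  for m d :: nat and \<delta> \<delta>' :: "(nat \<times> nat \<times> nat) list" and x y :: config

text \<open>The alphabet is a list here because lists have codes. Nothing is lost: \<open>D\<close>
  is the letter set of a word and hence finite.\<close>

definition gap_step where
  "gap_step m \<delta> \<delta>' d x y \<longleftrightarrow> (\<exists>c D l l'. d mod c = 0 \<and>
     gap_side (restr m \<delta>) c (set D) (fst (snd x)) (fst x) l (fst y) \<and>
     gap_side (restr m \<delta>') c (set D) (snd (snd (snd x))) (fst (snd (snd x))) l' (fst (snd (snd y))) \<and>
     fst (snd y) = fst (snd x) + l \<and> snd (snd (snd y)) = snd (snd (snd x)) + l')"
  for m d :: nat and \<delta> \<delta>' :: "(nat \<times> nat \<times> nat) list" and x y :: config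

definition step where
  "step m \<delta> \<delta>' d x y \<longleftrightarrow> letter_step m \<delta> \<delta>' d x y \<or> gap_step m \<delta> \<delta>' d x y"

lemma reach_iff_steps:
  "reach (restr m \<delta>) (restr m \<delta>') (set I) (set I') d p s r s' \<longleftrightarrow>
   (\<exists>p0 r0. p0 \<in> set I \<and> r0 \<in> set I' \<and> (step m \<delta> \<delta>' d)\<^sup>*\<^sup>* (p0, 0, r0, 0) (p, s, r, s'))"
  (is "?R p s r s' \<longleftrightarrow> _")
proof
  show "?R p s r s' \<Longrightarrow> \<exists>p0 r0. p0 \<in> set I \<and> r0 \<in> set I' \<and> (step m \<delta> \<delta>' d)\<^sup>*\<^sup>* (p0, 0, r0, 0) (p, s, r, s')"
  proof (induction rule: reach.induct)
    case (start p r)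
    then show ?case by blast
  next
    case (letter p s r s' a q q')
    then have "letter_step m \<delta> \<delta>' d (p, s, r, s') (q, Suc s, q', Suc s')"
      unfolding letter_step_def
      by (intro conjI bexI[of _ "(p, a, q)"] bexI[of _ "(r, a, q')"]) (auto simp: restr_def)
    then have "step m \<delta> \<delta>' d (p, s, r, s') (q, Suc s, q', Suc s')" by (simp add: step_def)
    then show ?case using letter.IH by (blast intro: rtranclp.rtrancl_into_rtrancl)
  next
    case (gap p s r s' c D l q l' q')
    have "finite D" using gap(3) by (auto simp: gap_side_def)
    then obtain Dl where "set Dl = D" using finite_list by blast
    then have "gap_step m \<delta> \<delta>' d (p, s, r, s') (q, s + l, q', s' + l')"
      unfolding gap_step_def using gap(2-4)
      by (intro exI[of _ c] exI[of _ Dl] exI[of _ l] exI[of _ l']) simp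
    then have "step m \<delta> \<delta>' d (p, s, r, s') (q, s + l, q', s' + l')" by (simp add: step_def)
    then show ?case using gap.IH by (blast intro: rtranclp.rtrancl_into_rtrancl)
  qed
next
  assume "\<exists>p0 r0. p0 \<in> set I \<and> r0 \<in> set I' \<and> (step m \<delta> \<delta>' d)\<^sup>*\<^sup>* (p0, 0, r0, 0) (p, s, r, s')"
  then obtain p0 r0 where p0: "p0 \<in> set I" "r0 \<in> set I'" "(step m \<delta> \<delta>' d)\<^sup>*\<^sup>* (p0, 0, r0, 0) (p, s, r, s')"
    by blast
  have "?R (fst y) (fst (snd y)) (fst (snd (snd y))) (snd (snd (snd y)))"
    if "(step m \<delta> \<delta>' d)\<^sup>*\<^sup>* (p0, 0, r0, 0) y" for y
    using that
  proof (induction rule: rtranclp_induct)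
    case base
    show ?case using p0 by (auto intro: reach.start)
  next
    case (step y z)
    from step(2) consider "letter_step m \<delta> \<delta>' d y z" | "gap_step m \<delta> \<delta>' d y z"
      unfolding step_def by blast
    then show ?case
    proof cases
      case 1
      then obtain t t' where t: "t \<in> set \<delta>" "t' \<in> set \<delta>'" "fst (snd t) < m" "fst (snd t) = fst (snd t')"
        "fst t = fst y" "fst t' = fst (snd (snd y))"
        "z = (snd (snd t), Suc (fst (snd y)), snd (snd t'), Suc (snd (snd (snd y))))"
        "fst (snd y) mod d = snd (snd (snd y)) mod d"
        unfolding letter_step_def by blast
      have "(fst y, fst (snd t), snd (snd t)) \<in> set (restr m \<delta>)"
        "(fst (snd (snd y)), fst (snd t), snd (snd t')) \<in> set (restr m \<delta>')"
      proof -
        have "(fst y, fst (snd t), snd (snd t)) = t" "(fst (snd (snd y)), fst (snd t), snd (snd t')) = t'"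
          using t(4-6) by (simp_all add: prod_eq_iff)
        then show "(fst y, fst (snd t), snd (snd t)) \<in> set (restr m \<delta>)"
          "(fst (snd (snd y)), fst (snd t), snd (snd t')) \<in> set (restr m \<delta>')"
          using t(1-4) by (simp_all add: mem_restr)
      qed
      from reach.letter[OF step.IH t(8) this] show ?thesis by (simp add: t(7))
    next
      case 2
      then obtain c D l l' where g: "d mod c = 0"
        "gap_side (restr m \<delta>) c (set D) (fst (snd y)) (fst y) l (fst z)"
        "gap_side (restr m \<delta>') c (set D) (snd (snd (snd y))) (fst (snd (snd y))) l' (fst (snd (snd z)))"
        "fst (snd z) = fst (snd y) + l" "snd (snd (snd z)) = snd (snd (snd y)) + l'"
        unfolding gap_step_def by (elim exE conjE) (rule that; assumption)
      have "c dvd d" using g(1) by (simp add: dvd_eq_mod_eq_0)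
      from reach.gap[OF step.IH this g(2,3)] show ?thesis by (simp add: g(4,5))
    qed
  qed
  from this[OF p0(3)] show "?R p s r s'" by simp
qed

lemma re_pred_step:
  assumes "computable m" "computable \<delta>" "computable \<delta>'" "computable d" "computable a" "computable b"
  shows "re_pred (\<lambda>x. step (m x) (\<delta> x) (\<delta>' x) (d x) (a x) (b x))"
proof -
  have "re_pred (\<lambda>x. letter_step (m x) (\<delta> x) (\<delta>' x) (d x) (a x) (b x))"
    unfolding letter_step_def
    by (intro re_pred_dec_pred dec_pred_intros computable_intros assms[THEN computable_compose] assms)
  moreover have "re_pred (\<lambda>x. gap_step (m x) (\<delta> x) (\<delta>' x) (d x) (a x) (b x))"
    unfolding gap_step_def
    by (intro re_pred_ex re_pred_conj re_pred_gap_side; (rule re_pred_dec_pred)?;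
      intro dec_pred_intros computable_intros assms[THEN computable_compose])
  ultimately show ?thesis unfolding step_def by (rule re_pred_disj)
qed

text \<open>A finite invariant for the runs of one automaton. An entry holds a state, a length
  modulo \<open>d\<close> and a list of the short subwords read so far, each stored in reverse:
  appending a letter to the word then means putting it in front of stored subwords. Equations
  between sets are spelled out by quantifiers over lists, which keeps the condition
  decidable.\<close>

definition closed :: "nat \<Rightarrow> nat list \<Rightarrow> (nat \<times> nat \<times> nat) list \<Rightarrow> nat \<Rightarrow> nat \<Rightarrow>
    (nat \<times> nat \<times> (nat \<times> nat) list list) list \<Rightarrow> bool" where
  "closed m I \<delta> d k X \<longleftrightarrow>
     (\<forall>p\<in>set I. \<exists>e\<in>set X. fst e = p \<and> fst (snd e) = 0 \<and>
        [] \<in> set (snd (snd e)) \<and> (\<forall>u\<in>set (snd (snd e)). u = [])) \<and>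
     (\<forall>e\<in>set X. \<forall>t\<in>set \<delta>. fst t = fst e \<and> fst (snd t) < m \<longrightarrow>
        (\<exists>e'\<in>set X. fst e' = snd (snd t) \<and> fst (snd e') = Suc (fst (snd e)) mod d \<and>
          (\<forall>u\<in>set (snd (snd e')). u \<in> set (snd (snd e)) \<or>
            (\<exists>u'\<in>set (snd (snd e)). length u' < k \<and> u = (fst (snd t), fst (snd e)) # u')) \<and>
          (\<forall>u\<in>set (snd (snd e)). u \<in> set (snd (snd e')) \<and>
            (length u < k \<longrightarrow> (fst (snd t), fst (snd e)) # u \<in> set (snd (snd e'))))))"

definition profile :: "nat \<Rightarrow> nat \<Rightarrow> nat list \<Rightarrow> (nat \<times> nat) list set" where
  "profile d k w = {u. length u \<le> k \<and> subseq u (rev (en d 0 w))}"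

lemma profile_Nil: "profile d k [] = {[]}"
  by (auto simp: profile_def)

text \<open>The new last letter comes first in the reversed word, so a subword either skips it or
  begins with it.\<close>

lemma profile_snoc:
  "profile d k (w @ [a]) = profile d k w \<union> {(a, length w mod d) # u | u. u \<in> profile d k w \<and> length u < k}"
proof -
  have "subseq u (b # x) \<longleftrightarrow> subseq u x \<or> (\<exists>v. u = b # v \<and> subseq v x)" for u x and b :: "nat \<times> nat"
    by (cases u) (auto dest: subseq_Cons')
  then show ?thesis unfolding profile_def by (auto simp: en_append)
qed

lemma subseq_rev_iff: "subseq (rev u) (rev x) \<longleftrightarrow> subseq u x"
proof -
  have "subseq u x \<Longrightarrow> subseq (rev u) (rev x)" for u x :: "'a list"
    by (induction rule: list_emb.induct) (auto intro: subseq_rev_drop_many)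
  from this[of u x] this[of "rev u" "rev x"] show ?thesis by auto
qed

lemma mod_eqv_iff_profile:
  "mod_eqv d k w w' \<longleftrightarrow> length w mod d = length w' mod d \<and> profile d k w = profile d k w'"
proof -
  have "profile d k w = profile d k w' \<longleftrightarrow> sub_eq k (en d 0 w) (en d 0 w')"
  proof
    assume eq: "profile d k w = profile d k w'"
    have "subseq u (en d 0 w) = subseq u (en d 0 w')" if "length u \<le> k" for u
    proof -
      have "(rev u \<in> profile d k w) = (rev u \<in> profile d k w')" using eq by simp
      then show ?thesis using that by (simp add: profile_def subseq_rev_iff)
    qed
    then show "sub_eq k (en d 0 w) (en d 0 w')" by (simp add: sub_eq_def)
  next
    assume "sub_eq k (en d 0 w) (en d 0 w')"
    then have "subseq u (rev (en d 0 w)) = subseq u (rev (en d 0 w'))" if "length u \<le> k" for u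
      using that subseq_rev_iff[of "rev u" "en d 0 w"] subseq_rev_iff[of "rev u" "en d 0 w'"]
      by (simp add: sub_eq_def)
    then show "profile d k w = profile d k w'" by (auto simp: profile_def)
  qed
  then show ?thesis by (auto simp: mod_eqv_def)
qed

lemma closed_sound:
  assumes cl: "closed m I \<delta> d k X" and p0: "p0 \<in> set I"
  shows "nfa_run (restr m \<delta>) p0 w p \<Longrightarrow> \<exists>C. (p, length w mod d, C) \<in> set X \<and> set C = profile d k w"
proof (induction w arbitrary: p rule: rev_induct)
  case Nil
  obtain e where "e \<in> set X" "fst e = p0" "fst (snd e) = 0" "[] \<in> set (snd (snd e))"
    "\<forall>u\<in>set (snd (snd e)). u = []"
    using cl p0 unfolding closed_def by blast
  then have "(p0, 0, snd (snd e)) \<in> set X" "set (snd (snd e)) = {[]}"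
    by (auto simp: prod_eq_iff) (metis prod.collapse)
  then show ?case using Nil by (auto simp: profile_Nil)
next
  case (snoc a w)
  then obtain p1 where p1: "nfa_run (restr m \<delta>) p0 w p1" "(p1, a, p) \<in> set \<delta>" "a < m"
    by (auto simp: nfa_run_append mem_restr)
  from snoc.IH[OF p1(1)] obtain C where C: "(p1, length w mod d, C) \<in> set X" "set C = profile d k w"
    by blast
  let ?b = "(a, length w mod d)"
  have "\<exists>e'\<in>set X. fst e' = p \<and> fst (snd e') = Suc (length w mod d) mod d \<and>
      (\<forall>u\<in>set (snd (snd e')). u \<in> set C \<or> (\<exists>u'\<in>set C. length u' < k \<and> u = ?b # u')) \<and>
      (\<forall>u\<in>set C. u \<in> set (snd (snd e')) \<and> (length u < k \<longrightarrow> ?b # u \<in> set (snd (snd e'))))"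
    using cl[unfolded closed_def, THEN conjunct2, THEN bspec, OF C(1), THEN bspec, OF p1(2)] p1(3)
    by simp
  then obtain q r C' where C': "(q, r, C') \<in> set X" "q = p" "r = Suc (length w mod d) mod d"
      "(\<forall>u\<in>set C'. u \<in> set C \<or> (\<exists>u'\<in>set C. length u' < k \<and> u = ?b # u'))"
      "(\<forall>u\<in>set C. u \<in> set C' \<and> (length u < k \<longrightarrow> ?b # u \<in> set C'))" by auto
  have "set C' = profile d k (w @ [a])"
    unfolding profile_snoc C(2)[symmetric]
  proof (intro set_eqI iffI)
    fix u assume "u \<in> set C'"
    then show "u \<in> set C \<union> {?b # u | u. u \<in> set C \<and> length u < k}" using C'(4) by auto
  next
    fix u assume "u \<in> set C \<union> {?b # u | u. u \<in> set C \<and> length u < k}"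
    then show "u \<in> set C'" using C'(5) by auto
  qed
  then show ?case using C'(1-3) by (auto simp: mod_Suc_eq)
qed

text \<open>The entries of all actual runs form an invariant; they are finitely many because states,
  residues and sets of short subwords are.\<close>

lemma closed_complete:
  assumes d: "d > 0"
  shows "\<exists>X. closed m I \<delta> d k X \<and> (\<forall>(p, r, C)\<in>set X. \<exists>w. \<exists>p0\<in>set I.
    nfa_run (restr m \<delta>) p0 w p \<and> r = length w mod d \<and> set C = profile d k w)"
proof -
  \<comment> \<open>One list is fixed for each set of subwords; otherwise one set could appear in
    infinitely many entries.\<close>
  define can where "can A = (SOME l. set l = A)" for A :: "(nat \<times> nat) list set"
  have can: "set (can A) = A" if "finite A" for A
    unfolding can_def using finite_list[OF that] by (rule someI_ex)
  define Y where "Y = {(p, length w mod d, can (profile d k w)) | p w.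
    \<exists>p0\<in>set I. nfa_run (restr m \<delta>) p0 w p}"
  have sub: "profile d k w \<subseteq> factors m d k" if run: "nfa_run (restr m \<delta>) p w q" for p w q
  proof
    fix u assume u: "u \<in> profile d k w"
    have "w \<in> lists {0..<m}" using run by (simp add: nfa_run_restr)
    moreover have "subseq (rev u) (en d 0 w)" using u subseq_rev_iff[of u "rev (en d 0 w)"] by (simp add: profile_def)
    ultimately have "rev u \<in> factors m d k"
      using u d by (intro subseq_en_factors) (auto simp: profile_def)
    then show "u \<in> factors m d k" by (auto simp: factors_def)
  qed
  have fin: "finite (profile d k w)" if "nfa_run (restr m \<delta>) p w q" for p w q
    using sub[OF that] finite_factors by (rule finite_subset)
  have "Y \<subseteq> (set I \<union> states (restr m \<delta>)) \<times> {..<d} \<times> can ` Pow (factors m d k)"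
  proof
    fix y assume "y \<in> Y"
    then obtain p w p0 where y: "y = (p, length w mod d, can (profile d k w))" "p0 \<in> set I"
      "nfa_run (restr m \<delta>) p0 w p" unfolding Y_def by blast
    have "p \<in> set I \<union> states (restr m \<delta>)"
    proof (cases "w = []")
      case False
      then show ?thesis using nfa_run_states[OF y(3)] nfa_run_start_state[OF y(3)] by blast
    qed (use y in auto)
    then show "y \<in> (set I \<union> states (restr m \<delta>)) \<times> {..<d} \<times> can ` Pow (factors m d k)"
      using y(1) d sub[OF y(3)] by auto
  qed
  then have "finite Y" by (rule finite_subset) (simp add: finite_factors)
  then obtain X where X: "set X = Y" using finite_list by blast
  have memY: "(p, length w mod d, can (profile d k w)) \<in> set X"
    if "p0 \<in> set I" "nfa_run (restr m \<delta>) p0 w p" for p0 p w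
    using that unfolding X Y_def by blast
  have "closed m I \<delta> d k X"
    unfolding closed_def
  proof (intro conjI ballI impI)
    fix p assume p: "p \<in> set I"
    have "(p, 0, can {[]}) \<in> set X" using memY[OF p, of "[]" p] by (simp add: profile_Nil)
    then show "\<exists>e\<in>set X. fst e = p \<and> fst (snd e) = 0 \<and>
        [] \<in> set (snd (snd e)) \<and> (\<forall>u\<in>set (snd (snd e)). u = [])"
      by (rule bexI[rotated]) (simp add: can)
  next
    fix e t assume e: "e \<in> set X" and t: "t \<in> set \<delta>" "fst t = fst e \<and> fst (snd t) < m"
    from e obtain p w p0 where y: "e = (p, length w mod d, can (profile d k w))" "p0 \<in> set I"
      "nfa_run (restr m \<delta>) p0 w p" unfolding X Y_def by blast
    let ?a = "fst (snd t)" and ?q = "snd (snd t)"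
    have "(p, ?a, ?q) \<in> set (restr m \<delta>)" using t y(1) by (auto simp: mem_restr)
    then have run: "nfa_run (restr m \<delta>) p0 (w @ [?a]) ?q" using y(3) by (auto simp: nfa_run_append)
    have can_snoc: "set (can (profile d k (w @ [?a]))) = profile d k w \<union>
      {(?a, length w mod d) # u | u. u \<in> profile d k w \<and> length u < k}"
      by (rule trans[OF can[OF fin[OF run]] profile_snoc])
    show "\<exists>e'\<in>set X. fst e' = snd (snd t) \<and> fst (snd e') = Suc (fst (snd e)) mod d \<and>
          (\<forall>u\<in>set (snd (snd e')). u \<in> set (snd (snd e)) \<or>
            (\<exists>u'\<in>set (snd (snd e)). length u' < k \<and> u = (fst (snd t), fst (snd e)) # u')) \<and>
          (\<forall>u\<in>set (snd (snd e)). u \<in> set (snd (snd e')) \<and>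
            (length u < k \<longrightarrow> (fst (snd t), fst (snd e)) # u \<in> set (snd (snd e'))))"
      using memY[OF y(2) run]
      by (rule bexI[rotated])
        (auto simp: y(1) can[OF fin[OF y(3)]] can_snoc mod_Suc_eq)
  qed
  moreover have "\<exists>w. \<exists>p0\<in>set I. nfa_run (restr m \<delta>) p0 w p \<and> r = length w mod d \<and> set C = profile d k w"
    if "(p, r, C) \<in> set X" for p r C
    using that can[OF fin] unfolding X Y_def by blast
  ultimately show ?thesis by blast
qed

definition apart where
  "apart F F' X Y \<longleftrightarrow> (\<forall>e\<in>set X. \<forall>e'\<in>set Y. fst e \<in> set F \<and> fst e' \<in> set F' \<and> fst (snd e) = fst (snd e') \<longrightarrow>
     \<not> ((\<forall>u\<in>set (snd (snd e)). u \<in> set (snd (snd e'))) \<and> (\<forall>u\<in>set (snd (snd e')). u \<in> set (snd (snd e)))))"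
  for F F' :: "nat list" and X Y :: "(nat \<times> nat \<times> (nat \<times> nat) list list) list"

text \<open>Residue and profile determine the equivalence class, and an invariant holds both for
  every accepted word. The witness consists of numbers and lists with a decidable condition, so it
  can be found by search.\<close>

lemma separable_iff_closed:
  "separable (BSigma1_MOD m) (nfa_lang m (I, F, \<delta>)) (nfa_lang m (I', F', \<delta>')) \<longleftrightarrow>
   (\<exists>d k X Y. 0 < d \<and> closed m I \<delta> d k X \<and> closed m I' \<delta>' d k Y \<and> apart F F' X Y)"
proof -
  let ?K = "nfa_lang m (I, F, \<delta>)" and ?L = "nfa_lang m (I', F', \<delta>')"
  have KL: "?K \<subseteq> lists {0..<m}" "?L \<subseteq> lists {0..<m}" by (auto simp: nfa_lang_def)
  show ?thesis
    unfolding separable_iff[OF KL]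
  proof (intro iffI; elim exE conjE)
    fix d k assume d: "1 \<le> d" and neq: "\<forall>w\<in>?K. \<forall>w'\<in>?L. \<not> mod_eqv d k w w'"
    then have d0: "d > 0" by simp
    obtain X where X: "closed m I \<delta> d k X" "\<And>p r C. (p, r, C) \<in> set X \<Longrightarrow> \<exists>w. \<exists>p0\<in>set I.
      nfa_run (restr m \<delta>) p0 w p \<and> r = length w mod d \<and> set C = profile d k w"
      using closed_complete[OF d0, of m I \<delta> k] by blast
    obtain Y where Y: "closed m I' \<delta>' d k Y" "\<And>p r C. (p, r, C) \<in> set Y \<Longrightarrow> \<exists>w. \<exists>p0\<in>set I'.
      nfa_run (restr m \<delta>') p0 w p \<and> r = length w mod d \<and> set C = profile d k w"
      using closed_complete[OF d0, of m I' \<delta>' k] by blast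
    have "set C \<noteq> set C'" if e: "(p, r, C) \<in> set X" "(p', r, C') \<in> set Y" "p \<in> set F" "p' \<in> set F'" for p p' r C C'
    proof -
      obtain w p0 where w: "p0 \<in> set I" "nfa_run (restr m \<delta>) p0 w p" "r = length w mod d" "set C = profile d k w"
        using X(2)[OF e(1)] by blast
      obtain w' p0' where w': "p0' \<in> set I'" "nfa_run (restr m \<delta>') p0' w' p'" "r = length w' mod d" "set C' = profile d k w'"
        using Y(2)[OF e(2)] by blast
      have "w \<in> ?K" "w' \<in> ?L" unfolding nfa_lang_restr using w w' e(3,4) by blast+
      then show ?thesis using neq w w' by (auto simp: mod_eqv_iff_profile)
    qed
    then have "apart F F' X Y" unfolding apart_def by (auto simp: set_eq_iff) blast
    then show "\<exists>d k X Y. 0 < d \<and> closed m I \<delta> d k X \<and> closed m I' \<delta>' d k Y \<and> apart F F' X Y"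
      using d0 X(1) Y(1) by blast
  next
    fix d k X Y assume d: "0 < d" and X: "closed m I \<delta> d k X" and Y: "closed m I' \<delta>' d k Y"
      and ap: "apart F F' X Y"
    have "\<not> mod_eqv d k w w'" if "w \<in> ?K" "w' \<in> ?L" for w w'
    proof
      assume eqv: "mod_eqv d k w w'"
      obtain p0 q where p: "p0 \<in> set I" "q \<in> set F" "nfa_run (restr m \<delta>) p0 w q"
        using \<open>w \<in> ?K\<close> unfolding nfa_lang_restr by blast
      obtain p0' q' where p': "p0' \<in> set I'" "q' \<in> set F'" "nfa_run (restr m \<delta>') p0' w' q'"
        using \<open>w' \<in> ?L\<close> unfolding nfa_lang_restr by blast
      obtain C where C: "(q, length w mod d, C) \<in> set X" "set C = profile d k w"
        using closed_sound[OF X p(1,3)] by blast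
      obtain C' where C': "(q', length w' mod d, C') \<in> set Y" "set C' = profile d k w'"
        using closed_sound[OF Y p'(1,3)] by blast
      show False
        using ap[unfolded apart_def, THEN bspec, OF C(1), THEN bspec, OF C'(1)] p(2) p'(2) C(2) C'(2) eqv
        by (simp add: mod_eqv_iff_profile)
    qed
    then show "\<exists>d k. 1 \<le> d \<and> (\<forall>w\<in>?K. \<forall>w'\<in>?L. \<not> mod_eqv d k w w')" using d by (auto simp: Suc_le_eq)
  qed
qed

section \<open>Enumerability of separability and of inseparability\<close>

definition sep_instance :: "nat \<times> nfa \<times> nfa \<Rightarrow> bool" where
  "sep_instance x \<longleftrightarrow> separable (BSigma1_MOD (fst x)) (nfa_lang (fst x) (fst (snd x))) (nfa_lang (fst x) (snd (snd x)))"

lemma re_pred_separable: "re_pred sep_instance"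
proof -
  have "re_pred (\<lambda>x. \<exists>d k X Y. 0 < d \<and> closed (fst x) (fst (fst (snd x))) (snd (snd (fst (snd x)))) d k X \<and>
      closed (fst x) (fst (snd (snd x))) (snd (snd (snd (snd x)))) d k Y \<and>
      apart (fst (snd (fst (snd x)))) (fst (snd (snd (snd x)))) X Y)"
    unfolding closed_def apart_def
    by (intro re_pred_ex re_pred_dec_pred dec_pred_intros computable_intros)
  moreover have "sep_instance x \<longleftrightarrow> (\<exists>d k X Y. 0 < d \<and>
      closed (fst x) (fst (fst (snd x))) (snd (snd (fst (snd x)))) d k X \<and>
      closed (fst x) (fst (snd (snd x))) (snd (snd (snd (snd x)))) d k Y \<and>
      apart (fst (snd (fst (snd x)))) (fst (snd (snd (snd x)))) X Y)" for x
    unfolding sep_instance_def separable_iff_closed[symmetric] by simp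
  ultimately show ?thesis by presburger
qed

lemma re_pred_not_separable: "re_pred (\<lambda>x. \<not> sep_instance x)"
proof -
  have "re_pred (\<lambda>x. \<exists>d p s r s' p0 r0. 0 < d \<and> p0 \<in> set (fst (fst (snd x))) \<and> r0 \<in> set (fst (snd (snd x))) \<and>
      (step (fst x) (snd (snd (fst (snd x)))) (snd (snd (snd (snd x)))) d)\<^sup>*\<^sup>* (p0, 0, r0, 0) (p, s, r, s') \<and>
      p \<in> set (fst (snd (fst (snd x)))) \<and> r \<in> set (fst (snd (snd (snd x)))) \<and> s mod d = s' mod d)"
    by (intro re_pred_ex re_pred_conj re_pred_rtranclp re_pred_step; (rule re_pred_dec_pred)?; intro dec_pred_intros computable_intros)
  moreover have "\<not> sep_instance x \<longleftrightarrow> (\<exists>d p s r s' p0 r0. 0 < d \<and> p0 \<in> set (fst (fst (snd x))) \<and> r0 \<in> set (fst (snd (snd x))) \<and>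
      (step (fst x) (snd (snd (fst (snd x)))) (snd (snd (snd (snd x)))) d)\<^sup>*\<^sup>* (p0, 0, r0, 0) (p, s, r, s') \<and>
      p \<in> set (fst (snd (fst (snd x)))) \<and> r \<in> set (fst (snd (snd (snd x)))) \<and> s mod d = s' mod d)" for x
  proof -
    obtain m I F \<delta> I' F' \<delta>' where x: "x = (m, (I, F, \<delta>), (I', F', \<delta>'))" by (metis surj_pair)
    show ?thesis
      unfolding x sep_instance_def fst_conv snd_conv separable_iff_no_reach reach_iff_steps not_not by blast
  qed
  ultimately show ?thesis by presburger
qed

lemma encode_input_eq_gnum: "encode_input m A B = gnum (m, A, B)"
proof -
  have "(\<lambda>(p, a, q). prod_encode (p, prod_encode (a, q))) = (gnum :: nat \<times> nat \<times> nat \<Rightarrow> nat)" by auto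
  then have "encode_nfa A = gnum A" for A
    by (cases A) (simp add: encode_nfa_def gnum_list_def gnum_nat_def)
  then show ?thesis by (simp add: encode_input_def)
qed

theorem mainTheorem5:
  shows "decidable_nat (\<lambda>n. \<exists>m A B. n = encode_input m A B \<and>
            separable (BSigma1_MOD m) (nfa_lang m A) (nfa_lang m B))"
proof -
  have "dec_pred sep_instance" by (rule dec_pred_of_re_pred[OF re_pred_separable re_pred_not_separable])
  then have "decidable_nat (\<lambda>n. \<exists>x. n = gnum x \<and> sep_instance x)" by (rule decidable_nat_if_dec_pred)
  then show ?thesis
    by (simp add: sep_instance_def split_paired_Ex encode_input_eq_gnum del: gnum_Pair)
qed

end
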